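(* Let $\mathcal{X}\subseteq\mathbb{R}^n$ be open and convex, $\mathcal{U}\subseteq\mathbb{R}^m$ open, $\Phi:\mathcal{X}\to\mathbb{R}^n$ a function and $B\in\mathbb{R}^{n\times m}$ a matrix such that $(x,u)\mapsto\Phi(x)+Bu$ is a surjective map from $\mathcal{X}\times\mathcal{U}$ onto $\mathcal{X}$. Run the certification algorithm described in the context on the system $x^+=\Phi(x)+Bu$. Then the algorithm terminates in at most $n$ iterations of its main loop. If the system admits an $\infty$-step linear predictor, the algorithm returns "Exists" together with an invertible matrix $T\in\mathbb{R}^{n\times n}$ such that the coordinate change $\tilde x=Tx$ puts the system in CAP form; otherwise, it returns "Does not exist", certifying that no $\infty$-step linear predictor exists.
   Context: Notation. $\mathrm{col}$ denotes vertical stacking. For inputs $u_0,\dots,u_{N-1}\in\mathcal U$ and initial state $x$, $x(N)$ is the state after $N$ steps. The system admits an $N$-step linear predictor if there are a function $\Phi_N:\mathcal{X}\to\mathbb{R}^n$ and a constant matrix $B_N\in\mathbb{R}^{n\times Nm}$ with $x(N)=\Phi_N(x)+B_N\,\mathrm{col}(u_0,\dots,u_{N-1})$ for all $x\in\mathcal{X}$ and all $u_0,\dots,u_{N-1}\in\mathcal{U}$. It admits an $\infty$-step linear predictor if it admits an $N$-step linear predictor for all $N\ge 1$. CAP form. The system in coordinates $\tilde x=\mathrm{col}(\tilde x_1,\tilde x_2)=Tx$ is in control-affine preserved (CAP) form if $\tilde x_1^+=g(\tilde x_2)+C\tilde x_1+Du$ and $\tilde x_2^+=h(\tilde x_2)$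 for all $\tilde x\in T\mathcal{X}$, $u\in\mathcal{U}$, for some functions $g,h$ and constant matrices $C,D$; either block may be empty (if $\tilde x_2$ is empty, $g$ is a constant vector). Subroutine SCD$(\Phi,B,\Gamma)$. Input: a subsystem $x^+=\Phi(x)+Bz$ with $x$ of dimension $\hat n$ (ranging over the corresponding projection of the transformed state set) and a function $\Gamma(x)$ (possibly None, i.e. absent, and then regarded as affine). Output: $(\Phi^*,B^*,\Gamma^*,T^*,\mathrm{flag})$, initialized to None with $\mathrm{flag}=0$. - If $B$ has full row rank: set $\mathrm{flag}=1$ if $\Phi$ and $\Gamma$ are both affine in $x$, and $\mathrm{flag}=2$ otherwise. - Else if $B=0$: set $\mathrm{flag}=1$. - Else: choose an invertible $\bar T$ with $\bar TB=\mathrm{col}(\bar D,0)$, $\bar D$ of full row rank; with $\mathrm{col}(x_1,x_2):=\bar Tx$ (partitioned conformally), write the dynamics as $x_1^+=f_1(x_1,x_2)+\bar Dz$, $x_2^+=f_2(x_1,x_2)$, and set $\bar\Gamma(x_1,x_2):=\Gamma(\bar T^{-1}\mathrm{col}(x_1,x_2))$. If $f_1,f_2,\bar\Gamma$ are all affine in $x_1$, in the sense that $f_1=\Phi_1(x_2)+B_1x_1$, $f_2=\Phi_2(x_2)+B_2x_1$, $\bar\Gamma=\gamma(x_2)+Cx_1$ with constant matrices $B_1,B_2,C$, then return $\Phi^*=\Phi_2$, $B^*=B_2$, $\Gamma^*=\mathrm{col}(\gamma,\Phi_1)$, $T^*=\bar T$ with $\mathrm{flag}=0$. Otherwise set $\mathrm{flag}=2$.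 Main algorithm. Input: $x^+=\Phi(x)+Bu$. Initialize $\mathrm{flag}=0$, $i=0$, $\Phi_0=\Phi$, $B_0=B$, $\Gamma_0=$ None. While $\mathrm{flag}=0$ (each pass is one iteration): let $\hat n$ be the number of rows of $B_i$; compute $(\Phi_{i+1},B_{i+1},\Gamma_{i+1},T^*,\mathrm{flag})=\mathrm{SCD}(\Phi_i,B_i,\Gamma_i)$; if $\mathrm{flag}=0$, set $T_i:=\begin{bmatrix}I_{n-\hat n}&0\\0&T^*\end{bmatrix}$ and increase $i$ by one. After the loop: if $\mathrm{flag}=1$, return "Exists" and $T=T_{i-1}T_{i-2}\cdots T_0$ (the identity if $i=0$); if $\mathrm{flag}=2$, return "Does not exist". All rank and affineness tests are assumed exact. *)

theory Defs
  imports "Jordan_Normal_Form.DL_Rank" "HOL-Library.FuncSet"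
begin

text \<open>
  The algorithm passes to subsystems of smaller and smaller dimension, so vectors and matrices
  carry their dimension in the term (\<^const>\<open>carrier_vec\<close>, \<^const>\<open>carrier_mat\<close>).
  The type of vectors has no topology; openness and convexity in $R^d$ are therefore spelled out.
\<close>

definition open_vec :: "nat \<Rightarrow> real vec set \<Rightarrow> bool" where
  "open_vec d S \<longleftrightarrow> S \<subseteq> carrier_vec d \<and>
    (\<forall>x\<in>S. \<exists>e>0. \<forall>y\<in>carrier_vec d. sqrt ((y - x) \<bullet> (y - x)) < e \<longrightarrow> y \<in> S)"

definition convex_vec :: "real vec set \<Rightarrow> bool" where
  "convex_vec S \<longleftrightarrow>
    (\<forall>x\<in>S. \<forall>y\<in>S. \<forall>t. 0 \<le> t \<and> t \<le> 1 \<longrightarrow> (1 - t) \<cdot>\<^sub>v x + t \<cdot>\<^sub>v y \<in> S)"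

definition full_row_rank :: "real mat \<Rightarrow> bool" where
  "full_row_rank A \<longleftrightarrow> vec_space.rank (dim_row A) A = dim_row A"


subsection \<open>Linear predictors\<close>

definition stack_vecs :: "real vec list \<Rightarrow> real vec" where
  "stack_vecs us = foldr (@\<^sub>v) us vNil"

definition state_after :: "(real vec \<Rightarrow> real vec) \<Rightarrow> real mat \<Rightarrow> real vec \<Rightarrow> real vec list \<Rightarrow> real vec" where
  "state_after \<Phi> B x us = foldl (\<lambda>x u. \<Phi> x + B *\<^sub>v u) x us"

definition admits_predictor ::
  "nat \<Rightarrow> nat \<Rightarrow> real vec set \<Rightarrow> real vec set \<Rightarrow> (real vec \<Rightarrow> real vec) \<Rightarrow> real mat \<Rightarrow> nat \<Rightarrow> bool" where
  "admits_predictor n m X U \<Phi> B N \<longleftrightarrow>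
    (\<exists>\<Phi>N \<in> X \<rightarrow> carrier_vec n. \<exists>BN \<in> carrier_mat n (N * m).
      \<forall>x\<in>X. \<forall>us. length us = N \<and> set us \<subseteq> U \<longrightarrow>
        state_after \<Phi> B x us = \<Phi>N x + BN *\<^sub>v stack_vecs us)"

definition admits_inf_predictor ::
  "nat \<Rightarrow> nat \<Rightarrow> real vec set \<Rightarrow> real vec set \<Rightarrow> (real vec \<Rightarrow> real vec) \<Rightarrow> real mat \<Rightarrow> bool" where
  "admits_inf_predictor n m X U \<Phi> B \<longleftrightarrow> (\<forall>N\<ge>1. admits_predictor n m X U \<Phi> B N)"


subsection \<open>Control-affine preserved form\<close>

text \<open>
  If \<open>n2 = 0\<close> then \<open>g\<close> is only ever applied to the unique vector of dimension 0,
  so it is a constant vector.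
\<close>

definition cap_form ::
  "nat \<Rightarrow> nat \<Rightarrow> real vec set \<Rightarrow> real vec set \<Rightarrow> (real vec \<Rightarrow> real vec) \<Rightarrow> real mat \<Rightarrow> real mat \<Rightarrow> bool" where
  "cap_form n m X U \<Phi> B T \<longleftrightarrow>
    (\<exists>n1 n2. n1 + n2 = n \<and>
      (\<exists>g \<in> carrier_vec n2 \<rightarrow> carrier_vec n1. \<exists>h \<in> carrier_vec n2 \<rightarrow> carrier_vec n2.
       \<exists>C \<in> carrier_mat n1 n1. \<exists>D \<in> carrier_mat n1 m.
        \<forall>x\<in>X. \<forall>u\<in>U. \<forall>x1\<in>carrier_vec n1. \<forall>x2\<in>carrier_vec n2. T *\<^sub>v x = x1 @\<^sub>v x2 \<longrightarrow>
          T *\<^sub>v (\<Phi> x + B *\<^sub>v u) = (g x2 + C *\<^sub>v x1 + D *\<^sub>v u) @\<^sub>v h x2))"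


subsection \<open>The subroutine SCD\<close>

definition affine_map_on :: "nat \<Rightarrow> real vec set \<Rightarrow> (real vec \<Rightarrow> real vec) \<Rightarrow> bool" where
  "affine_map_on d S F \<longleftrightarrow>
    (\<exists>k. \<exists>c \<in> carrier_vec k. \<exists>A \<in> carrier_mat k d. \<forall>x\<in>S. F x = c + A *\<^sub>v x)"

text \<open>
  Projection of \<open>Y\<close>, a subset of $R^r \times R^s$, to the second block of coordinates.
\<close>

definition proj_second :: "nat \<Rightarrow> nat \<Rightarrow> real vec set \<Rightarrow> real vec set" where
  "proj_second r s Y = {x2 \<in> carrier_vec s. \<exists>x1 \<in> carrier_vec r. x1 @\<^sub>v x2 \<in> Y}"

text \<open>
  $f(x_1,x_2) = \varphi(x_2) + M x_1$ on \<open>Y\<close>, with $x_1 \in R^r$, $x_2 \in R^s$ and values in $R^k$;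
  \<open>f\<close> takes the stacked vector as its argument.
\<close>

definition affine_in_first ::
  "nat \<Rightarrow> nat \<Rightarrow> nat \<Rightarrow> real vec set \<Rightarrow> (real vec \<Rightarrow> real vec) \<Rightarrow> (real vec \<Rightarrow> real vec) \<Rightarrow> real mat \<Rightarrow> bool" where
  "affine_in_first k r s Y f \<phi> M \<longleftrightarrow>
    \<phi> \<in> proj_second r s Y \<rightarrow> carrier_vec k \<and> M \<in> carrier_mat k r \<and>
    (\<forall>x1\<in>carrier_vec r. \<forall>x2\<in>carrier_vec s. x1 @\<^sub>v x2 \<in> Y \<longrightarrow>
      f (x1 @\<^sub>v x2) = \<phi> x2 + M *\<^sub>v x1)"

text \<open>
  \<open>T\<close> is an admissible choice of the coordinate change, with inverse \<open>Ti\<close>.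
\<close>

definition scd_coords :: "real mat \<Rightarrow> real mat \<Rightarrow> real mat \<Rightarrow> real mat \<Rightarrow> bool" where
  "scd_coords B T Ti D \<longleftrightarrow>
    T \<in> carrier_mat (dim_row B) (dim_row B) \<and> Ti \<in> carrier_mat (dim_row B) (dim_row B) \<and>
    inverts_mat T Ti \<and> inverts_mat Ti T \<and>
    dim_row D \<le> dim_row B \<and> dim_col D = dim_col B \<and> full_row_rank D \<and>
    T * B = D @\<^sub>r 0\<^sub>m (dim_row B - dim_row D) (dim_col B)"

text \<open>
  Here \<open>r\<close> and \<open>s\<close> are the dimensions of $x_1$ and $x_2$. An absent $\Gamma$ imposes no condition
  and contributes no rows to $\Gamma^*$.
\<close>

definition scd_affine ::
  "nat \<Rightarrow> nat \<Rightarrow> real vec set \<Rightarrow> (real vec \<Rightarrow> real vec) \<Rightarrow> (real vec \<Rightarrow> real vec) option \<Rightarrow>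
   real mat \<Rightarrow> real mat \<Rightarrow> (real vec \<Rightarrow> real vec) \<Rightarrow> real mat \<Rightarrow> (real vec \<Rightarrow> real vec) \<Rightarrow> bool" where
  "scd_affine r s S \<Phi> \<Gamma> T Ti \<Phi>2 B2 \<Gamma>' \<longleftrightarrow>
    (let Y = (*\<^sub>v) T ` S;
         f1 = (\<lambda>y. vec_first (T *\<^sub>v \<Phi> (Ti *\<^sub>v y)) r);
         f2 = (\<lambda>y. vec_last (T *\<^sub>v \<Phi> (Ti *\<^sub>v y)) s)
     in \<exists>\<Phi>1 B1. affine_in_first r r s Y f1 \<Phi>1 B1 \<and> affine_in_first s r s Y f2 \<Phi>2 B2 \<and>
          (case \<Gamma> of
             None \<Rightarrow> \<Gamma>' = \<Phi>1
           | Some G \<Rightarrow> (\<exists>k \<gamma> C. affine_in_first k r s Y (\<lambda>y. G (Ti *\<^sub>v y)) \<gamma> C \<and>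
               \<Gamma>' = (\<lambda>x2. \<gamma> x2 @\<^sub>v \<Phi>1 x2))))"

text \<open>
  \<open>Flag0\<close> carries \<open>\<Phi>\<^sup>*\<close>, \<open>B\<^sup>*\<close>, \<open>\<Gamma>\<^sup>*\<close>, \<open>T\<^sup>*\<close>; with the other flags these outputs stay unset.
\<close>

datatype scd_output =
    Flag0 "real vec \<Rightarrow> real vec" "real mat" "(real vec \<Rightarrow> real vec) option" "real mat"
  | Flag1
  | Flag2

text \<open>
  The coordinate change is an arbitrary choice, so SCD is a relation between inputs and possible
  outputs. The set \<open>S\<close> is the domain of the subsystem.
\<close>

inductive SCD ::
  "real vec set \<Rightarrow> (real vec \<Rightarrow> real vec) \<Rightarrow> real mat \<Rightarrow> (real vec \<Rightarrow> real vec) option \<Rightarrow> scd_output \<Rightarrow> bool"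
where
  full_rank_affine:
    "\<lbrakk>full_row_rank B;
      affine_map_on (dim_row B) S \<Phi> \<and> pred_option (affine_map_on (dim_row B) S) \<Gamma>\<rbrakk>
     \<Longrightarrow> SCD S \<Phi> B \<Gamma> Flag1"
| full_rank_not_affine:
    "\<lbrakk>full_row_rank B;
      \<not> (affine_map_on (dim_row B) S \<Phi> \<and> pred_option (affine_map_on (dim_row B) S) \<Gamma>)\<rbrakk>
     \<Longrightarrow> SCD S \<Phi> B \<Gamma> Flag2"
| zero:
    "\<lbrakk>\<not> full_row_rank B; B = 0\<^sub>m (dim_row B) (dim_col B)\<rbrakk> \<Longrightarrow> SCD S \<Phi> B \<Gamma> Flag1"
| split_affine:
    "\<lbrakk>\<not> full_row_rank B; B \<noteq> 0\<^sub>m (dim_row B) (dim_col B); scd_coords B T Ti D;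
      scd_affine (dim_row D) (dim_row B - dim_row D) S \<Phi> \<Gamma> T Ti \<Phi>2 B2 \<Gamma>'\<rbrakk>
     \<Longrightarrow> SCD S \<Phi> B \<Gamma> (Flag0 \<Phi>2 B2 (Some \<Gamma>') T)"
| split_not_affine:
    "\<lbrakk>\<not> full_row_rank B; B \<noteq> 0\<^sub>m (dim_row B) (dim_col B); scd_coords B T Ti D;
      \<not> (\<exists>\<Phi>2 B2 \<Gamma>'. scd_affine (dim_row D) (dim_row B - dim_row D) S \<Phi> \<Gamma> T Ti \<Phi>2 B2 \<Gamma>')\<rbrakk>
     \<Longrightarrow> SCD S \<Phi> B \<Gamma> Flag2"


subsection \<open>The main loop\<close>

datatype result = Exists "real mat" | Does_not_exist

text \<open>
  \<open>Running S \<Phi> B \<Gamma> T\<close> is the state at the head of the loop: the current subsystem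
  \<open>\<Phi>\<^sub>i\<close>, \<open>B\<^sub>i\<close>, \<open>\<Gamma>\<^sub>i\<close> with its domain \<open>S\<close>, and the product \<open>T = T\<^bsub>i-1\<^esub> \<cdots> T\<^sub>0\<close> accumulated so far.
\<close>

datatype alg_state =
    Running "real vec set" "real vec \<Rightarrow> real vec" "real mat" "(real vec \<Rightarrow> real vec) option" "real mat"
  | Returned result

definition alg_init :: "nat \<Rightarrow> real vec set \<Rightarrow> (real vec \<Rightarrow> real vec) \<Rightarrow> real mat \<Rightarrow> alg_state" where
  "alg_init n X \<Phi> B = Running X \<Phi> B None (1\<^sub>m n)"

definition block_id :: "nat \<Rightarrow> real mat \<Rightarrow> real mat" where
  "block_id k T = four_block_mat (1\<^sub>m k) (0\<^sub>m k (dim_col T)) (0\<^sub>m (dim_row T) k) T"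

text \<open>
  One step is one iteration of the loop; an iteration that sets the flag to 1 or 2 includes the
  subsequent return.
\<close>

inductive iteration :: "nat \<Rightarrow> alg_state \<Rightarrow> alg_state \<Rightarrow> bool" for n :: nat where
  "SCD S \<Phi> B \<Gamma> (Flag0 \<Phi>' B' \<Gamma>' Ts)
   \<Longrightarrow> iteration n (Running S \<Phi> B \<Gamma> T)
        (Running (proj_second (dim_row B - dim_row B') (dim_row B') ((*\<^sub>v) Ts ` S)) \<Phi>' B' \<Gamma>'
          (block_id (n - dim_row B) Ts * T))"
| "SCD S \<Phi> B \<Gamma> Flag1 \<Longrightarrow> iteration n (Running S \<Phi> B \<Gamma> T) (Returned (Exists T))"
| "SCD S \<Phi> B \<Gamma> Flag2 \<Longrightarrow> iteration n (Running S \<Phi> B \<Gamma> T) (Returned Does_not_exist)"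

text \<open>
  Every run, whatever the choices made, reaches a return within \<open>k\<close> iterations: no run is longer
  than that, and no run gets stuck before returning.
\<close>

definition terminates_within :: "nat \<Rightarrow> nat \<Rightarrow> alg_state \<Rightarrow> bool" where
  "terminates_within k n s0 \<longleftrightarrow>
    (\<forall>j s. (iteration n ^^ j) s0 s \<longrightarrow> j \<le> k) \<and>
    (\<forall>s. (iteration n)\<^sup>*\<^sup>* s0 s \<longrightarrow> (\<exists>res. s = Returned res) \<or> (\<exists>s'. iteration n s s'))"

definition returns :: "nat \<Rightarrow> alg_state \<Rightarrow> result \<Rightarrow> bool" where
  "returns n s0 res \<longleftrightarrow> (iteration n)\<^sup>*\<^sup>* s0 (Returned res)"

end

theory Submission
  imports Defs
begin

text \<open>
  Suppose that all predictors exist, and let \<open>B\<^sub>N\<close> be the matrix of the \<open>N\<close>-step predictor. Every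
  state is reached from some other one in \<open>N\<close> steps, and perturbing the \<open>N\<close> inputs there shows that
  \<open>\<Phi>\<close> is locally affine along the range of \<open>B\<^sub>N\<close>, with a slope that does not depend on the state;
  convexity makes this global. The ranges of all \<open>B\<^sub>N\<close> form a subspace \<open>W\<close> that contains the range
  of \<open>B\<close> and is mapped into itself by the slope.

  The algorithm splits off coordinate blocks \<open>w\<close> such that \<open>T x = w @\<^sub>v z\<close>, where $w^+$ is affine
  in $(w,u)$ up to a function of \<open>z\<close>, and \<open>z\<close> evolves as a subsystem driven by the last block of
  \<open>w\<close>. By induction the split-off directions lie in \<open>W\<close>, and so do the directions in which the
  input moves the subsystem; hence all affineness tests succeed if the predictors exist. Conversely,
  an exit with flag 1 means that the subsystem is autonomous or that everything is affine, which is
  the CAP form, and iterating the CAP form yields predictors of every length.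
\<close>

text \<open>No regularity of \<open>\<Phi>\<close> is given, so every slope has to come from
  comparing trajectories. The functions of a later subsystem are worse still: they are known only on
  a projection of the transformed state set. Hence no affineness is proved inside a subsystem. Two
  points of its domain are lifted to states in \<open>X\<close>, the difference of the lifts is
  decomposed into elements of \<open>W\<close>, and the slope of \<open>\<Phi>\<close> is used
  there. The lifts may disagree in the split-off block, because that part of the difference lies in
  \<open>W\<close> too. For \<open>W\<close> only closure properties matter; it is the nonlinear
  counterpart of the reachable subspace. It passes from one subsystem to the next because the input
  of a subsystem can be prescribed: every vector of its input space has the form E w + F u. The
  negative answer needs no impossibility argument about predictors: it is shown to exclude every
  \<open>W\<close>, and the positive answer carries the CAP form. The coordinates of a pass are a
  free choice, so all facts are proved for every choice. The hypotheses allow \<open>X = {}\<close>;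
  predictors then exist trivially, no trajectory is available, and this case is treated
  apart.\<close>

section \<open>Full row rank and the coordinates that split a subsystem\<close>

text \<open>Rank is the dimension of the column span, so for maximal rank a maximal independent set
  of columns is already a basis of the whole space. In this form full rank supplies inputs with a
  prescribed image.\<close>

lemma full_row_rank_iff_surj:
  "full_row_rank A \<longleftrightarrow> (\<forall>y\<in>carrier_vec (dim_row A). \<exists>x\<in>carrier_vec (dim_col A). A *\<^sub>v x = y)"
proof -
  obtain n where n: "dim_row A = n" by blast
  interpret vec_space "TYPE(real)" n .
  have A: "A \<in> carrier_mat n (dim_col A)" using n by auto
  have cols: "set (cols A) \<subseteq> carrier V" using cols_dim[of A] unfolding n module_vec_simps .
  have span: "span (set (cols A)) = {y\<in>carrier_vec n. \<exists>x\<in>carrier_vec (dim_col A). A *\<^sub>v x = y}"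
    using col_space_eq[OF A] unfolding col_space_def n .
  have "rank A = n \<longleftrightarrow> span (set (cols A)) = carrier_vec n"
  proof
    assume rk: "rank A = n"
    let ?P = "\<lambda>T. T \<subseteq> set (cols A) \<and> lin_indpt T"
    obtain S where S: "maximal S ?P"
      using maximal_exists_superset[of "set (cols A)" ?P "{}"] lin_dep_def by force
    have "card S = n" using rank_card_indpt[OF A S] rk by simp
    moreover have Ss: "S \<subseteq> set (cols A)" "lin_indpt S" using S unfolding maximal_def by auto
    ultimately have "basis S"
      using cols by (intro dim_li_is_basis) (auto simp: dim_is_n dest: finite_subset)
    then have "span S = carrier V" by (simp add: basis_def)
    with span_is_monotone[OF Ss(1)] span show "span (set (cols A)) = carrier_vec n" by auto
  next
    assume "span (set (cols A)) = carrier_vec n"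
    then have "span_vs (set (cols A)) = V" by (simp add: module_vec_def)
    then show "rank A = n" unfolding rank_def by (simp add: dim_is_n)
  qed
  then show ?thesis unfolding full_row_rank_def n span by blast
qed

text \<open>The slopes of \<open>\<Phi>\<close> arise as a function that is linear on a carrier set
  only, while the affineness tests ask for a constant matrix.\<close>

lemma linear_fun_as_mat:
  fixes f :: "real vec \<Rightarrow> real vec"
  assumes f: "\<And>v. v \<in> carrier_vec a \<Longrightarrow> f v \<in> carrier_vec b"
    and add: "\<And>v w. v \<in> carrier_vec a \<Longrightarrow> w \<in> carrier_vec a \<Longrightarrow> f (v + w) = f v + f w"
    and smult: "\<And>c v. v \<in> carrier_vec a \<Longrightarrow> f (c \<cdot>\<^sub>v v) = c \<cdot>\<^sub>v f v"
  obtains M where "M \<in> carrier_mat b a" "\<And>v. v \<in> carrier_vec a \<Longrightarrow> f v = M *\<^sub>v v"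
proof -
  define M where "M = mat b a (\<lambda>(i, j). f (unit_vec a j) $ i)"
  have M: "M \<in> carrier_mat b a" by (simp add: M_def)
  \<comment> \<open>Induction on the number of coordinates kept adds one unit vector at a time and
    thereby avoids finite sums of vectors.\<close>
  have trunc: "f (vec a (\<lambda>i. if i < k then v $ i else 0)) = vec b (\<lambda>i. \<Sum>j<k. v $ j * f (unit_vec a j) $ i)"
    if "k \<le> a" for k and v :: "real vec"
    using that
  proof (induction k)
    case 0
    have "f (0 \<cdot>\<^sub>v 0\<^sub>v a) = 0 \<cdot>\<^sub>v f (0\<^sub>v a)" by (rule smult) simp
    moreover have "vec a (\<lambda>i. if i < 0 then v $ i else 0) = 0 \<cdot>\<^sub>v 0\<^sub>v a" by auto
    ultimately show ?case using f[of "0\<^sub>v a"] by auto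
  next
    case (Suc k)
    let ?t = "\<lambda>k. vec a (\<lambda>i. if i < k then v $ i else 0)"
    have "?t (Suc k) = ?t k + v $ k \<cdot>\<^sub>v unit_vec a k"
      using Suc.prems by (intro eq_vecI) (auto simp: unit_vec_def less_Suc_eq)
    then have "f (?t (Suc k)) = f (?t k) + v $ k \<cdot>\<^sub>v f (unit_vec a k)"
      using add smult by simp
    also have "\<dots> = vec b (\<lambda>i. \<Sum>j<Suc k. v $ j * f (unit_vec a j) $ i)"
      using f[of "unit_vec a k"] Suc by auto
    finally show ?case .
  qed
  have "f v = M *\<^sub>v v" if v: "v \<in> carrier_vec a" for v
  proof -
    have "vec a (\<lambda>i. if i < a then v $ i else 0) = v" using v by auto
    with trunc[of a v] have "f v = vec b (\<lambda>i. \<Sum>j<a. v $ j * f (unit_vec a j) $ i)" by simp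
    also have "\<dots> = M *\<^sub>v v"
      using v by (auto simp: M_def scalar_prod_def lessThan_atLeast0 mult.commute)
    finally show ?thesis .
  qed
  with M show ?thesis using that by blast
qed

text \<open>Gauss-Jordan elimination gives one admissible choice: in row echelon form the nonzero
  rows come first, and their pivots make them independent.\<close>

lemma scd_coords_exist:
  fixes B :: "real mat"
  shows "\<exists>T Ti D. scd_coords B T Ti D"
proof -
  define k m where "k = dim_row B" and "m = dim_col B"
  have B: "B \<in> carrier_mat k m" by (simp add: k_def m_def)
  obtain T Ti C where C: "C \<in> carrier_mat k m" "row_echelon_form C" "C = T * B"
    and T: "T \<in> carrier_mat k k" "Ti \<in> carrier_mat k k" "T * Ti = 1\<^sub>m k" "Ti * T = 1\<^sub>m k"
    using gauss_jordan_single[OF B refl] by metis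
  obtain f where "pivot_fun C f m" using C by (auto simp: row_echelon_form_def)
  note piv = pivot_funD[OF carrier_matD(1)[OF C(1)] this]
  \<comment> \<open>The pivot function has the value \<open>m\<close> on zero rows, so
    \<open>r\<close> counts the nonzero rows.\<close>
  define r where "r = (LEAST i. i = k \<or> f i = m)"
  have r: "r = k \<or> f r = m" "r \<le> k" and below: "\<And>i. i < r \<Longrightarrow> f i \<noteq> m"
    unfolding r_def using LeastI[of "\<lambda>i. i = k \<or> f i = m" k] Least_le[of "\<lambda>i. i = k \<or> f i = m" k]
    by (auto dest: not_less_Least)
  have above: "f i = m" if "r \<le> i" "i < k" for i
    using that
  proof (induction i rule: dec_induct)
    case base
    then show ?case using r by auto
  next
    case (step i)
    then show ?case using piv(1)[of "Suc i"] piv(3)[of i] by force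
  qed
  have zero: "C $$ (i, j) = 0" if "r \<le> i" "i < k" "j < m" for i j
    using piv(2)[of i j] above[OF that(1,2)] that by auto
  have fm: "f i < m" if "i < r" for i using piv(1)[of i] below[OF that] that r(2) by force
  define D where "D = mat r m (\<lambda>(i, j). C $$ (i, j))"
  have D: "D \<in> carrier_mat r m" by (simp add: D_def)
  have inj: "i = i'" if "i < r" "i' < r" "f i = f i'" for i i'
    using that piv(4)[of i] piv(5)[of i' i] fm r(2) by (metis less_le_trans one_neq_zero)
  have "full_row_rank D"
    unfolding full_row_rank_iff_surj
  proof
    fix y :: "real vec" assume "y \<in> carrier_vec (dim_row D)"
    then have y: "y \<in> carrier_vec r" by (simp add: D_def)
    \<comment> \<open>A solution of D x = y supported on the pivot columns: the entry
      \<open>y $ i\<close> goes to the pivot column of row \<open>i\<close>, in which all other rows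
      vanish.\<close>
    define g where "g j = (if \<exists>i<r. f i = j then y $ (THE i. i < r \<and> f i = j) else 0)" for j
    have g: "g (f i) = y $ i" if "i < r" for i
    proof -
      have "(THE i'. i' < r \<and> f i' = f i) = i" using that inj by blast
      then show ?thesis using that by (auto simp: g_def)
    qed
    have g0: "g j = 0" if "j \<notin> f ` {..<r}" for j using that by (auto simp: g_def)
    have "D *\<^sub>v vec m g = y"
    proof (rule eq_vecI)
      fix i assume "i < dim_vec y"
      then have i: "i < r" using y by simp
      have "(D *\<^sub>v vec m g) $ i = (\<Sum>j<m. C $$ (i, j) * g j)"
        using i by (simp add: D_def scalar_prod_def lessThan_atLeast0)
      also have "\<dots> = (\<Sum>j\<in>f ` {..<r}. C $$ (i, j) * g j)"
        using fm g0 by (intro sum.mono_neutral_right) auto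
      also have "\<dots> = (\<Sum>i'<r. C $$ (i, f i') * y $ i')"
        using inj g by (subst sum.reindex) (auto simp: inj_on_def)
      also have "\<dots> = (\<Sum>i'<r. if i' = i then y $ i' else 0)"
        using piv(4,5) fm i r(2) by (intro sum.cong) auto
      also have "\<dots> = y $ i" using i by simp
      finally show "(D *\<^sub>v vec m g) $ i = y $ i" .
    qed (use y in \<open>simp add: D_def\<close>)
    then show "\<exists>x\<in>carrier_vec (dim_col D). D *\<^sub>v x = y" by (auto simp: D_def)
  qed
  moreover have "C = D @\<^sub>r 0\<^sub>m (k - r) m"
    using C(1) r(2) zero by (intro eq_matI) (auto simp: D_def append_rows_def)
  ultimately show ?thesis
    using T C(3) r(2) D unfolding scd_coords_def inverts_mat_def k_def m_def
    by (intro exI[of _ T] exI[of _ Ti] exI[of _ D]) auto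
qed

section \<open>Stacked input sequences, their perturbations, and open sets\<close>

lemma append_vec_assoc: "(a @\<^sub>v b) @\<^sub>v c = a @\<^sub>v b @\<^sub>v c"
  by (rule eq_vecI) auto

lemma append_vec_smult: "c \<cdot>\<^sub>v (a @\<^sub>v b) = c \<cdot>\<^sub>v a @\<^sub>v c \<cdot>\<^sub>v b"
  by (rule eq_vecI) auto

lemma stack_vecs_Nil [simp]: "stack_vecs [] = vNil"
  and stack_vecs_Cons [simp]: "stack_vecs (u # us) = u @\<^sub>v stack_vecs us"
  by (simp_all add: stack_vecs_def)

lemma stack_vecs_carrier:
  "set us \<subseteq> carrier_vec m \<Longrightarrow> stack_vecs us \<in> carrier_vec (length us * m)"
  by (induction us) auto

lemma stack_vecs_snoc: "stack_vecs (us @ [u]) = stack_vecs us @\<^sub>v u"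
  by (induction us) (auto simp: append_vec_assoc)

text \<open>The base point is \<open>us\<close>, the direction \<open>vs\<close>. Lists are kept
  because \<open>U\<close> constrains each single input, whereas a predictor sees only the
  stack.\<close>

definition perturb :: "real \<Rightarrow> real vec list \<Rightarrow> real vec list \<Rightarrow> real vec list" where
  "perturb t vs us = map2 (\<lambda>u v. u + t \<cdot>\<^sub>v v) us vs"

lemma length_perturb [simp]: "length us = length vs \<Longrightarrow> length (perturb t vs us) = length vs"
  by (simp add: perturb_def)

lemma perturb_carrier:
  assumes "length us = length vs" "set us \<subseteq> carrier_vec m" "set vs \<subseteq> carrier_vec m"
  shows "set (perturb t vs us) \<subseteq> carrier_vec m"
  using assms unfolding perturb_def by (induction us vs rule: list_induct2) auto

lemma stack_vecs_perturb:
  assumes "length us = length vs" "set us \<subseteq> carrier_vec m" "set vs \<subseteq> carrier_vec m"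
  shows "stack_vecs (perturb t vs us) = stack_vecs us + t \<cdot>\<^sub>v stack_vecs vs"
  using assms unfolding perturb_def
proof (induction us vs rule: list_induct2)
  case (Cons u us v vs)
  then have "stack_vecs us \<in> carrier_vec (length vs * m)" "stack_vecs vs \<in> carrier_vec (length vs * m)"
    using stack_vecs_carrier[of us m] stack_vecs_carrier[of vs m] by auto
  then show ?case
    using Cons append_vec_add[of u m "t \<cdot>\<^sub>v v" "stack_vecs us" "length vs * m" "t \<cdot>\<^sub>v stack_vecs vs"]
    by (simp add: append_vec_smult)
qed auto

lemma open_vec_ray:
  assumes "open_vec d S" "x \<in> S" "v \<in> carrier_vec d"
  obtains e where "e > 0" "\<And>t. \<bar>t\<bar> < e \<Longrightarrow> x + t \<cdot>\<^sub>v v \<in> S"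
proof -
  obtain e where e: "e > 0"
    and ball: "\<And>y. y \<in> carrier_vec d \<Longrightarrow> sqrt ((y - x) \<bullet> (y - x)) < e \<Longrightarrow> y \<in> S"
    and x: "x \<in> carrier_vec d"
    using assms unfolding open_vec_def by blast
  define q where "q = sqrt (v \<bullet> v)"
  have "v \<bullet> v \<ge> 0" by (auto simp: scalar_prod_def intro: sum_nonneg)
  then have q: "q \<ge> 0" by (simp add: q_def)
  \<comment> \<open>The radius is divided by \<open>q + 1\<close> rather than by the norm
    \<open>q\<close>, which may be 0.\<close>
  have "x + t \<cdot>\<^sub>v v \<in> S" if "\<bar>t\<bar> < e / (q + 1)" for t
  proof (rule ball)
    have "x + t \<cdot>\<^sub>v v - x = t \<cdot>\<^sub>v v" using x assms(3) by auto
    then have "sqrt ((x + t \<cdot>\<^sub>v v - x) \<bullet> (x + t \<cdot>\<^sub>v v - x)) = \<bar>t\<bar> * q"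
      using assms(3) by (simp add: q_def real_sqrt_mult flip: mult.assoc)
    also have "\<dots> \<le> \<bar>t\<bar> * (q + 1)" by (simp add: mult_left_mono)
    also have "\<dots> < e" using that q by (simp add: field_simps)
    finally show "sqrt ((x + t \<cdot>\<^sub>v v - x) \<bullet> (x + t \<cdot>\<^sub>v v - x)) < e" .
  qed (use x assms(3) in auto)
  moreover have "e / (q + 1) > 0" using e q by simp
  ultimately show ?thesis using that by blast
qed

lemma open_vec_perturb:
  assumes "open_vec m U" "length us = length vs" "set us \<subseteq> U" "set vs \<subseteq> carrier_vec m"
  shows "\<exists>e>0. \<forall>t. \<bar>t\<bar> < e \<longrightarrow> set (perturb t vs us) \<subseteq> U"
  using assms(2-4) unfolding perturb_def
proof (induction us vs rule: list_induct2)
  case Nil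
  then show ?case by (auto intro: exI[of _ 1])
next
  case (Cons u us v vs)
  obtain e where e: "e > 0" "\<And>t. \<bar>t\<bar> < e \<Longrightarrow> set (map2 (\<lambda>u v. u + t \<cdot>\<^sub>v v) us vs) \<subseteq> U"
    using Cons by auto
  obtain e' where e': "e' > 0" "\<And>t. \<bar>t\<bar> < e' \<Longrightarrow> u + t \<cdot>\<^sub>v v \<in> U"
    using open_vec_ray[OF assms(1), of u v] Cons.prems by auto
  show ?case using e e' by (intro exI[of _ "min e e'"]) auto
qed

text \<open>Slopes are identified in this way, from a single nonzero step \<open>t\<close> that an
  open set permits.\<close>

lemma smult_vec_cancel:
  fixes a b :: "real vec"
  assumes "c + t \<cdot>\<^sub>v a = c + t \<cdot>\<^sub>v b" "t \<noteq> 0"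
    "a \<in> carrier_vec k" "b \<in> carrier_vec k" "c \<in> carrier_vec k"
  shows "a = b"
proof (rule eq_vecI)
  fix i assume "i < dim_vec b"
  then have i: "i < k" using assms(4) by simp
  have "(c + t \<cdot>\<^sub>v a) $ i = (c + t \<cdot>\<^sub>v b) $ i" using assms(1) by simp
  then show "a $ i = b $ i" using assms(2-5) i by simp
qed (use assms in auto)

lemma state_after_Nil [simp]: "state_after \<Phi> B x [] = x"
  and state_after_Cons [simp]: "state_after \<Phi> B x (u # us) = state_after \<Phi> B (\<Phi> x + B *\<^sub>v u) us"
  and state_after_snoc [simp]:
    "state_after \<Phi> B x (us @ [u]) = \<Phi> (state_after \<Phi> B x us) + B *\<^sub>v u"
  by (simp_all add: state_after_def)

section \<open>Directions along which the system is affine\<close>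

locale control_system =
  fixes n m :: nat and X U :: "real vec set" and \<Phi> :: "real vec \<Rightarrow> real vec" and B :: "real mat"
  assumes X_open: "open_vec n X"
    and X_convex: "convex_vec X"
    and U_open: "open_vec m U"
    and \<Phi>_carrier: "\<Phi> \<in> X \<rightarrow> carrier_vec n"
    and B_carrier: "B \<in> carrier_mat n m"
    and onto: "(\<lambda>(x, u). \<Phi> x + B *\<^sub>v u) ` (X \<times> U) = X"
begin

lemma X_carrier: "x \<in> X \<Longrightarrow> x \<in> carrier_vec n"
  using X_open by (auto simp: open_vec_def)

lemma U_carrier: "u \<in> U \<Longrightarrow> u \<in> carrier_vec m"
  using U_open by (auto simp: open_vec_def)

lemma step_in_X: "x \<in> X \<Longrightarrow> u \<in> U \<Longrightarrow> \<Phi> x + B *\<^sub>v u \<in> X"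
  using onto by force

lemma step_onto: "y \<in> X \<Longrightarrow> \<exists>x\<in>X. \<exists>u\<in>U. y = \<Phi> x + B *\<^sub>v u"
  using onto by force

lemma state_after_in_X: "x \<in> X \<Longrightarrow> set us \<subseteq> U \<Longrightarrow> state_after \<Phi> B x us \<in> X"
  by (induction us arbitrary: x) (auto simp: step_in_X)

lemma state_after_onto:
  assumes "y \<in> X"
  shows "\<exists>x\<in>X. \<exists>us. length us = N \<and> set us \<subseteq> U \<and> state_after \<Phi> B x us = y"
  using assms
proof (induction N arbitrary: y)
  case (Suc N)
  obtain x u where xu: "x \<in> X" "u \<in> U" "y = \<Phi> x + B *\<^sub>v u" using step_onto[OF Suc.prems] by blast
  obtain x0 us where "x0 \<in> X" "length us = N" "set us \<subseteq> U" "state_after \<Phi> B x0 us = x"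
    using Suc.IH[OF xu(1)] by blast
  with xu show ?case by (intro bexI[of _ x0] exI[of _ "us @ [u]"]) auto
qed auto

text \<open>One slope \<open>d\<close> serves all states \<open>y\<close> and all steps
  \<open>t\<close>. This uniformity is what makes the matrices in the affineness tests
  constant.\<close>

definition affine_direction :: "real vec \<Rightarrow> real vec \<Rightarrow> bool" where
  "affine_direction w d \<longleftrightarrow> w \<in> carrier_vec n \<and> d \<in> carrier_vec n \<and>
    (\<forall>y\<in>X. \<forall>t. y + t \<cdot>\<^sub>v w \<in> X \<longrightarrow> \<Phi> (y + t \<cdot>\<^sub>v w) = \<Phi> y + t \<cdot>\<^sub>v d)"

text \<open>On the segment from y to y + t w, each coordinate of \<open>\<Phi>\<close> minus its
  expected growth is locally constant; so it has derivative 0 and is constant. Differentiability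
  along the line is a consequence of local affineness, not an assumption.\<close>

lemma affine_direction_if_local:
  assumes w: "w \<in> carrier_vec n" and d: "d \<in> carrier_vec n"
    and loc: "\<And>y. y \<in> X \<Longrightarrow> \<exists>e>0. \<forall>t. \<bar>t\<bar> < e \<longrightarrow> \<Phi> (y + t \<cdot>\<^sub>v w) = \<Phi> y + t \<cdot>\<^sub>v d"
  shows "affine_direction w d"
  unfolding affine_direction_def
proof (intro conjI ballI allI impI)
  fix y t assume y: "y \<in> X" and yt: "y + t \<cdot>\<^sub>v w \<in> X"
  note yc = X_carrier[OF y]
  have seg: "y + (s * t) \<cdot>\<^sub>v w \<in> X" if "0 \<le> s" "s \<le> 1" for s
  proof -
    have "(1 - s) \<cdot>\<^sub>v y + s \<cdot>\<^sub>v (y + t \<cdot>\<^sub>v w) \<in> X"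
      using X_convex y yt that unfolding convex_vec_def by blast
    moreover have "(1 - s) \<cdot>\<^sub>v y + s \<cdot>\<^sub>v (y + t \<cdot>\<^sub>v w) = y + (s * t) \<cdot>\<^sub>v w"
      using yc w by (intro eq_vecI) (auto simp: algebra_simps)
    ultimately show ?thesis by simp
  qed
  have "\<Phi> (y + t \<cdot>\<^sub>v w) $ i = (\<Phi> y + t \<cdot>\<^sub>v d) $ i" if i: "i < n" for i
  proof -
    define \<psi> where "\<psi> s = \<Phi> (y + (s * t) \<cdot>\<^sub>v w) $ i - s * t * d $ i" for s
    have der: "(\<psi> has_real_derivative 0) (at s)" if s: "0 \<le> s" "s \<le> 1" for s
    proof -
      obtain e where e: "e > 0" and loc_e: "\<And>\<tau>. \<bar>\<tau>\<bar> < e \<Longrightarrow>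
          \<Phi> (y + (s * t) \<cdot>\<^sub>v w + \<tau> \<cdot>\<^sub>v w) = \<Phi> (y + (s * t) \<cdot>\<^sub>v w) + \<tau> \<cdot>\<^sub>v d"
        using loc[OF seg[OF s]] by blast
      \<comment> \<open>The radius \<open>e\<close> bounds steps along \<open>w\<close>, and a
        change of \<open>s\<close> is scaled by \<open>t\<close> before it becomes such a step. The
        summand 1 covers \<open>t = 0\<close>.\<close>
      have "\<psi> s' = \<psi> s" if "\<bar>s' - s\<bar> < e / (\<bar>t\<bar> + 1)" for s'
      proof -
        have "\<bar>s' - s\<bar> * \<bar>t\<bar> \<le> \<bar>s' - s\<bar> * (\<bar>t\<bar> + 1)" by (simp add: mult_left_mono)
        also have "\<dots> < e" using that by (simp add: field_simps)
        finally have "\<bar>(s' - s) * t\<bar> < e" by (simp add: abs_mult)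
        from loc_e[OF this] have "\<Phi> (y + (s' * t) \<cdot>\<^sub>v w) = \<Phi> (y + (s * t) \<cdot>\<^sub>v w) + ((s' - s) * t) \<cdot>\<^sub>v d"
        proof -
          assume *: "\<Phi> (y + (s * t) \<cdot>\<^sub>v w + ((s' - s) * t) \<cdot>\<^sub>v w) = \<Phi> (y + (s * t) \<cdot>\<^sub>v w) + ((s' - s) * t) \<cdot>\<^sub>v d"
          have "y + (s * t) \<cdot>\<^sub>v w + ((s' - s) * t) \<cdot>\<^sub>v w = y + (s' * t) \<cdot>\<^sub>v w"
            using yc w by (intro eq_vecI) (auto simp: algebra_simps)
          with * show ?thesis by simp
        qed
        then show ?thesis using d i by (simp add: \<psi>_def algebra_simps)
      qed
      then have const: "\<psi> s' = \<psi> s" if "dist s' s < e / (\<bar>t\<bar> + 1)" for s'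
        using that unfolding dist_real_def by blast
      have "e / (\<bar>t\<bar> + 1) > 0" using e by (intro divide_pos_pos) auto
      with const have "eventually (\<lambda>s'. \<psi> s' = \<psi> s) (nhds s)"
        unfolding eventually_nhds_metric by blast
      then show ?thesis using DERIV_cong_ev[of s s \<psi> "\<lambda>_. \<psi> s" 0 0] by simp
    qed
    have "\<psi> 1 = \<psi> 0"
    proof (rule DERIV_isconst_end[of 0 1 \<psi>])
      show "continuous_on {0..1} \<psi>"
        using der by (intro DERIV_atLeastAtMost_imp_continuous_on) auto
    qed (use der in auto)
    moreover have "y + 0 \<cdot>\<^sub>v w = y" using yc w by auto
    ultimately show ?thesis using d i by (simp add: \<psi>_def)
  qed
  then show "\<Phi> (y + t \<cdot>\<^sub>v w) = \<Phi> y + t \<cdot>\<^sub>v d"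
    using d funcset_mem[OF \<Phi>_carrier yt] by (intro eq_vecI) auto
qed (use w d in auto)

text \<open>All that later proofs retain of the predictors. If \<open>X\<close> is nonempty and
  \<open>\<Phi>\<close> is linear, these are the invariant subspaces containing the range of
  \<open>B\<close>, the smallest of which is the reachable subspace. The clause on \<open>B\<close>
  also puts 0 into \<open>W\<close>.\<close>

definition invariant_directions :: "real vec set \<Rightarrow> bool" where
  "invariant_directions W \<longleftrightarrow> W \<subseteq> carrier_vec n \<and>
    (\<forall>w\<in>W. \<forall>w'\<in>W. w + w' \<in> W) \<and> (\<forall>w\<in>W. \<forall>c. c \<cdot>\<^sub>v w \<in> W) \<and>
    (\<forall>v\<in>carrier_vec m. B *\<^sub>v v \<in> W) \<and> (\<forall>w\<in>W. \<exists>d\<in>W. affine_direction w d)"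

text \<open>\<open>L vs\<close> is the change of the final state when the inputs change by
  \<open>vs\<close>; it depends on neither the initial state nor the base inputs. A zero in front of
  \<open>vs\<close> merely delays the change, so the ranges for growing lengths are nested. A zero
  at the end lets the change pass through \<open>\<Phi>\<close> once more, which gives the slope
  along \<open>L vs\<close>.\<close>

lemma invariant_directions_if_predictor:
  assumes pred: "admits_inf_predictor n m X U \<Phi> B" and "X \<noteq> {}"
  shows "\<exists>W. invariant_directions W"
proof -
  obtain x0 where x0: "x0 \<in> X" using \<open>X \<noteq> {}\<close> by blast
  obtain u0 where u0: "u0 \<in> U" using step_onto[OF x0] by blast
  \<comment> \<open>Predictors of different lengths are chosen independently; relations between
    their matrices must come from the trajectories.\<close>
  have "\<forall>N. \<exists>P Q. N \<ge> 1 \<longrightarrow> P \<in> X \<rightarrow> carrier_vec n \<and> Q \<in> carrier_mat n (N * m) \<and>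
     (\<forall>x\<in>X. \<forall>us. length us = N \<and> set us \<subseteq> U \<longrightarrow> state_after \<Phi> B x us = P x + Q *\<^sub>v stack_vecs us)"
    using pred unfolding admits_inf_predictor_def admits_predictor_def by blast
  then obtain P Q where P: "\<And>N x. N \<ge> 1 \<Longrightarrow> x \<in> X \<Longrightarrow> P N x \<in> carrier_vec n"
    and Q: "\<And>N. N \<ge> 1 \<Longrightarrow> Q N \<in> carrier_mat n (N * m)"
    and PQ: "\<And>N x us. N \<ge> 1 \<Longrightarrow> x \<in> X \<Longrightarrow> length us = N \<Longrightarrow> set us \<subseteq> U \<Longrightarrow>
        state_after \<Phi> B x us = P N x + Q N *\<^sub>v stack_vecs us"
    unfolding choice_iff Pi_def by blast
  define L where "L vs = Q (length vs) *\<^sub>v stack_vecs vs" for vs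
  have stackc: "stack_vecs vs \<in> carrier_vec (length vs * m)" if "set vs \<subseteq> carrier_vec m" for vs
    using that stack_vecs_carrier by blast
  have Lc: "L vs \<in> carrier_vec n" if "vs \<noteq> []" "set vs \<subseteq> carrier_vec m" for vs
    using Q[of "length vs"] stackc[OF that(2)] that(1)
    by (cases vs) (auto simp: L_def)
  have Ladd: "L (perturb t vs us) = L us + t \<cdot>\<^sub>v L vs"
    if "vs \<noteq> []" "length us = length vs" "set us \<subseteq> carrier_vec m" "set vs \<subseteq> carrier_vec m" for us vs t
  proof -
    have len: "length vs \<ge> 1" using that(1) by (cases vs) auto
    show ?thesis
      using stackc[OF that(3)] stackc[OF that(4)] that(2)
      by (simp add: L_def stack_vecs_perturb[OF that(2-4)] mult_add_distrib_mat_vec[OF Q[OF len]]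
          mult_mat_vec[OF Q[OF len]])
  qed
  have state: "state_after \<Phi> B x (perturb t vs us) = state_after \<Phi> B x us + t \<cdot>\<^sub>v L vs"
    if "x \<in> X" "vs \<noteq> []" "length us = length vs" "set us \<subseteq> U" "set vs \<subseteq> carrier_vec m"
      "set (perturb t vs us) \<subseteq> U" for x t vs us
  proof -
    have usc: "set us \<subseteq> carrier_vec m" using that(4) U_carrier by blast
    have len: "length us \<ge> 1" "us \<noteq> []" using that(2,3) by (cases vs; auto)+
    have "state_after \<Phi> B x (perturb t vs us) = P (length us) x + L (perturb t vs us)"
      using PQ[OF len(1) that(1) _ that(6)] that(3) by (simp add: L_def)
    also have "\<dots> = P (length us) x + L us + t \<cdot>\<^sub>v L vs"
      using Lc[OF len(2) usc] Lc[OF that(2,5)] P[OF len(1) that(1)]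
      by (subst Ladd[OF that(2,3) usc that(5)]) (auto intro!: eq_vecI)
    also have "P (length us) x + L us = state_after \<Phi> B x us"
      using PQ[OF len(1) that(1) refl that(4)] by (simp add: L_def)
    finally show ?thesis .
  qed
  \<comment> \<open>A run from \<open>x0\<close> that begins with \<open>u0\<close> is also a
    shorter run from the successor of \<open>x0\<close>, so two predictor matrices describe the same
    change of state.\<close>
  have pad: "L (0\<^sub>v m # vs) = L vs" if vs: "vs \<noteq> []" "set vs \<subseteq> carrier_vec m" for vs
  proof -
    let ?us = "replicate (length vs) u0"
    have us: "set ?us \<subseteq> U" using u0 by (auto simp: set_replicate_conv_if)
    obtain e where e: "e > 0" "\<And>t. \<bar>t\<bar> < e \<Longrightarrow> set (perturb t vs ?us) \<subseteq> U"
      using open_vec_perturb[OF U_open, of ?us vs] us vs(2) by auto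
    define t where "t = e / 2"
    have t: "t \<noteq> 0" "set (perturb t vs ?us) \<subseteq> U" using e by (auto simp: t_def)
    have pt: "perturb t (0\<^sub>v m # vs) (u0 # ?us) = u0 # perturb t vs ?us"
      using U_carrier[OF u0] by (auto simp: perturb_def)
    have x1: "\<Phi> x0 + B *\<^sub>v u0 \<in> X" using step_in_X x0 u0 by blast
    have "state_after \<Phi> B x0 (u0 # ?us) + t \<cdot>\<^sub>v L (0\<^sub>v m # vs)
        = state_after \<Phi> B x0 (perturb t (0\<^sub>v m # vs) (u0 # ?us))"
      using state[of x0 "0\<^sub>v m # vs" "u0 # ?us" t] x0 us vs u0 t(2) pt by simp
    also have "\<dots> = state_after \<Phi> B x0 (u0 # ?us) + t \<cdot>\<^sub>v L vs"
      using state[OF x1 vs(1) _ us vs(2) t(2)] pt by simp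
    finally have eq: "state_after \<Phi> B x0 (u0 # ?us) + t \<cdot>\<^sub>v L (0\<^sub>v m # vs)
        = state_after \<Phi> B x0 (u0 # ?us) + t \<cdot>\<^sub>v L vs" .
    have "state_after \<Phi> B x0 (u0 # ?us) \<in> carrier_vec n"
      using u0 us by (intro X_carrier state_after_in_X[OF x0]) simp
    then show ?thesis
      using smult_vec_cancel[OF eq t(1) _ Lc[OF vs]] Lc[of "0\<^sub>v m # vs"] vs(2) by simp
  qed
  have padn: "L (replicate j (0\<^sub>v m) @ vs) = L vs" if "vs \<noteq> []" "set vs \<subseteq> carrier_vec m" for j vs
    using that by (induction j) (auto simp: pad set_replicate_conv_if)
  \<comment> \<open>Any \<open>y\<close> is the end of a run with \<open>length vs\<close> steps.
    Perturbing that run moves \<open>y\<close> by a multiple of \<open>L vs\<close>; prolonging it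
    by the unperturbed input \<open>u0\<close> shows how \<open>\<Phi>\<close> responds.\<close>
  have dir: "affine_direction (L vs) (L (vs @ [0\<^sub>v m]))" if vs: "vs \<noteq> []" "set vs \<subseteq> carrier_vec m" for vs
  proof (rule affine_direction_if_local)
    fix y assume "y \<in> X"
    then obtain x us where x: "x \<in> X" and us: "length us = length vs" "set us \<subseteq> U"
      and y: "state_after \<Phi> B x us = y"
      using state_after_onto by blast
    obtain e where e: "e > 0" "\<And>t. \<bar>t\<bar> < e \<Longrightarrow> set (perturb t vs us) \<subseteq> U"
      using open_vec_perturb[OF U_open us vs(2)] by blast
    have "\<Phi> (y + t \<cdot>\<^sub>v L vs) = \<Phi> y + t \<cdot>\<^sub>v L (vs @ [0\<^sub>v m])" if t: "\<bar>t\<bar> < e" for t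
    proof -
      have pt: "perturb t (vs @ [0\<^sub>v m]) (us @ [u0]) = perturb t vs us @ [u0]"
        using U_carrier[OF u0] us(1) by (auto simp: perturb_def)
      have yt: "state_after \<Phi> B x (perturb t vs us) = y + t \<cdot>\<^sub>v L vs"
        using state[OF x vs(1) us vs(2) e(2)[OF t]] y by simp
      have "\<Phi> (y + t \<cdot>\<^sub>v L vs) + B *\<^sub>v u0 = state_after \<Phi> B x (perturb t vs us @ [u0])"
        using yt by simp
      also have "\<dots> = \<Phi> y + B *\<^sub>v u0 + t \<cdot>\<^sub>v L (vs @ [0\<^sub>v m])"
        using state[of x "vs @ [0\<^sub>v m]" "us @ [u0]" t] x us vs u0 e(2)[OF t] pt y by simp
      finally have *: "\<Phi> (y + t \<cdot>\<^sub>v L vs) + B *\<^sub>v u0 = \<Phi> y + B *\<^sub>v u0 + t \<cdot>\<^sub>v L (vs @ [0\<^sub>v m])" .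
      have c: "\<Phi> (y + t \<cdot>\<^sub>v L vs) \<in> carrier_vec n" "\<Phi> y \<in> carrier_vec n"
          "B *\<^sub>v u0 \<in> carrier_vec n" "L (vs @ [0\<^sub>v m]) \<in> carrier_vec n"
        using \<Phi>_carrier state_after_in_X[OF x e(2)[OF t]] yt \<open>y \<in> X\<close> B_carrier U_carrier[OF u0] Lc vs
        by auto
      show ?thesis
      proof (rule eq_vecI)
        fix i assume "i < dim_vec (\<Phi> y + t \<cdot>\<^sub>v L (vs @ [0\<^sub>v m]))"
        then have i: "i < n" using c by simp
        have "(\<Phi> (y + t \<cdot>\<^sub>v L vs) + B *\<^sub>v u0) $ i = (\<Phi> y + B *\<^sub>v u0 + t \<cdot>\<^sub>v L (vs @ [0\<^sub>v m])) $ i"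
          using * by simp
        then show "\<Phi> (y + t \<cdot>\<^sub>v L vs) $ i = (\<Phi> y + t \<cdot>\<^sub>v L (vs @ [0\<^sub>v m])) $ i"
          using i c B_carrier by simp
      qed (use c in auto)
    qed
    with e(1) show "\<exists>e>0. \<forall>t. \<bar>t\<bar> < e \<longrightarrow> \<Phi> (y + t \<cdot>\<^sub>v L vs) = \<Phi> y + t \<cdot>\<^sub>v L (vs @ [0\<^sub>v m])" by blast
  qed (use Lc vs in auto)
  have LB: "L [v] = B *\<^sub>v v" if v: "v \<in> carrier_vec m" for v
  proof -
    obtain e where e: "e > 0" "\<And>t. \<bar>t\<bar> < e \<Longrightarrow> u0 + t \<cdot>\<^sub>v v \<in> U"
      using open_vec_ray[OF U_open u0 v] by blast
    define t where "t = e / 2"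
    have t: "t \<noteq> 0" "u0 + t \<cdot>\<^sub>v v \<in> U" using e by (auto simp: t_def)
    have c: "\<Phi> x0 \<in> carrier_vec n" "B *\<^sub>v u0 \<in> carrier_vec n" "B *\<^sub>v v \<in> carrier_vec n"
      using \<Phi>_carrier x0 B_carrier U_carrier[OF u0] v by auto
    have "\<Phi> x0 + B *\<^sub>v u0 + t \<cdot>\<^sub>v L [v] = \<Phi> x0 + B *\<^sub>v (u0 + t \<cdot>\<^sub>v v)"
      using state[of x0 "[v]" "[u0]" t] x0 v u0 t by (simp add: perturb_def)
    also have "\<dots> = \<Phi> x0 + B *\<^sub>v u0 + t \<cdot>\<^sub>v (B *\<^sub>v v)"
      using c U_carrier[OF u0] v
      by (subst mult_add_distrib_mat_vec[OF B_carrier])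
        (auto simp: mult_mat_vec[OF B_carrier] intro!: assoc_add_vec[symmetric])
    finally have eq: "\<Phi> x0 + B *\<^sub>v u0 + t \<cdot>\<^sub>v L [v] = \<Phi> x0 + B *\<^sub>v u0 + t \<cdot>\<^sub>v (B *\<^sub>v v)" .
    show ?thesis
      using smult_vec_cancel[OF eq t(1) _ c(3)] Lc[of "[v]"] v c by simp
  qed
  define W where "W = L ` {vs. vs \<noteq> [] \<and> set vs \<subseteq> carrier_vec m}"
  have comb: "w + c \<cdot>\<^sub>v w' \<in> W" if ww: "w \<in> W" "w' \<in> W" for w w' c
  proof -
    obtain vs vs' where vs: "w = L vs" "vs \<noteq> []" "set vs \<subseteq> carrier_vec m"
      and vs': "w' = L vs'" "vs' \<noteq> []" "set vs' \<subseteq> carrier_vec m"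
      using ww unfolding W_def by blast
    \<comment> \<open>Zeros in front bring both lists to the same length; truncated subtraction
      leaves the longer one unchanged.\<close>
    define us where "us = replicate (length vs' - length vs) (0\<^sub>v m) @ vs"
    define us' where "us' = replicate (length vs - length vs') (0\<^sub>v m) @ vs'"
    have us: "us \<noteq> []" "us' \<noteq> []" "set us \<subseteq> carrier_vec m" "set us' \<subseteq> carrier_vec m"
      "length us = length us'"
      using vs vs' by (auto simp: us_def us'_def)
    have "w + c \<cdot>\<^sub>v w' = L us + c \<cdot>\<^sub>v L us'" using vs vs' by (simp add: us_def us'_def padn)
    also have "\<dots> = L (perturb c us' us)" using Ladd us by simp
    finally have eq: "w + c \<cdot>\<^sub>v w' = L (perturb c us' us)" .
    have "perturb c us' us \<noteq> []" using us(2,5) length_perturb by (metis length_0_conv)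
    then show ?thesis
      using perturb_carrier[OF us(5,3,4)] unfolding W_def eq by blast
  qed
  have "invariant_directions W"
    unfolding invariant_directions_def
  proof (intro conjI ballI allI)
    show Wc: "W \<subseteq> carrier_vec n" using Lc by (auto simp: W_def)
    show sum: "w + w' \<in> W" if "w \<in> W" "w' \<in> W" for w w'
      using comb[OF that, of 1] by simp
    show "c \<cdot>\<^sub>v w \<in> W" if "w \<in> W" for w c
    proof -
      \<comment> \<open>Scaling is reduced to \<open>comb\<close> by splitting off one copy of
        \<open>w\<close>.\<close>
      have "w + (c - 1) \<cdot>\<^sub>v w = c \<cdot>\<^sub>v w" by (rule eq_vecI) (auto simp: algebra_simps)
      then show ?thesis using comb[OF that that, of "c - 1"] by simp
    qed
    show "B *\<^sub>v v \<in> W" if "v \<in> carrier_vec m" for v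
      using LB[OF that] that by (auto simp: W_def intro!: image_eqI[of _ _ "[v]"])
    show "\<exists>d\<in>W. affine_direction w d" if w: "w \<in> W" for w
    proof -
      obtain vs where vs: "w = L vs" "vs \<noteq> []" "set vs \<subseteq> carrier_vec m"
        using w unfolding W_def by blast
      have "L (vs @ [0\<^sub>v m]) \<in> W" unfolding W_def using vs(3) by (intro imageI) auto
      with dir[OF vs(2,3)] vs(1) show ?thesis by blast
    qed
  qed
  then show ?thesis by blast
qed

end

section \<open>Block matrices and inverse coordinate changes\<close>

lemma row_block_mat:
  fixes A D :: "real mat"
  assumes A: "A \<in> carrier_mat r a" and D: "D \<in> carrier_mat r d"
  obtains M where "M \<in> carrier_mat r (a + d)"
    "\<And>v w. v \<in> carrier_vec a \<Longrightarrow> w \<in> carrier_vec d \<Longrightarrow> M *\<^sub>v (v @\<^sub>v w) = A *\<^sub>v v + D *\<^sub>v w"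
proof -
  \<comment> \<open>The lower blocks have no rows, so this is \<open>A\<close> placed next to
    \<open>D\<close>.\<close>
  let ?M = "four_block_mat A D (0\<^sub>m 0 a) (0\<^sub>m 0 d)"
  have "?M *\<^sub>v (v @\<^sub>v w) = A *\<^sub>v v + D *\<^sub>v w" if "v \<in> carrier_vec a" "w \<in> carrier_vec d" for v w
    using A D that by (subst four_block_mat_mult_vec[of _ r a _ d _ 0]) (auto intro!: eq_vecI)
  moreover have "?M \<in> carrier_mat r (a + d)"
    using four_block_carrier_mat[OF A, of "0\<^sub>m 0 d" 0 d] D by simp
  ultimately show ?thesis using that by blast
qed

lemma split_rows_mat:
  fixes M :: "real mat"
  assumes M: "M \<in> carrier_mat (r + s) c"
  obtains M1 M2 where "M1 \<in> carrier_mat r c" "M2 \<in> carrier_mat s c"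
    "\<And>v. v \<in> carrier_vec c \<Longrightarrow> M *\<^sub>v v = (M1 *\<^sub>v v) @\<^sub>v (M2 *\<^sub>v v)"
proof -
  define M1 where "M1 = mat r c (\<lambda>(i, j). M $$ (i, j))"
  define M2 where "M2 = mat s c (\<lambda>(i, j). M $$ (r + i, j))"
  have "M *\<^sub>v v = (M1 *\<^sub>v v) @\<^sub>v (M2 *\<^sub>v v)" if "v \<in> carrier_vec c" for v
    using M that by (intro eq_vecI) (auto simp: M1_def M2_def scalar_prod_def)
  then show ?thesis using that[of M1 M2] by (simp add: M1_def M2_def)
qed

lemma append_vec_obtain:
  assumes "v \<in> carrier_vec (a + b)"
  obtains v1 v2 where "v1 \<in> carrier_vec a" "v2 \<in> carrier_vec b" "v = v1 @\<^sub>v v2"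
  using vec_first_last_append[OF assms] vec_first_carrier vec_last_carrier by metis

lemma vec_first_append [simp]: "v \<in> carrier_vec a \<Longrightarrow> vec_first (v @\<^sub>v w) a = v"
  by (auto simp: vec_first_def)

lemma vec_last_append [simp]: "w \<in> carrier_vec b \<Longrightarrow> vec_last (v @\<^sub>v w) b = w"
  by (auto simp: vec_last_def)

lemma mult_mat_vec_inverse:
  fixes A :: "real mat"
  assumes "A \<in> carrier_mat k k" "C \<in> carrier_mat k k" "A * C = 1\<^sub>m k" "v \<in> carrier_vec k"
  shows "A *\<^sub>v (C *\<^sub>v v) = v"
  using assms assoc_mult_mat_vec[OF assms(1,2,4)] by simp

lemma invertible_mat_inverse:
  fixes T :: "real mat"
  assumes T: "T \<in> carrier_mat k k" and "invertible_mat T"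
  obtains Ti where "Ti \<in> carrier_mat k k" "T * Ti = 1\<^sub>m k" "Ti * T = 1\<^sub>m k"
proof -
  obtain Ti where Ti: "T * Ti = 1\<^sub>m k" "Ti * T = 1\<^sub>m (dim_row Ti)"
    using assms unfolding invertible_mat_def inverts_mat_def by auto
  have "dim_col Ti = k" using Ti(1) by (metis index_mult_mat(3) index_one_mat(3))
  moreover have "dim_row Ti = k" using Ti(2) T by (metis carrier_matD(2) index_mult_mat(3) index_one_mat(3))
  ultimately show ?thesis using that Ti by auto
qed

lemma invertible_matI:
  fixes T :: "real mat"
  assumes "T \<in> carrier_mat k k" "Ti \<in> carrier_mat k k" "T * Ti = 1\<^sub>m k" "Ti * T = 1\<^sub>m k"
  shows "invertible_mat T"
  using assms unfolding invertible_mat_def inverts_mat_def by auto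

lemma block_id_carrier: "T \<in> carrier_mat k k \<Longrightarrow> block_id a T \<in> carrier_mat (a + k) (a + k)"
  unfolding block_id_def by auto

lemma block_id_mult_vec:
  assumes "T \<in> carrier_mat k k" "w \<in> carrier_vec a" "z \<in> carrier_vec k"
  shows "block_id a T *\<^sub>v (w @\<^sub>v z) = w @\<^sub>v (T *\<^sub>v z)"
  using assms unfolding block_id_def by (subst four_block_mat_mult_vec[of _ a a _ k _ k]) auto

lemma block_id_mult:
  assumes "T \<in> carrier_mat k k" "Ti \<in> carrier_mat k k" "T * Ti = 1\<^sub>m k"
  shows "block_id a T * block_id a Ti = 1\<^sub>m (a + k)"
  using assms unfolding block_id_def
  by (subst mult_four_block_mat[of _ a a _ k _ k]) (auto intro!: eq_matI)

section \<open>From the CAP form to predictors\<close>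

context control_system
begin

text \<open>The second block evolves without inputs and without the first block, so after N steps it
  is a function of the initial state. Whatever \<open>g\<close> contributes is then such a function
  as well, and the inputs meet only the constant matrices \<open>C\<close> and
  \<open>D\<close>.\<close>

lemma predictor_if_cap_form:
  assumes T: "T \<in> carrier_mat n n" "invertible_mat T" and cap: "cap_form n m X U \<Phi> B T"
  shows "admits_inf_predictor n m X U \<Phi> B"
proof -
  obtain Ti where Ti: "Ti \<in> carrier_mat n n" "Ti * T = 1\<^sub>m n"
    using invertible_mat_inverse[OF T] by metis
  obtain n1 n2 g h C D where n12: "n1 + n2 = n"
    and gh: "g \<in> carrier_vec n2 \<rightarrow> carrier_vec n1" "h \<in> carrier_vec n2 \<rightarrow> carrier_vec n2"
    and CD: "C \<in> carrier_mat n1 n1" "D \<in> carrier_mat n1 m"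
    and step: "\<And>x u x1 x2. x \<in> X \<Longrightarrow> u \<in> U \<Longrightarrow> x1 \<in> carrier_vec n1 \<Longrightarrow> x2 \<in> carrier_vec n2 \<Longrightarrow>
       T *\<^sub>v x = x1 @\<^sub>v x2 \<Longrightarrow> T *\<^sub>v (\<Phi> x + B *\<^sub>v u) = (g x2 + C *\<^sub>v x1 + D *\<^sub>v u) @\<^sub>v h x2"
    using cap unfolding cap_form_def by blast
  have claim: "\<exists>p q Q. Q \<in> carrier_mat n1 (N * m) \<and> (\<forall>x\<in>X. p x \<in> carrier_vec n1 \<and> q x \<in> carrier_vec n2) \<and>
     (\<forall>x\<in>X. \<forall>us. length us = N \<and> set us \<subseteq> U \<longrightarrow>
       T *\<^sub>v state_after \<Phi> B x us = (p x + Q *\<^sub>v stack_vecs us) @\<^sub>v q x)" for N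
  proof (induction N)
    case 0
    show ?case
    proof (intro exI conjI ballI allI impI)
      fix x us assume "x \<in> X" and us: "length us = 0 \<and> set us \<subseteq> U"
      then have "T *\<^sub>v x \<in> carrier_vec (n1 + n2)" using T(1) X_carrier n12 by auto
      then have "vec_first (T *\<^sub>v x) n1 @\<^sub>v vec_last (T *\<^sub>v x) n2 = T *\<^sub>v x"
        by (rule vec_first_last_append)
      moreover have "vec_first (T *\<^sub>v x) n1 + 0\<^sub>m n1 0 *\<^sub>v vNil = vec_first (T *\<^sub>v x) n1"
        by (intro eq_vecI) auto
      ultimately show "T *\<^sub>v state_after \<Phi> B x us
          = (vec_first (T *\<^sub>v x) n1 + 0\<^sub>m n1 0 *\<^sub>v stack_vecs us) @\<^sub>v vec_last (T *\<^sub>v x) n2"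
        using us by simp
    qed auto
  next
    case (Suc N)
    then obtain p q Q where Q: "Q \<in> carrier_mat n1 (N * m)"
      and pq: "\<And>x. x \<in> X \<Longrightarrow> p x \<in> carrier_vec n1" "\<And>x. x \<in> X \<Longrightarrow> q x \<in> carrier_vec n2"
      and st: "\<And>x us. x \<in> X \<Longrightarrow> length us = N \<Longrightarrow> set us \<subseteq> U \<Longrightarrow>
         T *\<^sub>v state_after \<Phi> B x us = (p x + Q *\<^sub>v stack_vecs us) @\<^sub>v q x"
      by blast
    \<comment> \<open>The earlier inputs pass through \<open>C\<close> once more; the newest input
      is last in the stack, so \<open>D\<close> is the last block of columns.\<close>
    obtain Q' where Q': "Q' \<in> carrier_mat n1 (N * m + m)" and Q'_eq:
      "\<And>v w. v \<in> carrier_vec (N * m) \<Longrightarrow> w \<in> carrier_vec m \<Longrightarrow> Q' *\<^sub>v (v @\<^sub>v w) = (C * Q) *\<^sub>v v + D *\<^sub>v w"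
      using row_block_mat[of "C * Q" n1 "N * m" D m] CD Q by auto
    show ?case
    proof (intro exI conjI ballI allI impI)
      show "Q' \<in> carrier_mat n1 (Suc N * m)" using Q' by (simp add: add.commute)
      fix x assume x: "x \<in> X"
      show "g (q x) + C *\<^sub>v p x \<in> carrier_vec n1" "h (q x) \<in> carrier_vec n2"
        using gh CD pq[OF x] by (auto dest: funcset_mem)
      fix us assume "length us = Suc N \<and> set us \<subseteq> U"
      then obtain us' u where us: "us = us' @ [u]" "length us' = N" "set us' \<subseteq> U" "u \<in> U"
        by (cases us rule: rev_cases) auto
      have stk: "stack_vecs us' \<in> carrier_vec (N * m)"
        using stack_vecs_carrier[of us' m] us U_carrier by auto
      have c: "g (q x) \<in> carrier_vec n1" "C *\<^sub>v p x \<in> carrier_vec n1"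
        "C *\<^sub>v (Q *\<^sub>v stack_vecs us') \<in> carrier_vec n1" "D *\<^sub>v u \<in> carrier_vec n1"
        "Q *\<^sub>v stack_vecs us' \<in> carrier_vec n1"
        using gh CD pq[OF x] Q stk U_carrier[OF us(4)] by (auto dest: funcset_mem)
      have "T *\<^sub>v state_after \<Phi> B x us = (g (q x) + C *\<^sub>v (p x + Q *\<^sub>v stack_vecs us') + D *\<^sub>v u) @\<^sub>v h (q x)"
        using step[OF state_after_in_X[OF x us(3)] us(4) _ pq(2)[OF x] st[OF x us(2,3)]] c pq[OF x] us(1)
        by simp
      also have "g (q x) + C *\<^sub>v (p x + Q *\<^sub>v stack_vecs us') + D *\<^sub>v u
          = g (q x) + C *\<^sub>v p x + Q' *\<^sub>v stack_vecs us"
        using c CD Q stk U_carrier[OF us(4)] pq[OF x]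
        by (auto simp: us(1) stack_vecs_snoc Q'_eq mult_add_distrib_mat_vec[OF CD(1)] intro!: eq_vecI)
      finally show "T *\<^sub>v state_after \<Phi> B x us = (g (q x) + C *\<^sub>v p x + Q' *\<^sub>v stack_vecs us) @\<^sub>v h (q x)" .
    qed
  qed
  have "admits_predictor n m X U \<Phi> B N" for N
  proof -
    obtain p q Q where Q: "Q \<in> carrier_mat n1 (N * m)"
      and pq: "\<And>x. x \<in> X \<Longrightarrow> p x \<in> carrier_vec n1" "\<And>x. x \<in> X \<Longrightarrow> q x \<in> carrier_vec n2"
      and st: "\<And>x us. x \<in> X \<Longrightarrow> length us = N \<Longrightarrow> set us \<subseteq> U \<Longrightarrow>
         T *\<^sub>v state_after \<Phi> B x us = (p x + Q *\<^sub>v stack_vecs us) @\<^sub>v q x"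
      using claim[of N] by blast
    \<comment> \<open>No input reaches the second block, hence the zero rows; \<open>Ti\<close> then
      leads back to the original coordinates.\<close>
    let ?Q = "Q @\<^sub>r 0\<^sub>m n2 (N * m)"
    have Q0: "?Q \<in> carrier_mat n (N * m)" using carrier_append_rows[OF Q, of "0\<^sub>m n2 (N * m)" n2] n12 by simp
    have pqn: "p x @\<^sub>v q x \<in> carrier_vec n" if "x \<in> X" for x
      using append_carrier_vec[OF pq(1)[OF that] pq(2)[OF that]] n12 by simp
    show ?thesis
      unfolding admits_predictor_def
    proof (intro bexI[of _ "\<lambda>x. Ti *\<^sub>v (p x @\<^sub>v q x)"] bexI[of _ "Ti * ?Q"] ballI allI impI)
      fix x us assume x: "x \<in> X" and us: "length us = N \<and> set us \<subseteq> U"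
      have stk: "stack_vecs us \<in> carrier_vec (N * m)"
        using stack_vecs_carrier[of us m] us U_carrier by auto
      have "state_after \<Phi> B x us = Ti *\<^sub>v (T *\<^sub>v state_after \<Phi> B x us)"
        using mult_mat_vec_inverse[OF Ti(1) T(1) Ti(2)] X_carrier[OF state_after_in_X[OF x]] us by simp
      also have "T *\<^sub>v state_after \<Phi> B x us = (p x @\<^sub>v q x) + ?Q *\<^sub>v stack_vecs us"
        using st[OF x, of us] us stk pq[OF x] Q
        by (auto simp: mat_mult_append[OF Q _ stk, of _ n2] append_vec_add[of _ n1 _ _ n2])
      also have "Ti *\<^sub>v \<dots> = Ti *\<^sub>v (p x @\<^sub>v q x) + Ti * ?Q *\<^sub>v stack_vecs us"
        using Q0 stk by (subst mult_add_distrib_mat_vec[OF Ti(1) pqn[OF x]])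
          (auto simp: assoc_mult_mat_vec[OF Ti(1) Q0 stk])
      finally show "state_after \<Phi> B x us = Ti *\<^sub>v (p x @\<^sub>v q x) + Ti * ?Q *\<^sub>v stack_vecs us" .
    next
      show "Ti * ?Q \<in> carrier_mat n (N * m)" using Ti(1) Q0 by simp
      show "(\<lambda>x. Ti *\<^sub>v (p x @\<^sub>v q x)) \<in> X \<rightarrow> carrier_vec n"
        using Ti(1) pqn by auto
    qed
  qed
  then show ?thesis by (simp add: admits_inf_predictor_def)
qed

end

section \<open>Splitting coordinates of a subsystem\<close>

lemma mult_mat_vec_add_smult:
  fixes M :: "real mat"
  assumes "M \<in> carrier_mat r c" "a \<in> carrier_vec c" "b \<in> carrier_vec c"
  shows "M *\<^sub>v (a + t \<cdot>\<^sub>v b) = M *\<^sub>v a + t \<cdot>\<^sub>v (M *\<^sub>v b)"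
  using assms by (simp add: mult_add_distrib_mat_vec[OF assms(1)] mult_mat_vec[OF assms(1)])

text \<open>The last two facts identify the range of \<open>B\<close> in the new coordinates as the
  space of all (y, 0): the first block is exactly what the input can move.\<close>

lemma scd_coordsD:
  assumes coords: "scd_coords B T Ti D" and B: "B \<in> carrier_mat k l"
  shows "T \<in> carrier_mat k k" "Ti \<in> carrier_mat k k" "T * Ti = 1\<^sub>m k" "Ti * T = 1\<^sub>m k"
    "dim_row D \<le> k" "D \<in> carrier_mat (dim_row D) l" "full_row_rank D"
    "v \<in> carrier_vec l \<Longrightarrow> T *\<^sub>v (B *\<^sub>v v) = (D *\<^sub>v v) @\<^sub>v 0\<^sub>v (k - dim_row D)"
    "y \<in> carrier_vec (dim_row D) \<Longrightarrow> \<exists>v\<in>carrier_vec l. D *\<^sub>v v = y"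
proof -
  show T: "T \<in> carrier_mat k k" "Ti \<in> carrier_mat k k" "T * Ti = 1\<^sub>m k" "Ti * T = 1\<^sub>m k"
    and "dim_row D \<le> k" and D: "D \<in> carrier_mat (dim_row D) l" and full: "full_row_rank D"
    using assms unfolding scd_coords_def inverts_mat_def by auto
  have TB: "T * B = D @\<^sub>r 0\<^sub>m (k - dim_row D) l" using assms unfolding scd_coords_def by auto
  show "T *\<^sub>v (B *\<^sub>v v) = (D *\<^sub>v v) @\<^sub>v 0\<^sub>v (k - dim_row D)" if v: "v \<in> carrier_vec l"
  proof -
    have "0\<^sub>m (k - dim_row D) l *\<^sub>v v = 0\<^sub>v (k - dim_row D)" using v by (intro eq_vecI) auto
    then show ?thesis
      using assoc_mult_mat_vec[OF T(1) B v] mat_mult_append[OF D _ v, of "0\<^sub>m (k - dim_row D) l" "k - dim_row D"]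
      by (simp add: TB)
  qed
  show "\<exists>v\<in>carrier_vec l. D *\<^sub>v v = y" if "y \<in> carrier_vec (dim_row D)"
    using full that unfolding full_row_rank_iff_surj carrier_matD(2)[OF D] by blast
qed

text \<open>If \<open>D\<close> had no rows, \<open>B\<close> would vanish; if it had all
  \<open>k\<close> rows, \<open>B\<close> would be onto. The two strict bounds give progress in
  every split and leave a subsystem of positive dimension.\<close>

lemma scd_coords_dim:
  assumes coords: "scd_coords B T Ti D" and B: "B \<in> carrier_mat k l"
    and not_full: "\<not> full_row_rank B" and nonzero: "B \<noteq> 0\<^sub>m k l"
  shows "0 < dim_row D" "dim_row D < k"
proof -
  note c = scd_coordsD[OF coords B]
  have inv: "Ti *\<^sub>v (T *\<^sub>v (B *\<^sub>v v)) = B *\<^sub>v v" if "v \<in> carrier_vec l" for v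
    using mult_mat_vec_inverse[OF c(2,1,4)] B that by simp
  show "0 < dim_row D"
  proof (rule ccontr)
    assume "\<not> 0 < dim_row D"
    then have D0: "dim_row D = 0" by simp
    have "B *\<^sub>v v = 0\<^sub>v k" if v: "v \<in> carrier_vec l" for v
    proof -
      have "(D *\<^sub>v v) @\<^sub>v 0\<^sub>v (k - dim_row D) = 0\<^sub>v k" using D0 by (intro eq_vecI) auto
      then have "B *\<^sub>v v = Ti *\<^sub>v 0\<^sub>v k" using inv[OF v] c(8)[OF v] by simp
      then show ?thesis using c(2) by auto
    qed
    have "B = 0\<^sub>m k l"
    proof (intro eq_matI)
      fix i j assume "i < dim_row (0\<^sub>m k l)" "j < dim_col (0\<^sub>m k l)"
      then have ij: "i < k" "j < l" by auto
      have "(B *\<^sub>v unit_vec l j) $ i = 0" using \<open>\<And>v. v \<in> carrier_vec l \<Longrightarrow> B *\<^sub>v v = 0\<^sub>v k\<close> ij by simp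
      then show "B $$ (i, j) = 0\<^sub>m k l $$ (i, j)" using B ij by simp
    qed (use B in auto)
    with nonzero show False by simp
  qed
  show "dim_row D < k"
  proof (rule ccontr)
    assume "\<not> dim_row D < k"
    then have Dk: "dim_row D = k" using c(5) by simp
    have "\<exists>v\<in>carrier_vec l. B *\<^sub>v v = y" if y: "y \<in> carrier_vec k" for y
    proof -
      obtain v where v: "v \<in> carrier_vec l" "D *\<^sub>v v = T *\<^sub>v y"
        using c(9)[of "T *\<^sub>v y"] Dk c(1) y by auto
      have "(D *\<^sub>v v) @\<^sub>v 0\<^sub>v (k - dim_row D) = D *\<^sub>v v" using Dk by (intro eq_vecI) auto
      then have "B *\<^sub>v v = Ti *\<^sub>v (T *\<^sub>v y)" using inv[OF v(1)] c(8)[OF v(1)] v(2) by simp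
      with v(1) mult_mat_vec_inverse[OF c(2,1,4) y] show ?thesis by auto
    qed
    with not_full B show False unfolding full_row_rank_iff_surj by auto
  qed
qed

text \<open>An absent \<open>\<Gamma>\<close> is a function without components.\<close>

definition gamma_fun :: "(real vec \<Rightarrow> real vec) option \<Rightarrow> real vec \<Rightarrow> real vec" where
  "gamma_fun \<Gamma> = (case \<Gamma> of None \<Rightarrow> \<lambda>_. vNil | Some G \<Rightarrow> G)"

section \<open>The loop invariant\<close>

context control_system
begin

text \<open>
  In the coordinates \<open>T x = w @\<^sub>v z\<close> the current subsystem is that of \<open>z\<close>, and
  $w^+ = \Gamma(z) + C w + D u$. Its input is $u$ in the first iteration and the last block of $w$
  afterwards; \<open>E w + F u\<close> covers both cases.
\<close>

definition subsystem_dynamics ::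
  "nat \<Rightarrow> nat \<Rightarrow> (real vec \<Rightarrow> real vec) \<Rightarrow> real mat \<Rightarrow> (real vec \<Rightarrow> real vec) option \<Rightarrow> real mat \<Rightarrow>
   real mat \<Rightarrow> real mat \<Rightarrow> real mat \<Rightarrow> real mat \<Rightarrow> bool" where
  "subsystem_dynamics k l \<Psi> Bk \<Gamma> T C D E F \<longleftrightarrow>
    C \<in> carrier_mat (n - k) (n - k) \<and> D \<in> carrier_mat (n - k) m \<and>
    E \<in> carrier_mat l (n - k) \<and> F \<in> carrier_mat l m \<and>
    (\<forall>v\<in>carrier_vec l. \<exists>w\<in>carrier_vec (n - k). \<exists>u\<in>carrier_vec m. v = E *\<^sub>v w + F *\<^sub>v u) \<and>
    (\<forall>x\<in>X. \<forall>w\<in>carrier_vec (n - k). \<forall>z\<in>carrier_vec k. T *\<^sub>v x = w @\<^sub>v z \<longrightarrow>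
      gamma_fun \<Gamma> z \<in> carrier_vec (n - k) \<and> \<Psi> z \<in> carrier_vec k \<and>
      (\<forall>u\<in>U. T *\<^sub>v (\<Phi> x + B *\<^sub>v u) =
        (gamma_fun \<Gamma> z + C *\<^sub>v w + D *\<^sub>v u) @\<^sub>v (\<Psi> z + Bk *\<^sub>v (E *\<^sub>v w + F *\<^sub>v u))))"

text \<open>\<open>k\<close> and \<open>l\<close> are the dimensions of state and input of the
  current subsystem. The matrices \<open>C\<close>, \<open>D\<close>, \<open>E\<close>,
  \<open>F\<close> are bookkeeping that the algorithm never computes, hence existential. The
  description of \<open>S\<close> lets its points be lifted to states in \<open>X\<close>, and
  \<open>1 \<le> k\<close> reserves one pass for the return.\<close>

definition loop_invariant ::
  "nat \<Rightarrow> nat \<Rightarrow> real vec set \<Rightarrow> (real vec \<Rightarrow> real vec) \<Rightarrow> real mat \<Rightarrow> (real vec \<Rightarrow> real vec) option \<Rightarrow>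
   real mat \<Rightarrow> bool" where
  "loop_invariant k l S \<Psi> Bk \<Gamma> T \<longleftrightarrow>
    1 \<le> k \<and> k \<le> n \<and> Bk \<in> carrier_mat k l \<and> T \<in> carrier_mat n n \<and> invertible_mat T \<and>
    S = proj_second (n - k) k ((*\<^sub>v) T ` X) \<and> (\<Gamma> = None \<longrightarrow> k = n) \<and>
    (\<exists>C D E F. subsystem_dynamics k l \<Psi> Bk \<Gamma> T C D E F)"

lemma loop_invariant_init:
  assumes "n \<ge> 1"
  shows "loop_invariant n m X \<Phi> B None (1\<^sub>m n)"
proof -
  have eq: "x @\<^sub>v z = z" if "x \<in> carrier_vec 0" for x z :: "real vec"
    using that by (intro eq_vecI) auto
  have inv: "invertible_mat (1\<^sub>m n :: real mat)" by (rule invertible_matI[of _ n "1\<^sub>m n"]) auto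
  have S: "X = proj_second (n - n) n ((*\<^sub>v) (1\<^sub>m n) ` X)"
    using X_carrier by (auto simp: proj_second_def image_iff eq intro!: exI[of _ vNil])
  \<comment> \<open>Nothing is split off yet: \<open>w\<close> has dimension 0 and the subsystem's
    input is \<open>u\<close> itself, so \<open>E\<close> has no columns and \<open>F\<close> is the
    identity.\<close>
  have "subsystem_dynamics n m \<Phi> B None (1\<^sub>m n) (0\<^sub>m 0 0) (0\<^sub>m 0 m) (0\<^sub>m m 0) (1\<^sub>m m)"
    unfolding subsystem_dynamics_def
  proof (intro conjI ballI impI)
    fix v :: "real vec" assume v: "v \<in> carrier_vec m"
    show "\<exists>w\<in>carrier_vec (n - n). \<exists>u\<in>carrier_vec m. v = 0\<^sub>m m 0 *\<^sub>v w + 1\<^sub>m m *\<^sub>v u"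
      using v by (intro bexI[of _ "vNil"] bexI[of _ v]) (auto intro!: eq_vecI)
  next
    fix x w z :: "real vec" assume x: "x \<in> X" and w: "w \<in> carrier_vec (n - n)" and z: "z \<in> carrier_vec n"
      and "1\<^sub>m n *\<^sub>v x = w @\<^sub>v z"
    then have zx: "z = x" using eq[of w z] X_carrier[OF x] by simp
    show "gamma_fun None z \<in> carrier_vec (n - n)" by (simp add: gamma_fun_def)
    show "\<Phi> z \<in> carrier_vec n" using \<Phi>_carrier x zx by auto
    fix u assume u: "u \<in> U"
    have "B *\<^sub>v u \<in> carrier_vec n" "\<Phi> x \<in> carrier_vec n"
      using B_carrier U_carrier[OF u] \<Phi>_carrier x by auto
    moreover have "0\<^sub>m m 0 *\<^sub>v w + 1\<^sub>m m *\<^sub>v u = u"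
      using U_carrier[OF u] w by (intro eq_vecI) (auto simp: scalar_prod_def)
    moreover have "gamma_fun None z + 0\<^sub>m 0 0 *\<^sub>v w + 0\<^sub>m 0 m *\<^sub>v u \<in> carrier_vec 0"
      by (rule carrier_vecI) simp
    ultimately show "1\<^sub>m n *\<^sub>v (\<Phi> x + B *\<^sub>v u) =
          (gamma_fun None z + 0\<^sub>m 0 0 *\<^sub>v w + 0\<^sub>m 0 m *\<^sub>v u) @\<^sub>v
          (\<Phi> z + B *\<^sub>v (0\<^sub>m m 0 *\<^sub>v w + 1\<^sub>m m *\<^sub>v u))"
      using zx by (simp add: eq)
  qed auto
  then show ?thesis using assms B_carrier inv S unfolding loop_invariant_def by auto
qed

section \<open>Split-off directions and input directions lie in \<open>W\<close>\<close>

text \<open>The kernel of the map from x to its subsystem part z is contained in \<open>W\<close>;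
  equivalently, states with the same z differ by an element of \<open>W\<close>.\<close>

definition reached_in :: "real vec set \<Rightarrow> nat \<Rightarrow> real mat \<Rightarrow> bool" where
  "reached_in W k T \<longleftrightarrow>
    (\<forall>x\<in>carrier_vec n. \<forall>w\<in>carrier_vec (n - k). T *\<^sub>v x = w @\<^sub>v 0\<^sub>v k \<longrightarrow> x \<in> W)"

text \<open>Openness leaves room for a nonzero step from some state. Together with additivity and
  homogeneity, proved next, this turns the slope into a linear function on \<open>W\<close>.\<close>

lemma affine_direction_unique:
  assumes "X \<noteq> {}" "affine_direction w d" "affine_direction w d'"
  shows "d = d'"
proof -
  obtain x where x: "x \<in> X" using assms(1) by blast
  have c: "w \<in> carrier_vec n" "d \<in> carrier_vec n" "d' \<in> carrier_vec n" "\<Phi> x \<in> carrier_vec n"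
    using assms(2,3) \<Phi>_carrier x by (auto simp: affine_direction_def)
  obtain e where e: "e > 0" "\<And>t. \<bar>t\<bar> < e \<Longrightarrow> x + t \<cdot>\<^sub>v w \<in> X"
    using open_vec_ray[OF X_open x c(1)] by blast
  have t: "x + (e / 2) \<cdot>\<^sub>v w \<in> X" using e by simp
  have "\<Phi> x + (e / 2) \<cdot>\<^sub>v d = \<Phi> x + (e / 2) \<cdot>\<^sub>v d'"
    using assms(2,3) x t by (auto simp: affine_direction_def)
  then show ?thesis using smult_vec_cancel c e(1) by (metis half_gt_zero less_irrefl)
qed

text \<open>The state x + t (w + w') is reached via x + t w, which must lie in \<open>X\<close> as
  well; hence the minimum of two radii.\<close>

lemma affine_direction_add:
  assumes "X \<noteq> {}" "affine_direction w d" "affine_direction w' d'" "affine_direction (w + w') d''"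
  shows "d'' = d + d'"
proof -
  obtain x where x: "x \<in> X" using assms(1) by blast
  have c: "w \<in> carrier_vec n" "w' \<in> carrier_vec n" "d \<in> carrier_vec n" "d' \<in> carrier_vec n"
    "d'' \<in> carrier_vec n" "\<Phi> x \<in> carrier_vec n"
    using assms(2-4) \<Phi>_carrier x by (auto simp: affine_direction_def)
  obtain e where e: "e > 0" "\<And>t. \<bar>t\<bar> < e \<Longrightarrow> x + t \<cdot>\<^sub>v w \<in> X"
    using open_vec_ray[OF X_open x c(1)] by blast
  have "w + w' \<in> carrier_vec n" using c by simp
  then obtain e' where e': "e' > 0" "\<And>t. \<bar>t\<bar> < e' \<Longrightarrow> x + t \<cdot>\<^sub>v (w + w') \<in> X"
    using open_vec_ray[OF X_open x] by blast
  define t where "t = min e e' / 2"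
  have t: "t \<noteq> 0" "x + t \<cdot>\<^sub>v w \<in> X" "x + t \<cdot>\<^sub>v (w + w') \<in> X"
    using e e' by (auto simp: t_def)
  have "x + t \<cdot>\<^sub>v (w + w') = x + t \<cdot>\<^sub>v w + t \<cdot>\<^sub>v w'"
    using c X_carrier[OF x] by (intro eq_vecI) (auto simp: algebra_simps)
  then have "\<Phi> (x + t \<cdot>\<^sub>v (w + w')) = \<Phi> (x + t \<cdot>\<^sub>v w) + t \<cdot>\<^sub>v d'"
    using assms(3) t unfolding affine_direction_def by metis
  also have "\<Phi> (x + t \<cdot>\<^sub>v w) = \<Phi> x + t \<cdot>\<^sub>v d"
    using assms(2) t x unfolding affine_direction_def by blast
  also have "\<Phi> x + t \<cdot>\<^sub>v d + t \<cdot>\<^sub>v d' = \<Phi> x + t \<cdot>\<^sub>v (d + d')"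
    using c by (intro eq_vecI) (auto simp: algebra_simps)
  finally have "\<Phi> x + t \<cdot>\<^sub>v d'' = \<Phi> x + t \<cdot>\<^sub>v (d + d')"
    using assms(4) t x unfolding affine_direction_def by metis
  then show ?thesis using smult_vec_cancel[OF _ t(1)] c by (metis add_carrier_vec)
qed

lemma affine_direction_smult:
  assumes "affine_direction w d"
  shows "affine_direction (c \<cdot>\<^sub>v w) (c \<cdot>\<^sub>v d)"
proof -
  have "t \<cdot>\<^sub>v (c \<cdot>\<^sub>v v) = (t * c) \<cdot>\<^sub>v v" for t and v :: "real vec"
    by (intro eq_vecI) auto
  then show ?thesis using assms by (auto simp: affine_direction_def)
qed

text \<open>Two states that differ by a multiple of \<open>p\<close> have the same z. Under the same
  input, the values of \<open>\<Gamma>\<close> and \<open>\<Psi>\<close> cancel in the difference of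
  their successors, and only the part linear in w remains.\<close>

lemma kernel_direction:
  assumes inv: "loop_invariant k l S \<Psi> Bk \<Gamma> T" and dyn: "subsystem_dynamics k l \<Psi> Bk \<Gamma> T C D E F"
    and "X \<noteq> {}" and w0: "w0 \<in> carrier_vec (n - k)" and Tp: "T *\<^sub>v p = w0 @\<^sub>v 0\<^sub>v k"
    and d: "affine_direction p d"
  shows "T *\<^sub>v d = (C *\<^sub>v w0) @\<^sub>v (Bk *\<^sub>v (E *\<^sub>v w0))"
proof -
  have T: "T \<in> carrier_mat n n" and k: "k \<le> n" and Bk: "Bk \<in> carrier_mat k l"
    using inv by (auto simp: loop_invariant_def)
  have CDEF: "C \<in> carrier_mat (n - k) (n - k)" "D \<in> carrier_mat (n - k) m"
    "E \<in> carrier_mat l (n - k)" "F \<in> carrier_mat l m"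
    using dyn by (auto simp: subsystem_dynamics_def)
  have pd: "p \<in> carrier_vec n" "d \<in> carrier_vec n" using d by (auto simp: affine_direction_def)
  obtain x where x: "x \<in> X" using \<open>X \<noteq> {}\<close> by blast
  obtain u where u: "u \<in> U" using step_onto[OF x] by blast
  note xc = X_carrier[OF x] and uc = U_carrier[OF u]
  obtain e where e: "e > 0" "\<And>t. \<bar>t\<bar> < e \<Longrightarrow> x + t \<cdot>\<^sub>v p \<in> X"
    using open_vec_ray[OF X_open x pd(1)] by blast
  define t where "t = e / 2"
  have t: "t \<noteq> 0" "x + t \<cdot>\<^sub>v p \<in> X" using e by (auto simp: t_def)
  have "T *\<^sub>v x \<in> carrier_vec (n - k + k)" using T xc k by simp
  then obtain w z where w: "w \<in> carrier_vec (n - k)" and z: "z \<in> carrier_vec k" and Tx: "T *\<^sub>v x = w @\<^sub>v z"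
    by (rule append_vec_obtain)
  have "T *\<^sub>v (x + t \<cdot>\<^sub>v p) = (w @\<^sub>v z) + t \<cdot>\<^sub>v (w0 @\<^sub>v 0\<^sub>v k)"
    by (simp only: mult_mat_vec_add_smult[OF T xc pd(1)] Tx Tp)
  also have "\<dots> = (w + t \<cdot>\<^sub>v w0) @\<^sub>v z" using w w0 z by (intro eq_vecI) auto
  finally have Tx': "T *\<^sub>v (x + t \<cdot>\<^sub>v p) = (w + t \<cdot>\<^sub>v w0) @\<^sub>v z" .
  let ?y = "\<Phi> x + B *\<^sub>v u"
  have yc: "?y \<in> carrier_vec n" "\<Phi> x \<in> carrier_vec n" "B *\<^sub>v u \<in> carrier_vec n"
    using funcset_mem[OF \<Phi>_carrier x] mult_mat_vec_carrier[OF B_carrier uc] by auto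
  have Gz: "gamma_fun \<Gamma> z \<in> carrier_vec (n - k)" "\<Psi> z \<in> carrier_vec k"
    and Ty: "T *\<^sub>v ?y = (gamma_fun \<Gamma> z + C *\<^sub>v w + D *\<^sub>v u) @\<^sub>v (\<Psi> z + Bk *\<^sub>v (E *\<^sub>v w + F *\<^sub>v u))"
    using dyn x w z Tx u unfolding subsystem_dynamics_def by blast+
  have "\<Phi> (x + t \<cdot>\<^sub>v p) = \<Phi> x + t \<cdot>\<^sub>v d"
    using d x t unfolding affine_direction_def by blast
  then have "\<Phi> (x + t \<cdot>\<^sub>v p) + B *\<^sub>v u = ?y + t \<cdot>\<^sub>v d"
    using yc pd B_carrier by (auto intro!: eq_vecI)
  then have "T *\<^sub>v ?y + t \<cdot>\<^sub>v (T *\<^sub>v d) = T *\<^sub>v (\<Phi> (x + t \<cdot>\<^sub>v p) + B *\<^sub>v u)"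
    by (simp only: mult_mat_vec_add_smult[OF T yc(1) pd(2)])
  also have "\<dots> = (gamma_fun \<Gamma> z + C *\<^sub>v (w + t \<cdot>\<^sub>v w0) + D *\<^sub>v u) @\<^sub>v (\<Psi> z + Bk *\<^sub>v (E *\<^sub>v (w + t \<cdot>\<^sub>v w0) + F *\<^sub>v u))"
    using dyn t(2) w w0 z Tx' u unfolding subsystem_dynamics_def by (metis add_carrier_vec smult_carrier_vec)
  also have "C *\<^sub>v (w + t \<cdot>\<^sub>v w0) = C *\<^sub>v w + t \<cdot>\<^sub>v (C *\<^sub>v w0)"
    by (rule mult_mat_vec_add_smult[OF CDEF(1) w w0])
  also have "E *\<^sub>v (w + t \<cdot>\<^sub>v w0) + F *\<^sub>v u = (E *\<^sub>v w + F *\<^sub>v u) + t \<cdot>\<^sub>v (E *\<^sub>v w0)"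
    using w w0 uc CDEF
    by (auto simp: mult_mat_vec_add_smult[OF CDEF(3) w w0] intro!: eq_vecI)
  also have "Bk *\<^sub>v \<dots> = Bk *\<^sub>v (E *\<^sub>v w + F *\<^sub>v u) + t \<cdot>\<^sub>v (Bk *\<^sub>v (E *\<^sub>v w0))"
  proof -
    have "E *\<^sub>v w + F *\<^sub>v u \<in> carrier_vec l" "E *\<^sub>v w0 \<in> carrier_vec l" using CDEF w w0 uc by auto
    then show ?thesis by (rule mult_mat_vec_add_smult[OF Bk])
  qed
  also have "(gamma_fun \<Gamma> z + (C *\<^sub>v w + t \<cdot>\<^sub>v (C *\<^sub>v w0)) + D *\<^sub>v u) @\<^sub>v
      (\<Psi> z + (Bk *\<^sub>v (E *\<^sub>v w + F *\<^sub>v u) + t \<cdot>\<^sub>v (Bk *\<^sub>v (E *\<^sub>v w0))))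
    = T *\<^sub>v ?y + t \<cdot>\<^sub>v ((C *\<^sub>v w0) @\<^sub>v (Bk *\<^sub>v (E *\<^sub>v w0)))"
    unfolding Ty using CDEF(1,2) Bk Gz by (intro eq_vecI) auto
  finally have eq: "T *\<^sub>v ?y + t \<cdot>\<^sub>v (T *\<^sub>v d) = T *\<^sub>v ?y + t \<cdot>\<^sub>v ((C *\<^sub>v w0) @\<^sub>v (Bk *\<^sub>v (E *\<^sub>v w0)))" .
  have "(C *\<^sub>v w0) @\<^sub>v (Bk *\<^sub>v (E *\<^sub>v w0)) \<in> carrier_vec n"
    using CDEF(1) Bk k by (intro carrier_vecI) auto
  then show ?thesis
    by (rule smult_vec_cancel[OF eq t(1) mult_mat_vec_carrier[OF T pd(2)] _ mult_mat_vec_carrier[OF T yc(1)]])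
qed

text \<open>The same comparison with the state fixed and the input moved. The dynamics speak only of
  inputs in \<open>U\<close>; since \<open>U\<close> is open, they determine the effect of every
  vector \<open>v\<close>.\<close>

lemma input_direction:
  assumes inv: "loop_invariant k l S \<Psi> Bk \<Gamma> T" and dyn: "subsystem_dynamics k l \<Psi> Bk \<Gamma> T C D E F"
    and "X \<noteq> {}" and v: "v \<in> carrier_vec m"
  shows "T *\<^sub>v (B *\<^sub>v v) = (D *\<^sub>v v) @\<^sub>v (Bk *\<^sub>v (F *\<^sub>v v))"
proof -
  have T: "T \<in> carrier_mat n n" and k: "k \<le> n" and Bk: "Bk \<in> carrier_mat k l"
    using inv by (auto simp: loop_invariant_def)
  have CDEF: "C \<in> carrier_mat (n - k) (n - k)" "D \<in> carrier_mat (n - k) m"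
    "E \<in> carrier_mat l (n - k)" "F \<in> carrier_mat l m"
    using dyn by (auto simp: subsystem_dynamics_def)
  obtain x where x: "x \<in> X" using \<open>X \<noteq> {}\<close> by blast
  obtain u where u: "u \<in> U" using step_onto[OF x] by blast
  note xc = X_carrier[OF x] and uc = U_carrier[OF u]
  obtain e where e: "e > 0" "\<And>t. \<bar>t\<bar> < e \<Longrightarrow> u + t \<cdot>\<^sub>v v \<in> U"
    using open_vec_ray[OF U_open u v] by blast
  define t where "t = e / 2"
  have t: "t \<noteq> 0" "u + t \<cdot>\<^sub>v v \<in> U" using e by (auto simp: t_def)
  have "T *\<^sub>v x \<in> carrier_vec (n - k + k)" using T xc k by simp
  then obtain w z where w: "w \<in> carrier_vec (n - k)" and z: "z \<in> carrier_vec k" and Tx: "T *\<^sub>v x = w @\<^sub>v z"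
    by (rule append_vec_obtain)
  let ?y = "\<Phi> x + B *\<^sub>v u"
  have yc: "?y \<in> carrier_vec n" "\<Phi> x \<in> carrier_vec n" "B *\<^sub>v u \<in> carrier_vec n" "B *\<^sub>v v \<in> carrier_vec n"
    using funcset_mem[OF \<Phi>_carrier x] mult_mat_vec_carrier[OF B_carrier uc]
      mult_mat_vec_carrier[OF B_carrier v] by auto
  have Gz: "gamma_fun \<Gamma> z \<in> carrier_vec (n - k)" "\<Psi> z \<in> carrier_vec k"
    and Ty: "\<And>u. u \<in> U \<Longrightarrow> T *\<^sub>v (\<Phi> x + B *\<^sub>v u)
      = (gamma_fun \<Gamma> z + C *\<^sub>v w + D *\<^sub>v u) @\<^sub>v (\<Psi> z + Bk *\<^sub>v (E *\<^sub>v w + F *\<^sub>v u))"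
    using dyn x w z Tx unfolding subsystem_dynamics_def by blast+
  have "\<Phi> x + B *\<^sub>v (u + t \<cdot>\<^sub>v v) = ?y + t \<cdot>\<^sub>v (B *\<^sub>v v)"
    using yc B_carrier by (auto simp: mult_mat_vec_add_smult[OF B_carrier uc v] intro!: eq_vecI)
  then have "T *\<^sub>v ?y + t \<cdot>\<^sub>v (T *\<^sub>v (B *\<^sub>v v)) = T *\<^sub>v (\<Phi> x + B *\<^sub>v (u + t \<cdot>\<^sub>v v))"
    by (simp only: mult_mat_vec_add_smult[OF T yc(1,4)])
  also have "\<dots> = (gamma_fun \<Gamma> z + C *\<^sub>v w + D *\<^sub>v (u + t \<cdot>\<^sub>v v)) @\<^sub>v (\<Psi> z + Bk *\<^sub>v (E *\<^sub>v w + F *\<^sub>v (u + t \<cdot>\<^sub>v v)))"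
    by (rule Ty[OF t(2)])
  also have "D *\<^sub>v (u + t \<cdot>\<^sub>v v) = D *\<^sub>v u + t \<cdot>\<^sub>v (D *\<^sub>v v)"
    by (rule mult_mat_vec_add_smult[OF CDEF(2) uc v])
  also have "E *\<^sub>v w + F *\<^sub>v (u + t \<cdot>\<^sub>v v) = (E *\<^sub>v w + F *\<^sub>v u) + t \<cdot>\<^sub>v (F *\<^sub>v v)"
    using w v uc CDEF
    by (auto simp: mult_mat_vec_add_smult[OF CDEF(4) uc v] intro!: eq_vecI)
  also have "Bk *\<^sub>v \<dots> = Bk *\<^sub>v (E *\<^sub>v w + F *\<^sub>v u) + t \<cdot>\<^sub>v (Bk *\<^sub>v (F *\<^sub>v v))"
  proof -
    have "E *\<^sub>v w + F *\<^sub>v u \<in> carrier_vec l" "F *\<^sub>v v \<in> carrier_vec l" using CDEF w v uc by auto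
    then show ?thesis by (rule mult_mat_vec_add_smult[OF Bk])
  qed
  also have "(gamma_fun \<Gamma> z + C *\<^sub>v w + (D *\<^sub>v u + t \<cdot>\<^sub>v (D *\<^sub>v v))) @\<^sub>v
      (\<Psi> z + (Bk *\<^sub>v (E *\<^sub>v w + F *\<^sub>v u) + t \<cdot>\<^sub>v (Bk *\<^sub>v (F *\<^sub>v v))))
    = T *\<^sub>v ?y + t \<cdot>\<^sub>v ((D *\<^sub>v v) @\<^sub>v (Bk *\<^sub>v (F *\<^sub>v v)))"
    unfolding Ty[OF u] using CDEF(1,2) Bk Gz by (intro eq_vecI) auto
  finally have eq: "T *\<^sub>v ?y + t \<cdot>\<^sub>v (T *\<^sub>v (B *\<^sub>v v)) = T *\<^sub>v ?y + t \<cdot>\<^sub>v ((D *\<^sub>v v) @\<^sub>v (Bk *\<^sub>v (F *\<^sub>v v)))" .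
  have "(D *\<^sub>v v) @\<^sub>v (Bk *\<^sub>v (F *\<^sub>v v)) \<in> carrier_vec n"
    using CDEF(2) Bk k by (intro carrier_vecI) auto
  then show ?thesis
    by (rule smult_vec_cancel[OF eq t(1) mult_mat_vec_carrier[OF T yc(4)] _ mult_mat_vec_carrier[OF T yc(1)]])
qed

text \<open>Let v = E w0 + F u0 and let p have the coordinates (w0, 0). Then p is in
  \<open>W\<close>, hence so are its slope and B u0, and the sum of these two has the z-part Bk v.
  Subtracting it from \<open>x\<close> leaves a vector with z-part 0, which
  \<open>reached_in\<close> covers. The invariance of \<open>W\<close> under slopes enters
  here.\<close>

lemma reached_range:
  assumes inv: "loop_invariant k l S \<Psi> Bk \<Gamma> T" and W: "invariant_directions W" "reached_in W k T"
    and "X \<noteq> {}" and x: "x \<in> carrier_vec n" and w: "w \<in> carrier_vec (n - k)" and v: "v \<in> carrier_vec l"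
    and Tx: "T *\<^sub>v x = w @\<^sub>v (Bk *\<^sub>v v)"
  shows "x \<in> W"
proof -
  obtain C D E F where dyn: "subsystem_dynamics k l \<Psi> Bk \<Gamma> T C D E F"
    using inv unfolding loop_invariant_def by blast
  have T: "T \<in> carrier_mat n n" "invertible_mat T" and k: "k \<le> n" and Bk: "Bk \<in> carrier_mat k l"
    using inv by (auto simp: loop_invariant_def)
  obtain Ti where Ti: "Ti \<in> carrier_mat n n" "T * Ti = 1\<^sub>m n" using invertible_mat_inverse[OF T] by metis
  have CDEF: "C \<in> carrier_mat (n - k) (n - k)" "D \<in> carrier_mat (n - k) m"
    "E \<in> carrier_mat l (n - k)" "F \<in> carrier_mat l m"
    using dyn by (auto simp: subsystem_dynamics_def)
  have W_add: "a + b \<in> W" and W_c: "a \<in> carrier_vec n" if "a \<in> W" "b \<in> W" for a b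
    using W(1) that unfolding invariant_directions_def by blast+
  obtain w0 u0 where w0: "w0 \<in> carrier_vec (n - k)" and u0: "u0 \<in> carrier_vec m" and v_eq: "v = E *\<^sub>v w0 + F *\<^sub>v u0"
    using dyn v unfolding subsystem_dynamics_def by blast
  define p where "p = Ti *\<^sub>v (w0 @\<^sub>v 0\<^sub>v k)"
  have w0k: "w0 @\<^sub>v 0\<^sub>v k \<in> carrier_vec n" using append_carrier_vec[OF w0, of "0\<^sub>v k" k] k by simp
  have p: "p \<in> carrier_vec n" "T *\<^sub>v p = w0 @\<^sub>v 0\<^sub>v k"
    using Ti w0k mult_mat_vec_inverse[OF T(1) Ti] by (auto simp: p_def)
  then have "p \<in> W" using W(2) w0 unfolding reached_in_def by blast
  then obtain d where d: "d \<in> W" "affine_direction p d"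
    using W(1) unfolding invariant_directions_def by blast
  have "B *\<^sub>v u0 \<in> W" using W(1) u0 unfolding invariant_directions_def by blast
  define y where "y = d + B *\<^sub>v u0"
  have yW: "y \<in> W" and yc: "y \<in> carrier_vec n" and dc: "d \<in> carrier_vec n"
    using W_add[OF d(1) \<open>B *\<^sub>v u0 \<in> W\<close>] W_c d(1) unfolding y_def by blast+
  have "T *\<^sub>v y = T *\<^sub>v d + T *\<^sub>v (B *\<^sub>v u0)"
    using dc W_c[OF \<open>B *\<^sub>v u0 \<in> W\<close>] \<open>B *\<^sub>v u0 \<in> W\<close> by (simp add: y_def mult_add_distrib_mat_vec[OF T(1)])
  also have "\<dots> = (C *\<^sub>v w0 + D *\<^sub>v u0) @\<^sub>v (Bk *\<^sub>v v)"
  proof -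
    have "Bk *\<^sub>v v = Bk *\<^sub>v (E *\<^sub>v w0) + Bk *\<^sub>v (F *\<^sub>v u0)"
      using CDEF w0 u0 unfolding v_eq by (intro mult_add_distrib_mat_vec[OF Bk]) auto
    then show ?thesis
      using kernel_direction[OF inv dyn \<open>X \<noteq> {}\<close> w0 p(2) d(2)] input_direction[OF inv dyn \<open>X \<noteq> {}\<close> u0]
        CDEF Bk by (auto intro!: eq_vecI)
  qed
  finally have Ty: "T *\<^sub>v y = (C *\<^sub>v w0 + D *\<^sub>v u0) @\<^sub>v (Bk *\<^sub>v v)" .
  let ?w = "w + (-1) \<cdot>\<^sub>v (C *\<^sub>v w0 + D *\<^sub>v u0)"
  have "T *\<^sub>v (x + (-1) \<cdot>\<^sub>v y) = T *\<^sub>v x + (-1) \<cdot>\<^sub>v (T *\<^sub>v y)"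
    by (rule mult_mat_vec_add_smult[OF T(1) x yc])
  also have "\<dots> = ?w @\<^sub>v 0\<^sub>v k"
    unfolding Tx Ty using w CDEF Bk by (intro eq_vecI) auto
  finally have Txy: "T *\<^sub>v (x + (-1) \<cdot>\<^sub>v y) = ?w @\<^sub>v 0\<^sub>v k" .
  have "?w \<in> carrier_vec (n - k)" using w CDEF w0 u0 by auto
  with Txy have xyW: "x + (-1) \<cdot>\<^sub>v y \<in> W" using W(2) x yc unfolding reached_in_def by auto
  have "x + (-1) \<cdot>\<^sub>v y + y = x" using x yc by (intro eq_vecI) auto
  with W_add[OF xyW yW] show ?thesis by simp
qed

end

section \<open>Affineness along the range of the input matrix\<close>

text \<open>The hypothesis compares two points of one fibre over x2 directly; \<open>\<phi>\<close>
  is then defined through an arbitrary base point of each fibre.\<close>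

lemma affine_in_firstI:
  assumes M: "M \<in> carrier_mat q r"
    and f: "\<And>y. y \<in> Y \<Longrightarrow> f y \<in> carrier_vec q"
    and aff: "\<And>x1 x1' x2. x1 \<in> carrier_vec r \<Longrightarrow> x1' \<in> carrier_vec r \<Longrightarrow> x2 \<in> carrier_vec s \<Longrightarrow>
      x1 @\<^sub>v x2 \<in> Y \<Longrightarrow> x1' @\<^sub>v x2 \<in> Y \<Longrightarrow> f (x1 @\<^sub>v x2) = f (x1' @\<^sub>v x2) + M *\<^sub>v (x1 - x1')"
  shows "\<exists>\<phi>. affine_in_first q r s Y f \<phi> M"
proof -
  define pick where "pick x2 = (SOME x1. x1 \<in> carrier_vec r \<and> x1 @\<^sub>v x2 \<in> Y)" for x2
  have pick: "pick x2 \<in> carrier_vec r" "pick x2 @\<^sub>v x2 \<in> Y" if "x1 \<in> carrier_vec r" "x1 @\<^sub>v x2 \<in> Y" for x1 x2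
    using someI[of "\<lambda>x1. x1 \<in> carrier_vec r \<and> x1 @\<^sub>v x2 \<in> Y" x1] that unfolding pick_def by auto
  define \<phi> where "\<phi> x2 = f (pick x2 @\<^sub>v x2) - M *\<^sub>v pick x2" for x2
  have "affine_in_first q r s Y f \<phi> M"
    unfolding affine_in_first_def
  proof (intro conjI ballI impI)
    show "\<phi> \<in> proj_second r s Y \<rightarrow> carrier_vec q"
      using pick f M unfolding \<phi>_def proj_second_def by fastforce
    fix x1 x2 assume x: "x1 \<in> carrier_vec r" "x2 \<in> carrier_vec s" "x1 @\<^sub>v x2 \<in> Y"
    note p = pick[OF x(1,3)]
    have "f (x1 @\<^sub>v x2) = f (pick x2 @\<^sub>v x2) + (M *\<^sub>v x1 - M *\<^sub>v pick x2)"
      using aff[OF x(1) p(1) x(2,3) p(2)] mult_minus_distrib_mat_vec[OF M x(1) p(1)] by simp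
    also have "\<dots> = \<phi> x2 + M *\<^sub>v x1"
      using f[OF p(2)] M unfolding \<phi>_def by (intro eq_vecI) auto
    finally show "f (x1 @\<^sub>v x2) = \<phi> x2 + M *\<^sub>v x1" .
  qed (rule M)
  then show ?thesis by blast
qed

context control_system
begin

text \<open>Common core of both affineness tests; the columns of \<open>J\<close> are directions in
  which the input moves the subsystem. Lifts to \<open>X\<close> of two points of \<open>S\<close>
  that differ in such a direction differ by an element of \<open>W\<close>. There the slope of
  \<open>\<Phi>\<close> is linear and independent of the state, so one pair of matrices serves all
  of \<open>S\<close>.\<close>

lemma fiber_affine:
  assumes inv: "loop_invariant k l S \<Psi> Bk \<Gamma> T" and W: "invariant_directions W"
    and reach: "X \<noteq> {} \<Longrightarrow> reached_in W k T"
    and J: "J \<in> carrier_mat k r"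
    and range: "\<And>\<xi>. \<xi> \<in> carrier_vec r \<Longrightarrow> \<exists>v\<in>carrier_vec l. J *\<^sub>v \<xi> = Bk *\<^sub>v v"
  obtains M1 M2 where "M1 \<in> carrier_mat (n - k) r" "M2 \<in> carrier_mat k r"
    "\<And>z z' \<xi>. z \<in> S \<Longrightarrow> z' \<in> S \<Longrightarrow> \<xi> \<in> carrier_vec r \<Longrightarrow> z = z' + J *\<^sub>v \<xi> \<Longrightarrow>
      gamma_fun \<Gamma> z = gamma_fun \<Gamma> z' + M1 *\<^sub>v \<xi> \<and> \<Psi> z = \<Psi> z' + M2 *\<^sub>v \<xi>"
proof (cases "X = {}")
  case True
  then have "S = {}" using inv unfolding loop_invariant_def proj_second_def by auto
  then show ?thesis using that[of "0\<^sub>m (n - k) r" "0\<^sub>m k r"] by simp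
next
  case False
  note reach = reach[OF False]
  obtain C D E F where dyn: "subsystem_dynamics k l \<Psi> Bk \<Gamma> T C D E F"
    using inv unfolding loop_invariant_def by blast
  have T: "T \<in> carrier_mat n n" "invertible_mat T" and k: "k \<le> n" and Bk: "Bk \<in> carrier_mat k l"
    and S: "S = proj_second (n - k) k ((*\<^sub>v) T ` X)"
    using inv by (auto simp: loop_invariant_def)
  obtain Ti where Ti: "Ti \<in> carrier_mat n n" "T * Ti = 1\<^sub>m n" "Ti * T = 1\<^sub>m n"
    using invertible_mat_inverse[OF T] by metis
  have TTi: "T *\<^sub>v (Ti *\<^sub>v v) = v" if "v \<in> carrier_vec n" for v
    using mult_mat_vec_inverse[OF T(1) Ti(1,2) that] .
  have TiT: "Ti *\<^sub>v (T *\<^sub>v v) = v" if "v \<in> carrier_vec n" for v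
    using mult_mat_vec_inverse[OF Ti(1) T(1) Ti(3) that] .
  have CDEF: "C \<in> carrier_mat (n - k) (n - k)" "D \<in> carrier_mat (n - k) m"
    "E \<in> carrier_mat l (n - k)" "F \<in> carrier_mat l m"
    using dyn by (auto simp: subsystem_dynamics_def)
  have W_add: "a + b \<in> W" and W_smult: "c \<cdot>\<^sub>v a \<in> W" if "a \<in> W" "b \<in> W" for a b c
    using W that unfolding invariant_directions_def by blast+
  \<comment> \<open>A slope is chosen for each direction; uniqueness forces the choice to be linear
    on \<open>W\<close>.\<close>
  have "\<forall>w. \<exists>d. w \<in> W \<longrightarrow> affine_direction w d"
    using W unfolding invariant_directions_def by blast
  then obtain A where A: "\<And>w. w \<in> W \<Longrightarrow> affine_direction w (A w)" by metis
  have A_c: "A w \<in> carrier_vec n" if "w \<in> W" for w using A[OF that] by (simp add: affine_direction_def)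
  have A_add: "A (a + b) = A a + A b" if "a \<in> W" "b \<in> W" for a b
    using affine_direction_add[OF False A A A] W_add that by blast
  have A_smult: "A (c \<cdot>\<^sub>v a) = c \<cdot>\<^sub>v A a" if "a \<in> W" for a c
    using affine_direction_unique[OF False A affine_direction_smult[OF A]] W_smult that by blast
  have app: "a @\<^sub>v b \<in> carrier_vec n" if "a \<in> carrier_vec (n - k)" "b \<in> carrier_vec k" for a b :: "real vec"
    using append_carrier_vec[OF that] k by simp
  \<comment> \<open>\<open>q\<close> lifts J \<xi> to a direction of the full system that leaves the
    split-off block fixed.\<close>
  define q where "q \<xi> = Ti *\<^sub>v (0\<^sub>v (n - k) @\<^sub>v (J *\<^sub>v \<xi>))" for \<xi>
  have Jc: "0\<^sub>v (n - k) @\<^sub>v (J *\<^sub>v \<xi>) \<in> carrier_vec n" for \<xi>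
    by (intro app carrier_vecI) (use J in auto)
  have q_c: "q \<xi> \<in> carrier_vec n" and Tq: "T *\<^sub>v q \<xi> = 0\<^sub>v (n - k) @\<^sub>v (J *\<^sub>v \<xi>)" for \<xi>
    unfolding q_def using Ti(1) Jc TTi by auto
  have q_W: "q \<xi> \<in> W" if "\<xi> \<in> carrier_vec r" for \<xi>
  proof -
    obtain v where v: "v \<in> carrier_vec l" "J *\<^sub>v \<xi> = Bk *\<^sub>v v" using range \<open>\<xi> \<in> carrier_vec r\<close> by blast
    show ?thesis
      by (rule reached_range[OF inv W reach False q_c zero_carrier_vec v(1)]) (simp add: Tq v(2))
  qed
  have q_lin: "q (a + c \<cdot>\<^sub>v b) = q a + c \<cdot>\<^sub>v q b" if "a \<in> carrier_vec r" "b \<in> carrier_vec r" for a b c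
  proof -
    have "0\<^sub>v (n - k) @\<^sub>v (J *\<^sub>v (a + c \<cdot>\<^sub>v b)) = (0\<^sub>v (n - k) @\<^sub>v (J *\<^sub>v a)) + c \<cdot>\<^sub>v (0\<^sub>v (n - k) @\<^sub>v (J *\<^sub>v b))"
      using J unfolding mult_mat_vec_add_smult[OF J that] by (intro eq_vecI) auto
    then show ?thesis unfolding q_def using mult_mat_vec_add_smult[OF Ti(1) Jc Jc] by simp
  qed
  have Aq_lin: "T *\<^sub>v A (q (a + c \<cdot>\<^sub>v b)) = T *\<^sub>v A (q a) + c \<cdot>\<^sub>v (T *\<^sub>v A (q b))"
    if "a \<in> carrier_vec r" "b \<in> carrier_vec r" for a b c
  proof -
    have "A (q (a + c \<cdot>\<^sub>v b)) = A (q a) + c \<cdot>\<^sub>v A (q b)"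
      using q_lin[OF that] A_add A_smult q_W that W_smult by metis
    then show ?thesis using mult_mat_vec_add_smult[OF T(1) A_c A_c] q_W that by metis
  qed
  have Aq_c: "T *\<^sub>v A (q \<xi>) \<in> carrier_vec n" if "\<xi> \<in> carrier_vec r" for \<xi>
    using T(1) A_c[OF q_W[OF that]] by simp
  obtain M where M: "M \<in> carrier_mat n r" "\<And>\<xi>. \<xi> \<in> carrier_vec r \<Longrightarrow> T *\<^sub>v A (q \<xi>) = M *\<^sub>v \<xi>"
  proof (rule linear_fun_as_mat[of r "\<lambda>\<xi>. T *\<^sub>v A (q \<xi>)" n])
    show "T *\<^sub>v A (q (a + b)) = T *\<^sub>v A (q a) + T *\<^sub>v A (q b)"
      if "a \<in> carrier_vec r" "b \<in> carrier_vec r" for a b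
      using Aq_lin[OF that, of 1] that by simp
    show "T *\<^sub>v A (q (c \<cdot>\<^sub>v b)) = c \<cdot>\<^sub>v (T *\<^sub>v A (q b))" if b: "b \<in> carrier_vec r" for c b
    proof -
      have "c \<cdot>\<^sub>v b = b + (c - 1) \<cdot>\<^sub>v b" by (intro eq_vecI) (auto simp: algebra_simps)
      then have "T *\<^sub>v A (q (c \<cdot>\<^sub>v b)) = T *\<^sub>v A (q b) + (c - 1) \<cdot>\<^sub>v (T *\<^sub>v A (q b))"
        using Aq_lin[OF b b] by metis
      also have "\<dots> = c \<cdot>\<^sub>v (T *\<^sub>v A (q b))" by (intro eq_vecI) (auto simp: algebra_simps)
      finally show ?thesis .
    qed
  qed (use Aq_c in auto)
  obtain M1 M2 where M12: "M1 \<in> carrier_mat (n - k) r" "M2 \<in> carrier_mat k r"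
    and M_split: "\<And>\<xi>. \<xi> \<in> carrier_vec r \<Longrightarrow> M *\<^sub>v \<xi> = (M1 *\<^sub>v \<xi>) @\<^sub>v (M2 *\<^sub>v \<xi>)"
    using split_rows_mat[of M "n - k" k r] M(1) k by auto
  have "gamma_fun \<Gamma> z = gamma_fun \<Gamma> z' + M1 *\<^sub>v \<xi> \<and> \<Psi> z = \<Psi> z' + M2 *\<^sub>v \<xi>"
    if z: "z \<in> S" and z': "z' \<in> S" and \<xi>: "\<xi> \<in> carrier_vec r" and zz: "z = z' + J *\<^sub>v \<xi>" for z z' \<xi>
  proof -
    have zc: "z \<in> carrier_vec k" "z' \<in> carrier_vec k" using z z' unfolding S proj_second_def by auto
    obtain x w where x: "x \<in> X" "w \<in> carrier_vec (n - k)" "T *\<^sub>v x = w @\<^sub>v z"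
      using z unfolding S proj_second_def by force
    obtain x' w' where x': "x' \<in> X" "w' \<in> carrier_vec (n - k)" "T *\<^sub>v x' = w' @\<^sub>v z'"
      using z' unfolding S proj_second_def by force
    obtain u where u: "u \<in> U" using step_onto[OF x(1)] by blast
    note xc = X_carrier[OF x(1)] and xc' = X_carrier[OF x'(1)] and uc = U_carrier[OF u]
    have ww: "w - w' \<in> carrier_vec (n - k)" using x x' by simp
    \<comment> \<open>The lifts \<open>x\<close> and \<open>x'\<close> may also differ in the
      split-off block. This part of the difference is \<open>p\<close>; it lies in \<open>W\<close>
      by \<open>reached_in\<close>, and \<open>kernel_direction\<close> gives its slope.\<close>
    define p where "p = Ti *\<^sub>v ((w - w') @\<^sub>v 0\<^sub>v k)"
    have p_c: "p \<in> carrier_vec n" and Tp: "T *\<^sub>v p = (w - w') @\<^sub>v 0\<^sub>v k"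
      unfolding p_def using Ti(1) app[OF ww] TTi by auto
    have p_W: "p \<in> W" using reach p_c ww Tp unfolding reached_in_def by blast
    note q_W = q_W[OF \<xi>]
    have "x = x' + 1 \<cdot>\<^sub>v (p + q \<xi>)"
    proof -
      have "T *\<^sub>v (x' + (p + q \<xi>)) = T *\<^sub>v x' + (T *\<^sub>v p + T *\<^sub>v q \<xi>)"
        using mult_add_distrib_mat_vec[OF T(1) xc', of "p + q \<xi>"] mult_add_distrib_mat_vec[OF T(1) p_c q_c]
          p_c q_c by simp
      also have "\<dots> = T *\<^sub>v x"
        unfolding x x' Tp Tq zz using x(2) x'(2) zc J by (intro eq_vecI) auto
      finally have "x' + (p + q \<xi>) = x"
        using TiT[of x] TiT[of "x' + (p + q \<xi>)"] xc xc' p_c q_c by simp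
      then show ?thesis by simp
    qed
    with x(1) x'(1) A[OF W_add[OF p_W q_W]] have "\<Phi> x = \<Phi> x' + 1 \<cdot>\<^sub>v A (p + q \<xi>)"
      unfolding affine_direction_def by blast
    then have \<Phi>x: "\<Phi> x = \<Phi> x' + (A p + A (q \<xi>))" using A_add[OF p_W q_W] by simp
    have yc: "\<Phi> x' \<in> carrier_vec n" "B *\<^sub>v u \<in> carrier_vec n"
      using funcset_mem[OF \<Phi>_carrier x'(1)] mult_mat_vec_carrier[OF B_carrier uc] by auto
    have "\<Phi> x + B *\<^sub>v u = (\<Phi> x' + B *\<^sub>v u) + (A p + A (q \<xi>))"
      unfolding \<Phi>x using yc A_c[OF p_W] A_c[OF q_W] B_carrier by (intro eq_vecI) auto
    then have "T *\<^sub>v (\<Phi> x + B *\<^sub>v u) = T *\<^sub>v (\<Phi> x' + B *\<^sub>v u) + (T *\<^sub>v A p + T *\<^sub>v A (q \<xi>))"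
      using mult_add_distrib_mat_vec[OF T(1) A_c[OF p_W] A_c[OF q_W]]
        mult_add_distrib_mat_vec[OF T(1), of "\<Phi> x' + B *\<^sub>v u" "A p + A (q \<xi>)"] yc A_c[OF p_W] A_c[OF q_W]
      by simp
    also have "T *\<^sub>v A p = (C *\<^sub>v (w - w')) @\<^sub>v (Bk *\<^sub>v (E *\<^sub>v (w - w')))"
      by (rule kernel_direction[OF inv dyn False ww Tp A[OF p_W]])
    also have "T *\<^sub>v A (q \<xi>) = (M1 *\<^sub>v \<xi>) @\<^sub>v (M2 *\<^sub>v \<xi>)" using M(2) M_split \<xi> by simp
    finally have Tdiff: "T *\<^sub>v (\<Phi> x + B *\<^sub>v u) = T *\<^sub>v (\<Phi> x' + B *\<^sub>v u) +
      (((C *\<^sub>v (w - w')) @\<^sub>v (Bk *\<^sub>v (E *\<^sub>v (w - w')))) + ((M1 *\<^sub>v \<xi>) @\<^sub>v (M2 *\<^sub>v \<xi>)))" .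
    have Gz: "gamma_fun \<Gamma> z \<in> carrier_vec (n - k)" "\<Psi> z \<in> carrier_vec k"
      and Ty: "T *\<^sub>v (\<Phi> x + B *\<^sub>v u)
        = (gamma_fun \<Gamma> z + C *\<^sub>v w + D *\<^sub>v u) @\<^sub>v (\<Psi> z + Bk *\<^sub>v (E *\<^sub>v w + F *\<^sub>v u))"
      using dyn x zc(1) u unfolding subsystem_dynamics_def by blast+
    have Gz': "gamma_fun \<Gamma> z' \<in> carrier_vec (n - k)" "\<Psi> z' \<in> carrier_vec k"
      and Ty': "T *\<^sub>v (\<Phi> x' + B *\<^sub>v u)
        = (gamma_fun \<Gamma> z' + C *\<^sub>v w' + D *\<^sub>v u) @\<^sub>v (\<Psi> z' + Bk *\<^sub>v (E *\<^sub>v w' + F *\<^sub>v u))"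
      using dyn x' zc(2) u unfolding subsystem_dynamics_def by blast+
    have EF: "E *\<^sub>v w \<in> carrier_vec l" "E *\<^sub>v w' \<in> carrier_vec l" "F *\<^sub>v u \<in> carrier_vec l"
      using CDEF x(2) x'(2) uc by auto
    have lin: "C *\<^sub>v (w - w') = C *\<^sub>v w - C *\<^sub>v w'"
      "Bk *\<^sub>v (E *\<^sub>v (w - w')) = Bk *\<^sub>v (E *\<^sub>v w) - Bk *\<^sub>v (E *\<^sub>v w')"
      "Bk *\<^sub>v (E *\<^sub>v w + F *\<^sub>v u) = Bk *\<^sub>v (E *\<^sub>v w) + Bk *\<^sub>v (F *\<^sub>v u)"
      "Bk *\<^sub>v (E *\<^sub>v w' + F *\<^sub>v u) = Bk *\<^sub>v (E *\<^sub>v w') + Bk *\<^sub>v (F *\<^sub>v u)"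
      using mult_minus_distrib_mat_vec[OF CDEF(1) x(2) x'(2)] mult_minus_distrib_mat_vec[OF CDEF(3) x(2) x'(2)]
        mult_minus_distrib_mat_vec[OF Bk EF(1,2)] mult_add_distrib_mat_vec[OF Bk EF(1,3)]
        mult_add_distrib_mat_vec[OF Bk EF(2,3)] by simp_all
    have dims: "dim_row C = n - k" "dim_row D = n - k" "dim_row Bk = k" "dim_row M1 = n - k" "dim_row M2 = k"
      using CDEF Bk M12 by auto
    \<comment> \<open>The two blocks of the right-hand side, named so that the equation of stacked
      vectors can be separated. All terms in \<open>w\<close>, \<open>w'\<close> and
      \<open>u\<close> then cancel.\<close>
    define a where "a = gamma_fun \<Gamma> z' + C *\<^sub>v w' + D *\<^sub>v u + (C *\<^sub>v w - C *\<^sub>v w' + M1 *\<^sub>v \<xi>)"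
    define b where "b = \<Psi> z' + (Bk *\<^sub>v (E *\<^sub>v w') + Bk *\<^sub>v (F *\<^sub>v u)) +
      (Bk *\<^sub>v (E *\<^sub>v w) - Bk *\<^sub>v (E *\<^sub>v w') + M2 *\<^sub>v \<xi>)"
    have "(gamma_fun \<Gamma> z + C *\<^sub>v w + D *\<^sub>v u) @\<^sub>v (\<Psi> z + (Bk *\<^sub>v (E *\<^sub>v w) + Bk *\<^sub>v (F *\<^sub>v u))) = a @\<^sub>v b"
      using Tdiff unfolding Ty Ty' lin a_def b_def using dims by (auto intro!: eq_vecI)
    moreover have "gamma_fun \<Gamma> z + C *\<^sub>v w + D *\<^sub>v u \<in> carrier_vec (n - k)" "a \<in> carrier_vec (n - k)"
      using dims unfolding a_def by (auto intro!: carrier_vecI)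
    ultimately have ab: "gamma_fun \<Gamma> z + C *\<^sub>v w + D *\<^sub>v u = a" "\<Psi> z + (Bk *\<^sub>v (E *\<^sub>v w) + Bk *\<^sub>v (F *\<^sub>v u)) = b"
      using append_vec_eq by blast+
    have "gamma_fun \<Gamma> z = gamma_fun \<Gamma> z' + M1 *\<^sub>v \<xi>"
    proof (rule eq_vecI)
      fix i assume "i < dim_vec (gamma_fun \<Gamma> z' + M1 *\<^sub>v \<xi>)"
      then have i: "i < n - k" using dims by simp
      have "(gamma_fun \<Gamma> z + C *\<^sub>v w + D *\<^sub>v u) $ i = a $ i" using ab(1) by simp
      then show "gamma_fun \<Gamma> z $ i = (gamma_fun \<Gamma> z' + M1 *\<^sub>v \<xi>) $ i"
        using i dims Gz Gz' unfolding a_def by simp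
    qed (use Gz dims in simp)
    moreover have "\<Psi> z = \<Psi> z' + M2 *\<^sub>v \<xi>"
    proof (rule eq_vecI)
      fix i assume "i < dim_vec (\<Psi> z' + M2 *\<^sub>v \<xi>)"
      then have i: "i < k" using dims by simp
      have "(\<Psi> z + (Bk *\<^sub>v (E *\<^sub>v w) + Bk *\<^sub>v (F *\<^sub>v u))) $ i = b $ i" using ab(2) by simp
      then show "\<Psi> z $ i = (\<Psi> z' + M2 *\<^sub>v \<xi>) $ i"
        using i dims Gz Gz' unfolding b_def by simp
    qed (use Gz dims in simp)
    ultimately show ?thesis by blast
  qed
  then show ?thesis using that M12 by blast
qed

end

lemma affine_map_onI:
  assumes "M \<in> carrier_mat q d" "S \<subseteq> carrier_vec d" "\<And>z. z \<in> S \<Longrightarrow> f z \<in> carrier_vec q"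
    and aff: "\<And>z z'. z \<in> S \<Longrightarrow> z' \<in> S \<Longrightarrow> f z = f z' + M *\<^sub>v (z - z')"
  shows "affine_map_on d S f"
proof (cases "S = {}")
  case True
  then show ?thesis
    unfolding affine_map_on_def by (intro exI[of _ 0] bexI[of _ vNil] bexI[of _ "0\<^sub>m 0 d"]) auto
next
  case False
  then obtain z0 where z0: "z0 \<in> S" by blast
  have "f z = (f z0 - M *\<^sub>v z0) + M *\<^sub>v z" if z: "z \<in> S" for z
  proof -
    have "f z = f z0 + (M *\<^sub>v z - M *\<^sub>v z0)"
      using aff[OF z z0] mult_minus_distrib_mat_vec[OF assms(1) subsetD[OF assms(2) z] subsetD[OF assms(2) z0]]
      by simp
    also have "\<dots> = (f z0 - M *\<^sub>v z0) + M *\<^sub>v z"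
      using assms(1) assms(3)[OF z0] by (intro eq_vecI) auto
    finally show ?thesis .
  qed
  moreover have "f z0 - M *\<^sub>v z0 \<in> carrier_vec q" using assms(1) by (intro carrier_vecI) auto
  ultimately show ?thesis using assms(1) unfolding affine_map_on_def by blast
qed

text \<open>An absent \<open>\<Gamma>\<close> is read as a function with \<open>q = 0\<close>
  components, which spares the step of the invariant a case distinction. \<open>scd_affineI\<close>
  is the converse.\<close>

lemma scd_affineE:
  assumes "scd_affine r s S \<Phi> \<Gamma> T Ti \<Phi>2 B2 \<Gamma>'"
  obtains \<Phi>1 B1 q \<gamma> C where
    "affine_in_first r r s ((*\<^sub>v) T ` S) (\<lambda>y. vec_first (T *\<^sub>v \<Phi> (Ti *\<^sub>v y)) r) \<Phi>1 B1"
    "affine_in_first s r s ((*\<^sub>v) T ` S) (\<lambda>y. vec_last (T *\<^sub>v \<Phi> (Ti *\<^sub>v y)) s) \<Phi>2 B2"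
    "affine_in_first q r s ((*\<^sub>v) T ` S) (\<lambda>y. gamma_fun \<Gamma> (Ti *\<^sub>v y)) \<gamma> C"
    "\<Gamma>' = (\<lambda>x2. \<gamma> x2 @\<^sub>v \<Phi>1 x2)"
proof (cases \<Gamma>)
  case None
  then obtain \<Phi>1 B1 where 1:
    "affine_in_first r r s ((*\<^sub>v) T ` S) (\<lambda>y. vec_first (T *\<^sub>v \<Phi> (Ti *\<^sub>v y)) r) \<Phi>1 B1"
    "affine_in_first s r s ((*\<^sub>v) T ` S) (\<lambda>y. vec_last (T *\<^sub>v \<Phi> (Ti *\<^sub>v y)) s) \<Phi>2 B2"
    "\<Gamma>' = \<Phi>1"
    using assms unfolding scd_affine_def Let_def by auto
  have "affine_in_first 0 r s ((*\<^sub>v) T ` S) (\<lambda>y. gamma_fun \<Gamma> (Ti *\<^sub>v y)) (\<lambda>_. vNil) (0\<^sub>m 0 r)"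
    using None unfolding affine_in_first_def gamma_fun_def by (auto intro!: eq_vecI)
  from that[OF 1(1,2) this] 1(3) show ?thesis by simp
next
  case (Some G)
  then show ?thesis
    using assms that unfolding scd_affine_def Let_def gamma_fun_def by auto
qed

lemma scd_affineI:
  assumes "affine_in_first r r s ((*\<^sub>v) T ` S) (\<lambda>y. vec_first (T *\<^sub>v \<Phi> (Ti *\<^sub>v y)) r) \<Phi>1 B1"
    "affine_in_first s r s ((*\<^sub>v) T ` S) (\<lambda>y. vec_last (T *\<^sub>v \<Phi> (Ti *\<^sub>v y)) s) \<Phi>2 B2"
    "affine_in_first q r s ((*\<^sub>v) T ` S) (\<lambda>y. gamma_fun \<Gamma> (Ti *\<^sub>v y)) \<gamma> C"
  shows "\<exists>\<Gamma>'. scd_affine r s S \<Phi> \<Gamma> T Ti \<Phi>2 B2 \<Gamma>'"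
proof (cases \<Gamma>)
  case None
  then show ?thesis using assms(1,2) unfolding scd_affine_def Let_def by auto
next
  case (Some G)
  then show ?thesis
    using assms unfolding scd_affine_def Let_def gamma_fun_def
    by (intro exI[of _ "\<lambda>x2. \<gamma> x2 @\<^sub>v \<Phi>1 x2"] exI[of _ \<Phi>1] exI[of _ B1]) auto
qed

section \<open>No pass gets stuck\<close>

inductive_cases SCD_Flag0E: "SCD S \<Phi> B \<Gamma> (Flag0 \<Phi>' B' \<Gamma>' Ts)"
inductive_cases SCD_Flag1E: "SCD S \<Phi> B \<Gamma> Flag1"
inductive_cases SCD_Flag2E: "SCD S \<Phi> B \<Gamma> Flag2"
inductive_cases iteration_RunningE: "iteration n (Running S \<Phi> B \<Gamma> T) s"

text \<open>The premises of the five rules exhaust all cases as soon as some admissible coordinates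
  exist.\<close>

lemma SCD_total: "\<exists>out. SCD S \<Phi> B \<Gamma> out"
proof -
  obtain T Ti D where "scd_coords B T Ti D" using scd_coords_exist by blast
  then show ?thesis by (meson SCD.intros)
qed

lemma iteration_total: "\<exists>s'. iteration n (Running S \<Phi> B \<Gamma> T) s'"
proof -
  obtain out where out: "SCD S \<Phi> B \<Gamma> out" using SCD_total by blast
  show ?thesis
  proof (cases out)
    case (Flag0 \<Phi>' B' \<Gamma>' Ts)
    show ?thesis using iteration.intros(1)[OF out[unfolded Flag0]] by blast
  next
    case Flag1
    show ?thesis using iteration.intros(2)[OF out[unfolded Flag1]] by blast
  next
    case Flag2
    show ?thesis using iteration.intros(3)[OF out[unfolded Flag2]] by blast
  qed
qed

section \<open>The affineness tests succeed in the presence of \<open>W\<close>\<close>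

context control_system
begin

lemma loop_invariant_carrier:
  assumes inv: "loop_invariant k l S \<Psi> Bk \<Gamma> T" and z: "z \<in> S"
  shows "z \<in> carrier_vec k" "gamma_fun \<Gamma> z \<in> carrier_vec (n - k)" "\<Psi> z \<in> carrier_vec k"
    "\<exists>x\<in>X. \<exists>w\<in>carrier_vec (n - k). T *\<^sub>v x = w @\<^sub>v z"
proof -
  have "z \<in> proj_second (n - k) k ((*\<^sub>v) T ` X)" using inv z by (simp add: loop_invariant_def)
  then show "z \<in> carrier_vec k" and ex: "\<exists>x\<in>X. \<exists>w\<in>carrier_vec (n - k). T *\<^sub>v x = w @\<^sub>v z"
    unfolding proj_second_def image_iff mem_Collect_eq by metis+
  then show "gamma_fun \<Gamma> z \<in> carrier_vec (n - k)" "\<Psi> z \<in> carrier_vec k"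
    using inv unfolding loop_invariant_def subsystem_dynamics_def by blast+
qed

lemma loop_invariant_memI:
  assumes inv: "loop_invariant k l S \<Psi> Bk \<Gamma> T" and "x \<in> X" "w \<in> carrier_vec (n - k)" "z \<in> carrier_vec k"
    and Tx: "T *\<^sub>v x = w @\<^sub>v z"
  shows "z \<in> S"
proof -
  have S: "S = proj_second (n - k) k ((*\<^sub>v) T ` X)" using inv by (simp add: loop_invariant_def)
  have "w @\<^sub>v z \<in> (*\<^sub>v) T ` X" using imageI[OF assms(2), of "(*\<^sub>v) T"] unfolding Tx .
  then show ?thesis unfolding S proj_second_def using assms(3,4) by blast
qed

text \<open>At full rank every direction is in the range of \<open>Bk\<close>, so
  \<open>fiber_affine\<close> with the identity as \<open>J\<close> compares any two points of
  \<open>S\<close>.\<close>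

lemma full_row_rank_affine:
  assumes inv: "loop_invariant k l S \<Psi> Bk \<Gamma> T" and W: "invariant_directions W"
    and reach: "X \<noteq> {} \<Longrightarrow> reached_in W k T" and full: "full_row_rank Bk"
  shows "affine_map_on k S \<Psi> \<and> pred_option (affine_map_on k S) \<Gamma>"
proof -
  have Bk: "Bk \<in> carrier_mat k l" using inv by (simp add: loop_invariant_def)
  have "\<exists>v\<in>carrier_vec l. 1\<^sub>m k *\<^sub>v \<xi> = Bk *\<^sub>v v" if "\<xi> \<in> carrier_vec k" for \<xi>
    using full that Bk unfolding full_row_rank_iff_surj by fastforce
  then obtain M1 M2 where M: "M1 \<in> carrier_mat (n - k) k" "M2 \<in> carrier_mat k k"
    and aff: "\<And>z z' \<xi>. z \<in> S \<Longrightarrow> z' \<in> S \<Longrightarrow> \<xi> \<in> carrier_vec k \<Longrightarrow> z = z' + 1\<^sub>m k *\<^sub>v \<xi> \<Longrightarrow>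
      gamma_fun \<Gamma> z = gamma_fun \<Gamma> z' + M1 *\<^sub>v \<xi> \<and> \<Psi> z = \<Psi> z' + M2 *\<^sub>v \<xi>"
    using fiber_affine[OF inv W reach one_carrier_mat] by metis
  note c = loop_invariant_carrier[OF inv]
  have aff': "gamma_fun \<Gamma> z = gamma_fun \<Gamma> z' + M1 *\<^sub>v (z - z')" "\<Psi> z = \<Psi> z' + M2 *\<^sub>v (z - z')"
    if "z \<in> S" "z' \<in> S" for z z'
  proof -
    have "z = z' + 1\<^sub>m k *\<^sub>v (z - z')" using c(1)[OF that(1)] c(1)[OF that(2)] by (intro eq_vecI) auto
    with aff[OF that, of "z - z'"] c(1) that
    show "gamma_fun \<Gamma> z = gamma_fun \<Gamma> z' + M1 *\<^sub>v (z - z')" "\<Psi> z = \<Psi> z' + M2 *\<^sub>v (z - z')"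
      by auto
  qed
  have "affine_map_on k S \<Psi>" by (rule affine_map_onI[OF M(2) _ c(3) aff'(2)]) (use c(1) in blast)+
  moreover have "affine_map_on k S (gamma_fun \<Gamma>)" by (rule affine_map_onI[OF M(1) _ c(2) aff'(1)]) (use c(1) in blast)+
  ultimately show ?thesis by (cases \<Gamma>) (auto simp: gamma_fun_def)
qed

text \<open>Moving only the first block in the new coordinates means moving along (\<xi>, 0), which
  is the image under \<open>Ts\<close> of the range of \<open>Bk\<close>. This holds for every
  admissible choice of coordinates.\<close>

lemma split_affine_exists:
  assumes inv: "loop_invariant k l S \<Psi> Bk \<Gamma> T" and W: "invariant_directions W"
    and reach: "X \<noteq> {} \<Longrightarrow> reached_in W k T" and coords: "scd_coords Bk Ts Tsi D"
  shows "\<exists>\<Phi>2 B2 \<Gamma>'. scd_affine (dim_row D) (k - dim_row D) S \<Psi> \<Gamma> Ts Tsi \<Phi>2 B2 \<Gamma>'"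
proof -
  have Bk: "Bk \<in> carrier_mat k l" using inv by (simp add: loop_invariant_def)
  note co = scd_coordsD[OF coords Bk]
  define r s where "r = dim_row D" and "s = k - dim_row D"
  have rs: "r + s = k" using co(5) by (simp add: r_def s_def)
  let ?I = "1\<^sub>m r @\<^sub>r 0\<^sub>m s r :: real mat"
  have I: "?I \<in> carrier_mat k r" using carrier_append_rows[of "1\<^sub>m r" r r "0\<^sub>m s r" s] rs by simp
  \<comment> \<open>The first \<open>r\<close> columns of \<open>Tsi\<close>: they translate a
    change of the first block into the old coordinates of the subsystem.\<close>
  define J where "J = Tsi * ?I"
  have J: "J \<in> carrier_mat k r" using co(2) I by (simp add: J_def)
  have J_eq: "J *\<^sub>v \<xi> = Tsi *\<^sub>v (\<xi> @\<^sub>v 0\<^sub>v s)" if \<xi>: "\<xi> \<in> carrier_vec r" for \<xi>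
  proof -
    have "0\<^sub>m s r *\<^sub>v \<xi> = 0\<^sub>v s" using \<xi> by (intro eq_vecI) auto
    then have "?I *\<^sub>v \<xi> = \<xi> @\<^sub>v 0\<^sub>v s"
      using mat_mult_append[of "1\<^sub>m r" r r "0\<^sub>m s r" s \<xi>] \<xi> by simp
    then show ?thesis unfolding J_def using assoc_mult_mat_vec[OF co(2) I \<xi>] by simp
  qed
  have "\<exists>v\<in>carrier_vec l. J *\<^sub>v \<xi> = Bk *\<^sub>v v" if \<xi>: "\<xi> \<in> carrier_vec r" for \<xi>
  proof -
    obtain v where v: "v \<in> carrier_vec l" "D *\<^sub>v v = \<xi>" using co(9)[of \<xi>] \<xi> by (auto simp: r_def)
    have "J *\<^sub>v \<xi> = Tsi *\<^sub>v (Ts *\<^sub>v (Bk *\<^sub>v v))"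
      using J_eq[OF \<xi>] co(8)[OF v(1)] v(2) by (simp add: s_def)
    also have "\<dots> = Bk *\<^sub>v v"
      using mult_mat_vec_inverse[OF co(2,1,4)] Bk v(1) by simp
    finally show ?thesis using v(1) by blast
  qed
  then obtain M1 M2 where M: "M1 \<in> carrier_mat (n - k) r" "M2 \<in> carrier_mat k r"
    and aff: "\<And>z z' \<xi>. z \<in> S \<Longrightarrow> z' \<in> S \<Longrightarrow> \<xi> \<in> carrier_vec r \<Longrightarrow> z = z' + J *\<^sub>v \<xi> \<Longrightarrow>
      gamma_fun \<Gamma> z = gamma_fun \<Gamma> z' + M1 *\<^sub>v \<xi> \<and> \<Psi> z = \<Psi> z' + M2 *\<^sub>v \<xi>"
    using fiber_affine[OF inv W reach J] by metis
  note c = loop_invariant_carrier[OF inv]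
  let ?Y = "(*\<^sub>v) Ts ` S"
  have Y: "Tsi *\<^sub>v y \<in> S" if "y \<in> ?Y" for y
    using that mult_mat_vec_inverse[OF co(2,1,4)] c(1) by auto
  have aff': "gamma_fun \<Gamma> (Tsi *\<^sub>v (x1 @\<^sub>v x2)) = gamma_fun \<Gamma> (Tsi *\<^sub>v (x1' @\<^sub>v x2)) + M1 *\<^sub>v (x1 - x1')"
    "\<Psi> (Tsi *\<^sub>v (x1 @\<^sub>v x2)) = \<Psi> (Tsi *\<^sub>v (x1' @\<^sub>v x2)) + M2 *\<^sub>v (x1 - x1')"
    if x: "x1 \<in> carrier_vec r" "x1' \<in> carrier_vec r" "x2 \<in> carrier_vec s" "x1 @\<^sub>v x2 \<in> ?Y" "x1' @\<^sub>v x2 \<in> ?Y"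
    for x1 x1' x2
  proof -
    have d: "x1 - x1' \<in> carrier_vec r" using x by simp
    have cc: "x1' @\<^sub>v x2 \<in> carrier_vec k" "(x1 - x1') @\<^sub>v 0\<^sub>v s \<in> carrier_vec k"
      using append_carrier_vec[OF x(2,3)] append_carrier_vec[OF d, of "0\<^sub>v s" s] rs by auto
    have "x1 @\<^sub>v x2 = (x1' @\<^sub>v x2) + ((x1 - x1') @\<^sub>v 0\<^sub>v s)"
      using x(1-3) by (intro eq_vecI) auto
    then have "Tsi *\<^sub>v (x1 @\<^sub>v x2) = Tsi *\<^sub>v (x1' @\<^sub>v x2) + J *\<^sub>v (x1 - x1')"
      using mult_add_distrib_mat_vec[OF co(2) cc] J_eq[OF d] by simp
    from aff[OF Y[OF x(4)] Y[OF x(5)] d this]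
    show "gamma_fun \<Gamma> (Tsi *\<^sub>v (x1 @\<^sub>v x2)) = gamma_fun \<Gamma> (Tsi *\<^sub>v (x1' @\<^sub>v x2)) + M1 *\<^sub>v (x1 - x1')"
      "\<Psi> (Tsi *\<^sub>v (x1 @\<^sub>v x2)) = \<Psi> (Tsi *\<^sub>v (x1' @\<^sub>v x2)) + M2 *\<^sub>v (x1 - x1')" by auto
  qed
  \<comment> \<open>The two row blocks are the constant matrices for the two halves of the
    transformed dynamics.\<close>
  have "Ts * M2 \<in> carrier_mat (r + s) r" using co(1) M(2) rs by simp
  then obtain N1 N2 where N: "N1 \<in> carrier_mat r r" "N2 \<in> carrier_mat s r"
    and N_eq: "\<And>v. v \<in> carrier_vec r \<Longrightarrow> (Ts * M2) *\<^sub>v v = (N1 *\<^sub>v v) @\<^sub>v (N2 *\<^sub>v v)"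
    by (rule split_rows_mat) blast
  have aff_f: "vec_first (Ts *\<^sub>v \<Psi> (Tsi *\<^sub>v (x1 @\<^sub>v x2))) r
        = vec_first (Ts *\<^sub>v \<Psi> (Tsi *\<^sub>v (x1' @\<^sub>v x2))) r + N1 *\<^sub>v (x1 - x1')"
      "vec_last (Ts *\<^sub>v \<Psi> (Tsi *\<^sub>v (x1 @\<^sub>v x2))) s
        = vec_last (Ts *\<^sub>v \<Psi> (Tsi *\<^sub>v (x1' @\<^sub>v x2))) s + N2 *\<^sub>v (x1 - x1')"
    if x: "x1 \<in> carrier_vec r" "x1' \<in> carrier_vec r" "x2 \<in> carrier_vec s" "x1 @\<^sub>v x2 \<in> ?Y" "x1' @\<^sub>v x2 \<in> ?Y"
    for x1 x1' x2
  proof -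
    have d: "x1 - x1' \<in> carrier_vec r" using x by simp
    let ?a = "Ts *\<^sub>v \<Psi> (Tsi *\<^sub>v (x1' @\<^sub>v x2))"
    have M2c: "M2 *\<^sub>v (x1 - x1') \<in> carrier_vec k" using M(2) d by simp
    have "?a \<in> carrier_vec (r + s)" using c(3)[OF Y[OF x(5)]] co(1) rs by simp
    then obtain a1 a2 where a: "a1 \<in> carrier_vec r" "a2 \<in> carrier_vec s" "?a = a1 @\<^sub>v a2"
      by (rule append_vec_obtain)
    have Nc: "N1 *\<^sub>v (x1 - x1') \<in> carrier_vec r" "N2 *\<^sub>v (x1 - x1') \<in> carrier_vec s"
      using N d by auto
    have "Ts *\<^sub>v \<Psi> (Tsi *\<^sub>v (x1 @\<^sub>v x2)) = ?a + (Ts * M2) *\<^sub>v (x1 - x1')"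
      unfolding aff'(2)[OF x] using mult_add_distrib_mat_vec[OF co(1) c(3)[OF Y[OF x(5)]] M2c]
        assoc_mult_mat_vec[OF co(1) M(2) d] by simp
    also have "\<dots> = (a1 + N1 *\<^sub>v (x1 - x1')) @\<^sub>v (a2 + N2 *\<^sub>v (x1 - x1'))"
      unfolding a(3) N_eq[OF d] using append_vec_add[OF a(1) Nc(1) a(2) Nc(2)] .
    finally show "vec_first (Ts *\<^sub>v \<Psi> (Tsi *\<^sub>v (x1 @\<^sub>v x2))) r = vec_first ?a r + N1 *\<^sub>v (x1 - x1')"
      "vec_last (Ts *\<^sub>v \<Psi> (Tsi *\<^sub>v (x1 @\<^sub>v x2))) s = vec_last ?a s + N2 *\<^sub>v (x1 - x1')"
      unfolding a(3) using a(1,2) Nc by simp_all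
  qed
  obtain \<Phi>1 where "affine_in_first r r s ?Y (\<lambda>y. vec_first (Ts *\<^sub>v \<Psi> (Tsi *\<^sub>v y)) r) \<Phi>1 N1"
    using affine_in_firstI[where Y = ?Y and f = "\<lambda>y. vec_first (Ts *\<^sub>v \<Psi> (Tsi *\<^sub>v y)) r",
        OF N(1) vec_first_carrier aff_f(1)] by blast
  moreover obtain \<Phi>2 where "affine_in_first s r s ?Y (\<lambda>y. vec_last (Ts *\<^sub>v \<Psi> (Tsi *\<^sub>v y)) s) \<Phi>2 N2"
    using affine_in_firstI[where Y = ?Y and f = "\<lambda>y. vec_last (Ts *\<^sub>v \<Psi> (Tsi *\<^sub>v y)) s",
        OF N(2) vec_last_carrier aff_f(2)] by blast
  moreover obtain \<gamma> where "affine_in_first (n - k) r s ?Y (\<lambda>y. gamma_fun \<Gamma> (Tsi *\<^sub>v y)) \<gamma> M1"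
    using affine_in_firstI[where Y = ?Y and f = "\<lambda>y. gamma_fun \<Gamma> (Tsi *\<^sub>v y)", OF M(1) c(2)[OF Y] aff'(1)]
    by blast
  ultimately have "\<exists>\<Gamma>'. scd_affine r s S \<Psi> \<Gamma> Ts Tsi \<Phi>2 N2 \<Gamma>'" by (rule scd_affineI)
  then show ?thesis unfolding r_def s_def by blast
qed

section \<open>One pass preserves the invariant\<close>

text \<open>The block x1 moves from the subsystem into w and becomes the input of what is left,
  through \<open>B2\<close>. The old input E w + F u acts on x1 through \<open>Dk\<close>.
  Affineness in x1 leaves functions of x2 alone, and these form the new
  \<open>\<Gamma>\<close>.\<close>

lemma loop_invariant_step:
  assumes inv: "loop_invariant k l S \<Psi> Bk \<Gamma> T" and coords: "scd_coords Bk Ts Tsi Dk"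
    and not_full: "\<not> full_row_rank Bk" and nonzero: "Bk \<noteq> 0\<^sub>m k l"
    and aff: "scd_affine (dim_row Dk) (k - dim_row Dk) S \<Psi> \<Gamma> Ts Tsi \<Phi>2 B2 \<Gamma>'"
  defines "r \<equiv> dim_row Dk" and "s \<equiv> k - dim_row Dk"
  shows "loop_invariant s r (proj_second r s ((*\<^sub>v) Ts ` S)) \<Phi>2 B2 (Some \<Gamma>') (block_id (n - k) Ts * T)"
    and "X \<noteq> {} \<Longrightarrow> invariant_directions W \<Longrightarrow> reached_in W k T \<Longrightarrow> reached_in W s (block_id (n - k) Ts * T)"
proof -
  obtain C D E F where dyn: "subsystem_dynamics k l \<Psi> Bk \<Gamma> T C D E F"
    using inv unfolding loop_invariant_def by blast
  have T: "T \<in> carrier_mat n n" "invertible_mat T" and k: "k \<le> n" and Bk: "Bk \<in> carrier_mat k l"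
    and S: "S = proj_second (n - k) k ((*\<^sub>v) T ` X)"
    using inv by (auto simp: loop_invariant_def)
  obtain Ti where Ti: "Ti \<in> carrier_mat n n" "T * Ti = 1\<^sub>m n" "Ti * T = 1\<^sub>m n"
    using invertible_mat_inverse[OF T] by metis
  have CDEF: "C \<in> carrier_mat (n - k) (n - k)" "D \<in> carrier_mat (n - k) m"
    "E \<in> carrier_mat l (n - k)" "F \<in> carrier_mat l m"
    using dyn by (auto simp: subsystem_dynamics_def)
  note co = scd_coordsD[OF coords Bk]
  have rs: "r + s = k" "1 \<le> s" "n - s = (n - k) + r" "s \<le> n"
    using scd_coords_dim[OF coords Bk not_full nonzero] k by (auto simp: r_def s_def)
  have Dk: "Dk \<in> carrier_mat r l" using co(6) unfolding r_def .
  define T' where "T' = block_id (n - k) Ts * T"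
  have bT: "block_id (n - k) Ts \<in> carrier_mat n n" using block_id_carrier[OF co(1), of "n - k"] k by simp
  have bTi: "block_id (n - k) Tsi \<in> carrier_mat n n" using block_id_carrier[OF co(2), of "n - k"] k by simp
  have T': "T' \<in> carrier_mat n n" using bT T(1) by (simp add: T'_def)
  have "invertible_mat T'"
  proof (rule invertible_matI[OF T'])
    let ?b = "block_id (n - k) Ts" and ?bi = "block_id (n - k) Tsi"
    show "Ti * ?bi \<in> carrier_mat n n" using Ti bTi by simp
    have bb: "?b * ?bi = 1\<^sub>m n" "?bi * ?b = 1\<^sub>m n"
      using block_id_mult[OF co(1,2,3), of "n - k"] block_id_mult[OF co(2,1,4), of "n - k"] k by auto
    have "T' * (Ti * ?bi) = ?b * ((T * Ti) * ?bi)"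
      unfolding T'_def using bT bTi T(1) Ti(1)
      by (simp add: assoc_mult_mat[of _ n n _ n _ n])
    then show "T' * (Ti * ?bi) = 1\<^sub>m n" using bb bTi Ti by simp
    have "(Ti * ?bi) * T' = Ti * ((?bi * ?b) * T)"
      unfolding T'_def using bT bTi T(1) Ti(1)
      by (simp add: assoc_mult_mat[of _ n n _ n _ n])
    then show "(Ti * ?bi) * T' = 1\<^sub>m n" using bb T(1) Ti by simp
  qed
  have T'_eq: "T' *\<^sub>v x = w @\<^sub>v (Ts *\<^sub>v z)"
    if "x \<in> carrier_vec n" "w \<in> carrier_vec (n - k)" "z \<in> carrier_vec k" "T *\<^sub>v x = w @\<^sub>v z" for x w z
    unfolding T'_def using assoc_mult_mat_vec[OF bT T(1) that(1)] that block_id_mult_vec[OF co(1) that(2,3)]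
    by simp
  \<comment> \<open>Coordinates ((w, x1), x2) after the pass are regrouped as (w, (x1, x2)), whose
    second part comes from the former z.\<close>
  have T'_split: "\<exists>w x1 z. w' = w @\<^sub>v x1 \<and> w \<in> carrier_vec (n - k) \<and> x1 \<in> carrier_vec r \<and> z \<in> carrier_vec k \<and>
      T *\<^sub>v x = w @\<^sub>v z \<and> Ts *\<^sub>v z = x1 @\<^sub>v x2 \<and> z = Tsi *\<^sub>v (x1 @\<^sub>v x2)"
    if x: "x \<in> carrier_vec n" and w': "w' \<in> carrier_vec (n - s)" and "x2 \<in> carrier_vec s"
      and Tx: "T' *\<^sub>v x = w' @\<^sub>v x2" for x w' x2
  proof -
    obtain w x1 where w: "w \<in> carrier_vec (n - k)" "x1 \<in> carrier_vec r" "w' = w @\<^sub>v x1"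
      using w' unfolding rs(3) by (rule append_vec_obtain)
    have "T *\<^sub>v x \<in> carrier_vec (n - k + k)" using T(1) x k by simp
    then obtain w0 z where z: "w0 \<in> carrier_vec (n - k)" "z \<in> carrier_vec k" "T *\<^sub>v x = w0 @\<^sub>v z"
      by (rule append_vec_obtain)
    have "w0 @\<^sub>v (Ts *\<^sub>v z) = w @\<^sub>v (x1 @\<^sub>v x2)"
      using T'_eq[OF x z] Tx w(3) by (simp add: append_vec_assoc)
    then have "w0 = w" "Ts *\<^sub>v z = x1 @\<^sub>v x2" using append_vec_eq[OF z(1) w(1)] by auto
    then show ?thesis using w z mult_mat_vec_inverse[OF co(2,1,4) z(2)] by metis
  qed
  obtain \<Phi>1 B1 q \<gamma> Cq where
    f1: "affine_in_first r r s ((*\<^sub>v) Ts ` S) (\<lambda>y. vec_first (Ts *\<^sub>v \<Psi> (Tsi *\<^sub>v y)) r) \<Phi>1 B1" and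
    f2: "affine_in_first s r s ((*\<^sub>v) Ts ` S) (\<lambda>y. vec_last (Ts *\<^sub>v \<Psi> (Tsi *\<^sub>v y)) s) \<Phi>2 B2" and
    fg: "affine_in_first q r s ((*\<^sub>v) Ts ` S) (\<lambda>y. gamma_fun \<Gamma> (Tsi *\<^sub>v y)) \<gamma> Cq" and
    \<Gamma>': "\<Gamma>' = (\<lambda>x2. \<gamma> x2 @\<^sub>v \<Phi>1 x2)"
    by (rule scd_affineE[OF aff[folded r_def s_def]])
  have B12: "B1 \<in> carrier_mat r r" "B2 \<in> carrier_mat s r" using f1 f2 by (auto simp: affine_in_first_def)
  note c = loop_invariant_carrier[OF inv]
  have Y: "Tsi *\<^sub>v y \<in> S" if "y \<in> (*\<^sub>v) Ts ` S" for y
    using that mult_mat_vec_inverse[OF co(2,1,4)] c(1) by auto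
  note S_I = loop_invariant_memI[OF inv]
  \<comment> \<open>If \<open>X = {}\<close>, the number of rows of \<open>Cq\<close> is arbitrary.\<close>
  have "\<exists>Cg \<in> carrier_mat (n - k) r. \<forall>x1\<in>carrier_vec r. \<forall>x2\<in>carrier_vec s. x1 @\<^sub>v x2 \<in> (*\<^sub>v) Ts ` S \<longrightarrow>
      \<gamma> x2 \<in> carrier_vec (n - k) \<and> gamma_fun \<Gamma> (Tsi *\<^sub>v (x1 @\<^sub>v x2)) = \<gamma> x2 + Cg *\<^sub>v x1"
  proof (cases "\<exists>x1\<in>carrier_vec r. \<exists>x2\<in>carrier_vec s. x1 @\<^sub>v x2 \<in> (*\<^sub>v) Ts ` S")
    case False
    then show ?thesis by (intro bexI[of _ "0\<^sub>m (n - k) r"]) auto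
  next
    case True
    then obtain x1 x2 where x: "x1 \<in> carrier_vec r" "x2 \<in> carrier_vec s" "x1 @\<^sub>v x2 \<in> (*\<^sub>v) Ts ` S" by blast
    have "gamma_fun \<Gamma> (Tsi *\<^sub>v (x1 @\<^sub>v x2)) = \<gamma> x2 + Cq *\<^sub>v x1" "Cq \<in> carrier_mat q r"
      using fg x unfolding affine_in_first_def by blast+
    then have q: "q = n - k"
      using c(2)[OF Y[OF x(3)]] by (metis carrier_matD(1) carrier_vecD dim_mult_mat_vec index_add_vec(2))
    then show ?thesis
      using fg unfolding affine_in_first_def proj_second_def q by (intro bexI[of _ Cq]) auto
  qed
  then obtain Cg where Cg: "Cg \<in> carrier_mat (n - k) r" and
    g_eq: "\<And>x1 x2. x1 \<in> carrier_vec r \<Longrightarrow> x2 \<in> carrier_vec s \<Longrightarrow> x1 @\<^sub>v x2 \<in> (*\<^sub>v) Ts ` S \<Longrightarrow>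
      \<gamma> x2 \<in> carrier_vec (n - k) \<and> gamma_fun \<Gamma> (Tsi *\<^sub>v (x1 @\<^sub>v x2)) = \<gamma> x2 + Cg *\<^sub>v x1"
    by blast
  have \<Psi>_eq: "\<Phi>1 x2 \<in> carrier_vec r \<and> \<Phi>2 x2 \<in> carrier_vec s \<and>
      Ts *\<^sub>v \<Psi> (Tsi *\<^sub>v (x1 @\<^sub>v x2)) = (\<Phi>1 x2 + B1 *\<^sub>v x1) @\<^sub>v (\<Phi>2 x2 + B2 *\<^sub>v x1)"
    if x: "x1 \<in> carrier_vec r" "x2 \<in> carrier_vec s" "x1 @\<^sub>v x2 \<in> (*\<^sub>v) Ts ` S" for x1 x2
  proof -
    have "Ts *\<^sub>v \<Psi> (Tsi *\<^sub>v (x1 @\<^sub>v x2)) \<in> carrier_vec (r + s)"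
      using c(3)[OF Y[OF x(3)]] co(1) rs(1) by simp
    from vec_first_last_append[OF this, symmetric] show ?thesis
      using f1 f2 x unfolding affine_in_first_def proj_second_def by auto
  qed
  \<comment> \<open>The rows for w gain \<open>Cg\<close>, the dependence of the old
    \<open>\<Gamma>\<close> on x1. The rows for x1, in \<open>C2\<close>, combine the old input via
    \<open>Dk * E\<close> with \<open>B1\<close>.\<close>
  obtain C1 where C1: "C1 \<in> carrier_mat (n - k) (n - k + r)"
    "\<And>v w. v \<in> carrier_vec (n - k) \<Longrightarrow> w \<in> carrier_vec r \<Longrightarrow> C1 *\<^sub>v (v @\<^sub>v w) = C *\<^sub>v v + Cg *\<^sub>v w"
    using row_block_mat[OF CDEF(1) Cg] by blast
  have DE: "Dk * E \<in> carrier_mat r (n - k)" using Dk CDEF by simp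
  obtain C2 where C2: "C2 \<in> carrier_mat r (n - k + r)"
    "\<And>v w. v \<in> carrier_vec (n - k) \<Longrightarrow> w \<in> carrier_vec r \<Longrightarrow> C2 *\<^sub>v (v @\<^sub>v w) = (Dk * E) *\<^sub>v v + B1 *\<^sub>v w"
    using row_block_mat[OF DE B12(1)] by blast
  \<comment> \<open>The new input is the last block of the enlarged w: \<open>E'\<close> is the
    projection to it, and \<open>u\<close> has no direct influence.\<close>
  obtain E' :: "real mat" where E': "E' \<in> carrier_mat r (n - k + r)"
    "\<And>v w. v \<in> carrier_vec (n - k) \<Longrightarrow> w \<in> carrier_vec r \<Longrightarrow> E' *\<^sub>v (v @\<^sub>v w) = 0\<^sub>m r (n - k) *\<^sub>v v + 1\<^sub>m r *\<^sub>v w"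
    using row_block_mat[OF zero_carrier_mat[of r "n - k"] one_carrier_mat[of r]] by blast
  have E'_eq: "E' *\<^sub>v (v @\<^sub>v w) + 0\<^sub>m r m *\<^sub>v u = w"
    if "v \<in> carrier_vec (n - k)" "w \<in> carrier_vec r" "u \<in> carrier_vec m" for v w u
    unfolding E'(2)[OF that(1,2)] using that by (intro eq_vecI) auto
  have DF: "Dk * F \<in> carrier_mat r m" using Dk CDEF by simp
  have "subsystem_dynamics s r \<Phi>2 B2 (Some \<Gamma>') T' (C1 @\<^sub>r C2) (D @\<^sub>r (Dk * F)) E' (0\<^sub>m r m)"
    unfolding subsystem_dynamics_def rs(3)
  proof (intro conjI ballI impI)
    fix v :: "real vec" assume v: "v \<in> carrier_vec r"
    show "\<exists>w\<in>carrier_vec (n - k + r). \<exists>u\<in>carrier_vec m. v = E' *\<^sub>v w + 0\<^sub>m r m *\<^sub>v u"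
      using v E'_eq[of "0\<^sub>v (n - k)" v "0\<^sub>v m"]
      by (intro bexI[of _ "0\<^sub>v (n - k) @\<^sub>v v"] bexI[of _ "0\<^sub>v m"]) auto
  next
    fix x w' x2 assume x: "x \<in> X" and w': "w' \<in> carrier_vec (n - k + r)" and x2: "x2 \<in> carrier_vec s"
      and Tx: "T' *\<^sub>v x = w' @\<^sub>v x2"
    obtain w x1 z where w: "w' = w @\<^sub>v x1" "w \<in> carrier_vec (n - k)" and x1: "x1 \<in> carrier_vec r"
      and z: "z \<in> carrier_vec k" "T *\<^sub>v x = w @\<^sub>v z" "Ts *\<^sub>v z = x1 @\<^sub>v x2" "z = Tsi *\<^sub>v (x1 @\<^sub>v x2)"
      using T'_split[OF X_carrier[OF x] _ x2 Tx] w' rs(3) by auto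
    have zS: "z \<in> S" by (rule S_I[OF x w(2) z(1,2)])
    have xY: "x1 @\<^sub>v x2 \<in> (*\<^sub>v) Ts ` S" using imageI[OF zS, of "(*\<^sub>v) Ts"] unfolding z(3) .
    have g: "\<gamma> x2 \<in> carrier_vec (n - k)" "gamma_fun \<Gamma> z = \<gamma> x2 + Cg *\<^sub>v x1"
      using g_eq[OF x1 x2 xY, folded z(4)] by blast+
    have \<Phi>12: "\<Phi>1 x2 \<in> carrier_vec r" "\<Phi>2 x2 \<in> carrier_vec s"
      and \<Psi>: "Ts *\<^sub>v \<Psi> z = (\<Phi>1 x2 + B1 *\<^sub>v x1) @\<^sub>v (\<Phi>2 x2 + B2 *\<^sub>v x1)"
      using \<Psi>_eq[OF x1 x2 xY, folded z(4)] by blast+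
    show "gamma_fun (Some \<Gamma>') x2 \<in> carrier_vec (n - k + r)" "\<Phi>2 x2 \<in> carrier_vec s"
      using g(1) \<Phi>12 by (auto simp: gamma_fun_def \<Gamma>')
    fix u assume u: "u \<in> U"
    note uc = U_carrier[OF u]
    let ?v = "E *\<^sub>v w + F *\<^sub>v u"
    have v: "?v \<in> carrier_vec l" using CDEF w(2) uc by auto
    have Bv: "Bk *\<^sub>v ?v \<in> carrier_vec k" using Bk v by simp
    have Ty: "T *\<^sub>v (\<Phi> x + B *\<^sub>v u) = (gamma_fun \<Gamma> z + C *\<^sub>v w + D *\<^sub>v u) @\<^sub>v (\<Psi> z + Bk *\<^sub>v ?v)"
      using dyn x w(2) z(1,2) u unfolding subsystem_dynamics_def by blast
    have "T' *\<^sub>v (\<Phi> x + B *\<^sub>v u) = (gamma_fun \<Gamma> z + C *\<^sub>v w + D *\<^sub>v u) @\<^sub>v (Ts *\<^sub>v (\<Psi> z + Bk *\<^sub>v ?v))"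
      using CDEF w(2) uc c(2,3)[OF zS] Bv
      by (intro T'_eq[OF X_carrier[OF step_in_X[OF x u]] _ _ Ty]) auto
    also have "Ts *\<^sub>v (\<Psi> z + Bk *\<^sub>v ?v) = ((\<Phi>1 x2 + B1 *\<^sub>v x1) @\<^sub>v (\<Phi>2 x2 + B2 *\<^sub>v x1)) + ((Dk *\<^sub>v ?v) @\<^sub>v 0\<^sub>v s)"
      using mult_add_distrib_mat_vec[OF co(1) c(3)[OF zS] Bv] \<Psi> co(8)[OF v] by (simp add: s_def)
    also have "Dk *\<^sub>v ?v = (Dk * E) *\<^sub>v w + (Dk * F) *\<^sub>v u"
      using mult_add_distrib_mat_vec[OF Dk, of "E *\<^sub>v w" "F *\<^sub>v u"] CDEF w(2) uc
        assoc_mult_mat_vec[OF Dk CDEF(3) w(2)] assoc_mult_mat_vec[OF Dk CDEF(4) uc] by auto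
    also have "(gamma_fun \<Gamma> z + C *\<^sub>v w + D *\<^sub>v u) @\<^sub>v
        (((\<Phi>1 x2 + B1 *\<^sub>v x1) @\<^sub>v (\<Phi>2 x2 + B2 *\<^sub>v x1)) + (((Dk * E) *\<^sub>v w + (Dk * F) *\<^sub>v u) @\<^sub>v 0\<^sub>v s))
      = ((\<gamma> x2 @\<^sub>v \<Phi>1 x2) + ((C *\<^sub>v w + Cg *\<^sub>v x1) @\<^sub>v ((Dk * E) *\<^sub>v w + B1 *\<^sub>v x1)) +
          ((D *\<^sub>v u) @\<^sub>v ((Dk * F) *\<^sub>v u))) @\<^sub>v (\<Phi>2 x2 + B2 *\<^sub>v x1)"
      unfolding g(2) using g(1) \<Phi>12 CDEF Cg B12 Dk by (intro eq_vecI) auto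
    also have "\<dots> = (gamma_fun (Some \<Gamma>') x2 + (C1 @\<^sub>r C2) *\<^sub>v w' + (D @\<^sub>r (Dk * F)) *\<^sub>v u) @\<^sub>v
        (\<Phi>2 x2 + B2 *\<^sub>v (E' *\<^sub>v w' + 0\<^sub>m r m *\<^sub>v u))"
      unfolding mat_mult_append[OF C1(1) C2(1) w'] mat_mult_append[OF CDEF(2) DF uc]
      by (simp only: w(1) C1(2)[OF w(2) x1] C2(2)[OF w(2) x1] E'_eq[OF w(2) x1 uc] gamma_fun_def \<Gamma>' option.case)
    finally show "T' *\<^sub>v (\<Phi> x + B *\<^sub>v u) =
        (gamma_fun (Some \<Gamma>') x2 + (C1 @\<^sub>r C2) *\<^sub>v w' + (D @\<^sub>r (Dk * F)) *\<^sub>v u) @\<^sub>v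
        (\<Phi>2 x2 + B2 *\<^sub>v (E' *\<^sub>v w' + 0\<^sub>m r m *\<^sub>v u))" .
  qed (use C1 C2 E' CDEF(2) DF in auto)
  \<comment> \<open>The algorithm projects the domain again in every pass, whereas the invariant
    projects \<open>X\<close> at once; the resulting sets agree.\<close>
  moreover have "proj_second r s ((*\<^sub>v) Ts ` S) = proj_second (n - s) s ((*\<^sub>v) T' ` X)"
  proof (intro subset_antisym subsetI)
    fix x2 assume "x2 \<in> proj_second r s ((*\<^sub>v) Ts ` S)"
    then obtain x1 z where x: "x2 \<in> carrier_vec s" "x1 \<in> carrier_vec r" "z \<in> S" "x1 @\<^sub>v x2 = Ts *\<^sub>v z"
      unfolding proj_second_def image_iff mem_Collect_eq by blast
    obtain y w where y: "y \<in> X" "w \<in> carrier_vec (n - k)" "T *\<^sub>v y = w @\<^sub>v z" using c(4)[OF x(3)] by blast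
    have "(w @\<^sub>v x1) @\<^sub>v x2 = T' *\<^sub>v y"
      using T'_eq[OF X_carrier[OF y(1)] y(2) c(1)[OF x(3)] y(3)] x(4) by (simp add: append_vec_assoc)
    then show "x2 \<in> proj_second (n - s) s ((*\<^sub>v) T' ` X)"
      unfolding proj_second_def using x(1,2) y(1,2) rs(3) append_carrier_vec[OF y(2) x(2)] by auto
  next
    fix x2 assume "x2 \<in> proj_second (n - s) s ((*\<^sub>v) T' ` X)"
    then obtain w' x where x: "x2 \<in> carrier_vec s" "w' \<in> carrier_vec (n - s)" "x \<in> X" "T' *\<^sub>v x = w' @\<^sub>v x2"
      unfolding proj_second_def image_iff mem_Collect_eq by metis
    obtain w x1 z where w: "w \<in> carrier_vec (n - k)" and x1: "x1 \<in> carrier_vec r"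
      and z: "z \<in> carrier_vec k" "T *\<^sub>v x = w @\<^sub>v z" "Ts *\<^sub>v z = x1 @\<^sub>v x2"
      using T'_split[OF X_carrier[OF x(3)] x(2,1,4)] by blast
    have "x1 @\<^sub>v x2 \<in> (*\<^sub>v) Ts ` S"
      using imageI[OF S_I[OF x(3) w z(1,2)], of "(*\<^sub>v) Ts"] unfolding z(3) .
    then show "x2 \<in> proj_second r s ((*\<^sub>v) Ts ` S)" unfolding proj_second_def using x(1) x1 by blast
  qed
  ultimately show "loop_invariant s r (proj_second r s ((*\<^sub>v) Ts ` S)) \<Phi>2 B2 (Some \<Gamma>') (block_id (n - k) Ts * T)"
    unfolding loop_invariant_def T'_def[symmetric] using rs B12 T' \<open>invertible_mat T'\<close> by blast
  show "reached_in W s (block_id (n - k) Ts * T)"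
    if "X \<noteq> {}" and W: "invariant_directions W" "reached_in W k T"
    unfolding T'_def[symmetric] reached_in_def
  proof (intro ballI impI)
    fix x w' assume x: "x \<in> carrier_vec n" and w': "w' \<in> carrier_vec (n - s)" and Tx: "T' *\<^sub>v x = w' @\<^sub>v 0\<^sub>v s"
    obtain w x1 z where w: "w \<in> carrier_vec (n - k)" and x1: "x1 \<in> carrier_vec r"
      and z: "z \<in> carrier_vec k" "T *\<^sub>v x = w @\<^sub>v z" "Ts *\<^sub>v z = x1 @\<^sub>v 0\<^sub>v s" "z = Tsi *\<^sub>v (x1 @\<^sub>v 0\<^sub>v s)"
      using T'_split[OF x w' zero_carrier_vec Tx] by blast
    \<comment> \<open>\<open>Dk\<close> is onto, so every newly split-off x1 is produced by some
      input; its z then lies in the range of \<open>Bk\<close>.\<close>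
    obtain v where v: "v \<in> carrier_vec l" "Dk *\<^sub>v v = x1" using co(9)[of x1] x1 by (auto simp: r_def)
    have "Bk *\<^sub>v v = z"
      using mult_mat_vec_inverse[OF co(2,1,4), of "Bk *\<^sub>v v"] Bk v co(8)[OF v(1)] z(4) by (simp add: s_def)
    then show "x \<in> W" using reached_range[OF inv W \<open>X \<noteq> {}\<close> x w v(1)] z(2) by simp
  qed
qed


section \<open>Flag 1 yields the CAP form\<close>

lemma cap_form_if_empty: "X = {} \<Longrightarrow> cap_form n m X U \<Phi> B T"
  unfolding cap_form_def
  by (intro exI[of _ n] exI[of _ 0] conjI bexI[of _ "\<lambda>_. 0\<^sub>v n"] bexI[of _ "\<lambda>_. 0\<^sub>v 0"]
      bexI[of _ "0\<^sub>m n n"] bexI[of _ "0\<^sub>m n m"]) auto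

text \<open>The subsystem is autonomous here, so w and z serve as the first and the second block of
  the CAP form.\<close>

lemma cap_form_if_zero:
  assumes inv: "loop_invariant k l S \<Psi> Bk \<Gamma> T" and zero: "Bk = 0\<^sub>m k l"
  shows "cap_form n m X U \<Phi> B T"
proof -
  obtain C D E F where dyn: "subsystem_dynamics k l \<Psi> Bk \<Gamma> T C D E F"
    using inv unfolding loop_invariant_def by blast
  have k: "n - k + k = n" using inv by (auto simp: loop_invariant_def)
  have CDEF: "C \<in> carrier_mat (n - k) (n - k)" "D \<in> carrier_mat (n - k) m"
    "E \<in> carrier_mat l (n - k)" "F \<in> carrier_mat l m"
    using dyn by (auto simp: subsystem_dynamics_def)
  note c = loop_invariant_carrier[OF inv]
  \<comment> \<open>The CAP form asks for functions on whole vector spaces. Outside \<open>S\<close>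
    nothing is known about the dimension of the values, so they are set to zero.\<close>
  define g where "g z = (if z \<in> S then gamma_fun \<Gamma> z else 0\<^sub>v (n - k))" for z
  define h where "h z = (if z \<in> S then \<Psi> z else 0\<^sub>v k)" for z
  have gh: "g \<in> carrier_vec k \<rightarrow> carrier_vec (n - k)" "h \<in> carrier_vec k \<rightarrow> carrier_vec k"
    using c by (auto simp: g_def h_def)
  have "T *\<^sub>v (\<Phi> x + B *\<^sub>v u) = (g z + C *\<^sub>v w + D *\<^sub>v u) @\<^sub>v h z"
    if x: "x \<in> X" and u: "u \<in> U" and w: "w \<in> carrier_vec (n - k)" and z: "z \<in> carrier_vec k"
      and Tx: "T *\<^sub>v x = w @\<^sub>v z" for x u w z
  proof -
    have zS: "z \<in> S" using loop_invariant_memI[OF inv x w z Tx] .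
    have "E *\<^sub>v w + F *\<^sub>v u \<in> carrier_vec l" using CDEF w U_carrier[OF u] by auto
    then have "\<Psi> z + Bk *\<^sub>v (E *\<^sub>v w + F *\<^sub>v u) = \<Psi> z"
      unfolding zero using c(3)[OF zS] by (intro eq_vecI) auto
    moreover have "T *\<^sub>v (\<Phi> x + B *\<^sub>v u) =
        (gamma_fun \<Gamma> z + C *\<^sub>v w + D *\<^sub>v u) @\<^sub>v (\<Psi> z + Bk *\<^sub>v (E *\<^sub>v w + F *\<^sub>v u))"
      using dyn x u w z Tx unfolding subsystem_dynamics_def by blast
    ultimately show ?thesis using zS by (simp add: g_def h_def)
  qed
  then show ?thesis using k gh CDEF(1,2) unfolding cap_form_def by blast
qed

text \<open>The full system is affine in this case, so the second CAP block is taken empty and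
  \<open>g\<close> is the constant q stacked on p.\<close>

lemma cap_form_if_affine:
  assumes inv: "loop_invariant k l S \<Psi> Bk \<Gamma> T" and aff: "affine_map_on k S \<Psi>" "pred_option (affine_map_on k S) \<Gamma>"
  shows "cap_form n m X U \<Phi> B T"
proof (cases "X = {}")
  case True
  then show ?thesis by (rule cap_form_if_empty)
next
  case False
  obtain C D E F where dyn: "subsystem_dynamics k l \<Psi> Bk \<Gamma> T C D E F"
    using inv unfolding loop_invariant_def by blast
  have k: "n - k + k = n" and T: "T \<in> carrier_mat n n" and Bk: "Bk \<in> carrier_mat k l"
    using inv by (auto simp: loop_invariant_def)
  have CDEF: "C \<in> carrier_mat (n - k) (n - k)" "D \<in> carrier_mat (n - k) m"
    "E \<in> carrier_mat l (n - k)" "F \<in> carrier_mat l m"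
    using dyn by (auto simp: subsystem_dynamics_def)
  note c = loop_invariant_carrier[OF inv]
  have split: "\<exists>w\<in>carrier_vec (n - k). \<exists>z\<in>carrier_vec k. T *\<^sub>v x = w @\<^sub>v z" if "x \<in> X" for x
  proof -
    have "T *\<^sub>v x \<in> carrier_vec (n - k + k)" using T X_carrier[OF that] k by simp
    then show ?thesis using append_vec_obtain by metis
  qed
  obtain z0 where z0: "z0 \<in> S" using False split loop_invariant_memI[OF inv] by blast
  have affG: "affine_map_on k S (gamma_fun \<Gamma>)"
  proof (cases \<Gamma>)
    case None
    show ?thesis unfolding affine_map_on_def gamma_fun_def None
      by (intro exI[of _ 0] bexI[of _ vNil] bexI[of _ "0\<^sub>m 0 k"]) (auto intro!: eq_vecI)
  qed (use aff(2) in \<open>simp add: gamma_fun_def\<close>)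
  \<comment> \<open>The affineness test leaves the number of components open; the value at
    \<open>z0\<close> determines it. This is why a point of \<open>S\<close> is required.\<close>
  have dims: "\<exists>c\<in>carrier_vec q. \<exists>A\<in>carrier_mat q k. \<forall>z\<in>S. f z = c + A *\<^sub>v z"
    if "affine_map_on k S f" and fq: "f z0 \<in> carrier_vec q" for f q
  proof -
    obtain q' c0 A where q': "c0 \<in> carrier_vec q'" "A \<in> carrier_mat q' k" "\<forall>z\<in>S. f z = c0 + A *\<^sub>v z"
      using \<open>affine_map_on k S f\<close> unfolding affine_map_on_def by blast
    have "dim_vec (f z0) = q'" using q' z0 by simp
    then have "q' = q" using fq by simp
    with q' show ?thesis by blast
  qed
  obtain p P where pP: "p \<in> carrier_vec k" "P \<in> carrier_mat k k" "\<And>z. z \<in> S \<Longrightarrow> \<Psi> z = p + P *\<^sub>v z"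
    using dims[OF aff(1) c(3)[OF z0]] by blast
  obtain q Q where qQ: "q \<in> carrier_vec (n - k)" "Q \<in> carrier_mat (n - k) k"
    "\<And>z. z \<in> S \<Longrightarrow> gamma_fun \<Gamma> z = q + Q *\<^sub>v z"
    using dims[OF affG c(2)[OF z0]] by blast
  have BE: "Bk * E \<in> carrier_mat k (n - k)" and BF: "Bk * F \<in> carrier_mat k m" using Bk CDEF by auto
  let ?C = "four_block_mat C Q (Bk * E) P" and ?D = "D @\<^sub>r (Bk * F)" and ?g = "q @\<^sub>v p"
  have C: "?C \<in> carrier_mat n n" using four_block_carrier_mat[OF CDEF(1) pP(2)] k by simp
  have D: "?D \<in> carrier_mat n m" using carrier_append_rows[OF CDEF(2) BF] k by simp
  have g: "?g \<in> carrier_vec n" using append_carrier_vec[OF qQ(1) pP(1)] k by simp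
  have "T *\<^sub>v (\<Phi> x + B *\<^sub>v u) = (?g + ?C *\<^sub>v x1 + ?D *\<^sub>v u) @\<^sub>v 0\<^sub>v 0"
    if x: "x \<in> X" and u: "u \<in> U" and x1: "x1 \<in> carrier_vec n" and x2: "x2 \<in> carrier_vec 0"
      and Tx: "T *\<^sub>v x = x1 @\<^sub>v x2" for x u x1 x2
  proof -
    note uc = U_carrier[OF u]
    obtain w z where w: "w \<in> carrier_vec (n - k)" and z: "z \<in> carrier_vec k" and Tx': "T *\<^sub>v x = w @\<^sub>v z"
      using split[OF x] by blast
    have "x1 @\<^sub>v x2 = x1" using x2 by (intro eq_vecI) auto
    then have x1_eq: "x1 = w @\<^sub>v z" using Tx Tx' by simp
    have zS: "z \<in> S" using loop_invariant_memI[OF inv x w z Tx'] .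
    have EF: "E *\<^sub>v w \<in> carrier_vec l" "F *\<^sub>v u \<in> carrier_vec l" using CDEF w uc by auto
    have "T *\<^sub>v (\<Phi> x + B *\<^sub>v u) =
        (gamma_fun \<Gamma> z + C *\<^sub>v w + D *\<^sub>v u) @\<^sub>v (\<Psi> z + Bk *\<^sub>v (E *\<^sub>v w + F *\<^sub>v u))"
      using dyn x u w z Tx' unfolding subsystem_dynamics_def by blast
    also have "Bk *\<^sub>v (E *\<^sub>v w + F *\<^sub>v u) = (Bk * E) *\<^sub>v w + (Bk * F) *\<^sub>v u"
      using mult_add_distrib_mat_vec[OF Bk EF] assoc_mult_mat_vec[OF Bk CDEF(3) w]
        assoc_mult_mat_vec[OF Bk CDEF(4) uc] by simp
    also have "(gamma_fun \<Gamma> z + C *\<^sub>v w + D *\<^sub>v u) @\<^sub>v (\<Psi> z + ((Bk * E) *\<^sub>v w + (Bk * F) *\<^sub>v u))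
      = (?g + ((C *\<^sub>v w + Q *\<^sub>v z) @\<^sub>v ((Bk * E) *\<^sub>v w + P *\<^sub>v z)) + ((D *\<^sub>v u) @\<^sub>v ((Bk * F) *\<^sub>v u))) @\<^sub>v 0\<^sub>v 0"
      unfolding qQ(3)[OF zS] pP(3)[OF zS] using qQ(1,2) pP(1,2) CDEF Bk by (intro eq_vecI) auto
    also have "(C *\<^sub>v w + Q *\<^sub>v z) @\<^sub>v ((Bk * E) *\<^sub>v w + P *\<^sub>v z) = ?C *\<^sub>v x1"
      unfolding x1_eq by (rule four_block_mat_mult_vec[OF CDEF(1) qQ(2) BE pP(2) w z, symmetric])
    also have "(D *\<^sub>v u) @\<^sub>v ((Bk * F) *\<^sub>v u) = ?D *\<^sub>v u"
      by (rule mat_mult_append[OF CDEF(2) BF uc, symmetric])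
    finally show ?thesis .
  qed
  then show ?thesis
    unfolding cap_form_def using C D g
    by (intro exI[of _ n] exI[of _ 0] conjI bexI[of _ "\<lambda>_. ?g"] bexI[of _ "\<lambda>_. 0\<^sub>v 0"]
        bexI[of _ ?C] bexI[of _ ?D]) auto
qed


section \<open>Outcomes of a pass and length of a run\<close>

lemma cap_form_if_Flag1:
  assumes inv: "loop_invariant k l S \<Psi> Bk \<Gamma> T" and "SCD S \<Psi> Bk \<Gamma> Flag1"
  shows "cap_form n m X U \<Phi> B T"
proof -
  have dim: "dim_row Bk = k" "dim_col Bk = l" using inv by (auto simp: loop_invariant_def)
  from assms(2) show ?thesis
    by (elim SCD_Flag1E) (use dim cap_form_if_affine[OF inv] cap_form_if_zero[OF inv] in auto)
qed

lemma not_Flag2: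
  assumes inv: "loop_invariant k l S \<Psi> Bk \<Gamma> T" and W: "invariant_directions W"
    and reach: "X \<noteq> {} \<Longrightarrow> reached_in W k T"
  shows "\<not> SCD S \<Psi> Bk \<Gamma> Flag2"
proof
  have dim: "dim_row Bk = k" using inv by (auto simp: loop_invariant_def)
  assume "SCD S \<Psi> Bk \<Gamma> Flag2"
  then show False
  proof (elim SCD_Flag2E, goal_cases)
    case 1
    then show ?case using full_row_rank_affine[OF inv W reach] by (auto simp: dim)
  next
    case (2 Ts Tsi D)
    then show ?case using split_affine_exists[OF inv W reach, of Ts Tsi D] unfolding dim by blast
  qed
qed

lemma Flag0_step:
  assumes inv: "loop_invariant k l S \<Psi> Bk \<Gamma> T" and "SCD S \<Psi> Bk \<Gamma> (Flag0 \<Phi>' B' \<Gamma>' Ts)"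
  obtains k' l' where "k' < k"
    "loop_invariant k' l' (proj_second (dim_row Bk - dim_row B') (dim_row B') ((*\<^sub>v) Ts ` S)) \<Phi>' B' \<Gamma>'
      (block_id (n - dim_row Bk) Ts * T)"
    "\<And>W. X \<noteq> {} \<Longrightarrow> invariant_directions W \<Longrightarrow> reached_in W k T \<Longrightarrow>
      reached_in W k' (block_id (n - dim_row Bk) Ts * T)"
proof -
  have Bk: "Bk \<in> carrier_mat k l" using inv by (auto simp: loop_invariant_def)
  have dim: "dim_row Bk = k" "dim_col Bk = l" using Bk by auto
  obtain Tsi Dk G where nf: "\<not> full_row_rank Bk" and nz: "Bk \<noteq> 0\<^sub>m k l" and coords: "scd_coords Bk Ts Tsi Dk"
    and aff: "scd_affine (dim_row Dk) (k - dim_row Dk) S \<Psi> \<Gamma> Ts Tsi \<Phi>' B' G" and \<Gamma>': "\<Gamma>' = Some G"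
    using assms(2) unfolding dim[symmetric] by (elim SCD_Flag0E) blast
  let ?s = "k - dim_row Dk"
  have r: "0 < dim_row Dk" "dim_row Dk < k" using scd_coords_dim[OF coords Bk nf nz] by auto
  note step = loop_invariant_step[OF inv coords nf nz aff]
  \<comment> \<open>The loop infers the block sizes from the rows of \<open>B'\<close>; the new
    invariant shows that these are the rows left after the split.\<close>
  have row: "dim_row B' = ?s" using step(1) by (auto simp: loop_invariant_def)
  have diff: "dim_row Bk - dim_row B' = dim_row Dk" using dim r row by auto
  show ?thesis
  proof (rule that[of ?s "dim_row Dk"])
    show "?s < k" using r by simp
    show "loop_invariant ?s (dim_row Dk) (proj_second (dim_row Bk - dim_row B') (dim_row B') ((*\<^sub>v) Ts ` S))
        \<Phi>' B' \<Gamma>' (block_id (n - dim_row Bk) Ts * T)"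
      unfolding diff unfolding row dim(1) \<Gamma>' by (rule step(1))
    show "reached_in W ?s (block_id (n - dim_row Bk) Ts * T)"
      if "X \<noteq> {}" "invariant_directions W" "reached_in W k T" for W
      unfolding dim(1) by (rule step(2)[OF that])
  qed
qed

text \<open>Flag 2 remains as a possible outcome, since nothing contradicts it without
  \<open>W\<close> and the bound on the run length covers both answers.\<close>

lemma iteration_from_invariant:
  assumes inv: "loop_invariant k l S \<Psi> Bk \<Gamma> T" and "iteration n (Running S \<Psi> Bk \<Gamma> T) s"
  shows "(\<exists>k' l' S' \<Psi>' Bk' \<Gamma>' T'. s = Running S' \<Psi>' Bk' \<Gamma>' T' \<and> k' < k \<and> loop_invariant k' l' S' \<Psi>' Bk' \<Gamma>' T' \<and>
      (\<forall>W. X \<noteq> {} \<longrightarrow> invariant_directions W \<longrightarrow> reached_in W k T \<longrightarrow> reached_in W k' T')) \<or>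
    s = Returned (Exists T) \<and> cap_form n m X U \<Phi> B T \<or>
    s = Returned Does_not_exist \<and> SCD S \<Psi> Bk \<Gamma> Flag2"
  using assms(2)
proof (rule iteration_RunningE)
  fix \<Phi>' B' \<Gamma>' Ts
  assume s: "s = Running (proj_second (dim_row Bk - dim_row B') (dim_row B') ((*\<^sub>v) Ts ` S)) \<Phi>' B' \<Gamma>'
      (block_id (n - dim_row Bk) Ts * T)" and scd: "SCD S \<Psi> Bk \<Gamma> (Flag0 \<Phi>' B' \<Gamma>' Ts)"
  show ?thesis using Flag0_step[OF inv scd] s by metis
qed (use cap_form_if_Flag1[OF inv] in auto)

text \<open>\<open>k\<close> drops with every pass that continues and never falls below 1. So at
  most \<open>k - 1\<close> passes continue, and one more returns.\<close>

lemma run_length: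
  assumes "loop_invariant k l S \<Psi> Bk \<Gamma> T" "(iteration n ^^ j) (Running S \<Psi> Bk \<Gamma> T) s"
  shows "j \<le> k"
  using assms
proof (induction j arbitrary: k l S \<Psi> Bk \<Gamma> T)
  case (Suc j)
  have k: "1 \<le> k" using Suc.prems(1) by (simp add: loop_invariant_def)
  obtain s1 where s1: "iteration n (Running S \<Psi> Bk \<Gamma> T) s1" "(iteration n ^^ j) s1 s"
    using Suc.prems(2) by (blast elim: relpowp_Suc_E2)
  \<comment> \<open>A returned state has no successor; the pass that produced it is paid for by
    \<open>1 \<le> k\<close>.\<close>
  have ret: "Suc j \<le> k" if res: "s1 = Returned res" for res
  proof -
    have "j = 0"
    proof (rule ccontr)
      assume "j \<noteq> 0"
      then obtain j' where "j = Suc j'" by (cases j) auto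
      then obtain s2 where "iteration n (Returned res) s2"
        using s1(2) res by (blast elim: relpowp_Suc_E2)
      then show False by (cases rule: iteration.cases)
    qed
    then show ?thesis using k by simp
  qed
  from iteration_from_invariant[OF Suc.prems(1) s1(1)] show ?case
  proof (elim disjE exE conjE)
    fix k' l' S' \<Psi>' Bk' \<Gamma>' T'
    assume s1_eq: "s1 = Running S' \<Psi>' Bk' \<Gamma>' T'" and "k' < k" "loop_invariant k' l' S' \<Psi>' Bk' \<Gamma>' T'"
    then show ?thesis using Suc.IH[of k' l' S' \<Psi>' Bk' \<Gamma>' T'] s1(2) by simp
  qed (rule ret, assumption)+
qed simp

text \<open>Without states all predictors exist trivially, so the answer must be positive; this
  supplies a \<open>W\<close> where no trajectory could.\<close>

lemma invariant_directions_if_empty: "X = {} \<Longrightarrow> invariant_directions (carrier_vec n)"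
  unfolding invariant_directions_def affine_direction_def
  using B_carrier by (intro conjI ballI allI bexI[of _ "0\<^sub>v n"]) auto

text \<open>A run does not depend on \<open>W\<close>, so the clause for running states ranges over
  all of them. The negative answer is recorded as the absence of \<open>W\<close>, which the
  construction of \<open>W\<close> from predictors turns into their absence.\<close>

definition state_ok :: "alg_state \<Rightarrow> bool" where
  "state_ok s \<longleftrightarrow> (case s of
     Running S \<Psi> Bk \<Gamma> T \<Rightarrow> (\<exists>k l. loop_invariant k l S \<Psi> Bk \<Gamma> T \<and>
       (\<forall>W. X \<noteq> {} \<longrightarrow> invariant_directions W \<longrightarrow> reached_in W k T))
   | Returned (Exists T) \<Rightarrow> T \<in> carrier_mat n n \<and> invertible_mat T \<and> cap_form n m X U \<Phi> B T
   | Returned Does_not_exist \<Rightarrow> \<not> (\<exists>W. invariant_directions W))"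

lemma state_ok_reachable:
  assumes "n \<ge> 1" "(iteration n)\<^sup>*\<^sup>* (alg_init n X \<Phi> B) s"
  shows "state_ok s"
  using assms(2)
proof (induction rule: rtranclp_induct)
  case base
  \<comment> \<open>At the start the condition concerns only x = 0, which is in \<open>W\<close> as
    the image of 0 under \<open>B\<close>.\<close>
  have "x \<in> W" if "X \<noteq> {}" "invariant_directions W" "x \<in> carrier_vec n" "w \<in> carrier_vec (n - n)"
    "1\<^sub>m n *\<^sub>v x = w @\<^sub>v 0\<^sub>v n" for W x w
  proof -
    have "w @\<^sub>v 0\<^sub>v n = 0\<^sub>v n" using that(4) by (intro eq_vecI) auto
    then have "x = B *\<^sub>v 0\<^sub>v m" using that(3,5) B_carrier by (auto intro!: eq_vecI)
    then show ?thesis using that(2) unfolding invariant_directions_def by auto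
  qed
  then have "reached_in W n (1\<^sub>m n)" if "X \<noteq> {}" "invariant_directions W" for W
    using that unfolding reached_in_def by blast
  then show ?case
    using loop_invariant_init[OF assms(1)] unfolding state_ok_def alg_init_def alg_state.case by blast
next
  case (step s s')
  then obtain S \<Psi> Bk \<Gamma> T where s: "s = Running S \<Psi> Bk \<Gamma> T" by (auto elim: iteration.cases)
  then obtain k l where inv: "loop_invariant k l S \<Psi> Bk \<Gamma> T"
    and reach: "\<And>W. X \<noteq> {} \<Longrightarrow> invariant_directions W \<Longrightarrow> reached_in W k T"
    using step.IH by (auto simp: state_ok_def)
  have T: "T \<in> carrier_mat n n" "invertible_mat T" using inv by (auto simp: loop_invariant_def)
  from iteration_from_invariant[OF inv] step.hyps(2) s
  consider (run) k' l' S' \<Psi>' Bk' \<Gamma>' T' where "s' = Running S' \<Psi>' Bk' \<Gamma>' T'"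
      "loop_invariant k' l' S' \<Psi>' Bk' \<Gamma>' T'"
      "\<And>W. X \<noteq> {} \<Longrightarrow> invariant_directions W \<Longrightarrow> reached_in W k T \<Longrightarrow> reached_in W k' T'"
    | (yes) "s' = Returned (Exists T)" "cap_form n m X U \<Phi> B T"
    | (no) "s' = Returned Does_not_exist" "SCD S \<Psi> Bk \<Gamma> Flag2"
    by metis
  then show ?case
  proof cases
    case run
    then show ?thesis using reach unfolding state_ok_def run(1) alg_state.case by blast
  next
    case yes
    then show ?thesis using T by (simp add: state_ok_def)
  next
    case no
    then show ?thesis using not_Flag2[OF inv] reach by (auto simp: state_ok_def)
  qed
qed

end

theorem proposition3:
  fixes n m :: nat
    and X U :: "real vec set"
    and \<Phi> :: "real vec \<Rightarrow> real vec"
    and B :: "real mat"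
  assumes "n \<ge> 1"
    and "open_vec n X"
    and "convex_vec X"
    and "open_vec m U"
    and "\<Phi> \<in> X \<rightarrow> carrier_vec n"
    and "B \<in> carrier_mat n m"
    and "(\<lambda>(x, u). \<Phi> x + B *\<^sub>v u) ` (X \<times> U) = X"
  shows "terminates_within n n (alg_init n X \<Phi> B) \<and>
    (admits_inf_predictor n m X U \<Phi> B \<longrightarrow>
      (\<forall>res. returns n (alg_init n X \<Phi> B) res \<longrightarrow>
        (\<exists>T \<in> carrier_mat n n. res = Exists T \<and> invertible_mat T \<and> cap_form n m X U \<Phi> B T))) \<and>
    (\<not> admits_inf_predictor n m X U \<Phi> B \<longrightarrow>
      (\<forall>res. returns n (alg_init n X \<Phi> B) res \<longrightarrow> res = Does_not_exist))"
proof -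
  interpret control_system n m X U \<Phi> B
    by (rule control_system.intro[OF assms(2-7)])
  note ok = state_ok_reachable[OF assms(1)]
  have "terminates_within n n (alg_init n X \<Phi> B)"
    unfolding terminates_within_def
  proof (intro conjI allI impI)
    show "j \<le> n" if "(iteration n ^^ j) (alg_init n X \<Phi> B) s" for j s
      using run_length[OF loop_invariant_init[OF assms(1)]] that unfolding alg_init_def .
    show "(\<exists>res. s = Returned res) \<or> (\<exists>s'. iteration n s s')" for s
      using iteration_total by (cases s) blast+
  qed
  moreover have "\<exists>T \<in> carrier_mat n n. res = Exists T \<and> invertible_mat T \<and> cap_form n m X U \<Phi> B T"
    if "admits_inf_predictor n m X U \<Phi> B" "returns n (alg_init n X \<Phi> B) res" for res
  proof -
    \<comment> \<open>For nonempty as for empty \<open>X\<close> some \<open>W\<close> exists, which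
      rules out the negative answer.\<close>
    have "\<exists>W. invariant_directions W"
      using invariant_directions_if_predictor[OF that(1)] invariant_directions_if_empty by blast
    then show ?thesis
      using ok[OF that(2)[unfolded returns_def]] by (cases res) (auto simp: state_ok_def)
  qed
  \<comment> \<open>A positive answer would come with an invertible \<open>T\<close> and the CAP
    form, and these produce the missing predictors.\<close>
  moreover have "res = Does_not_exist"
    if "\<not> admits_inf_predictor n m X U \<Phi> B" "returns n (alg_init n X \<Phi> B) res" for res
    using ok[OF that(2)[unfolded returns_def]] predictor_if_cap_form that(1)
    by (cases res) (auto simp: state_ok_def)
  ultimately show ?thesis by blast
qed

end
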